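(* Let $r\ge0$, $q=r+1$, $p\ge1$, $d_h,\rho_h>0$ ($1\le h\le r$), $\widehat a_*\in\mathbb R$, and let the real column nodes $\xi_1,\dots,\xi_p$ be pairwise distinct with $\xi_i+\rho_h>0$ for all $i,h$. Fix a Laguerre-admissible row index $\boldsymbol\lambda=(n_1,\dots,n_r,\eta)\in\mathbb N_0^{r+1}$ (entries pairwise differing by at most one), and suppose that the rates $\rho_h$ with $n_h>0$ are pairwise distinct. For each of the balances $|\boldsymbol m|=|\boldsymbol\lambda|+1$ and $|\boldsymbol\lambda|=|\boldsymbol m|+1$ ($\boldsymbol m\in\mathbb N_0^p$ fixed), respectively, the transformed $A$- and $B$-problems, i.e. those of the matrix $[V_{j,\tau}(t)\mathrm e^{\xi_it}]_{j,i}\,\mathrm dt$ of the context, are weakly normal for all sufficiently large $\tau$. In the respective balance let $\boldsymbol A^{\mathrm H}$, $\boldsymbol B^{\mathrm H}$ be the (unique up to scalar) nonzero solution vectors of the $A$- and $B$-problems for the Hermite matrix $[U_j^{\mathrm H}(t)\mathrm e^{\xi_it}]_{j,i}\,\mathrm dt$; choose one nonzero coefficient of the limiting vector and normalize it to one, and use the same coefficient to normalize the solution vectors $\widetilde{\boldsymbol A}_\tau$, $\widetilde{\boldsymbol B}_\tau$ of the transformed problems. Then $$\widetilde{\boldsymbol A}_\tau\xrightarrow[\tau\to+\infty]{}\boldsymbol A^{\mathrm H},\qquad\widetilde{\boldsymbol B}_\tau\xrightarrow[\tau\to+\infty]{}\boldsymbol B^{\mathrm H}$$ coefficientwise, with error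 $\mathrm O(\tau^{-1/2})$ in every coefficient as $\tau\to+\infty$. The transformed $A$-problems are strongly normal for sufficiently large $\tau$. The same conclusion holds for $B$ whenever $\det C[(j,\lambda_j-1)\leftarrow\mathbf p]\ne0$ for every $j$ with $\lambda_j>0$.
   Context: $\kappa_{\rho,d}(u)=\frac{\rho^d}{\Gamma(d)}u^{d-1}\mathrm e^{-\rho u}\mathbf 1_{(0,\infty)}(u)$; $(K_{\rho,d}f)(t)=\int_0^\infty\kappa_{\rho,d}(u)f(t+u)\,\mathrm du$; $\phi_a(t)=\pi^{-1/2}\mathrm e^{-(t-a)^2}$; $F=K_{\rho_1,d_1}\cdots K_{\rho_r,d_r}\phi_{\widehat a_*}$; $U_h^{\mathrm H}=K_{\rho_h,1}F$ ($h\le r$), $U_q^{\mathrm H}=F$; $\lambda_h=n_h$ ($h\le r$), $\lambda_q=\eta$. Transformed rows: $h_\tau=\sqrt{2\tau}$, $\boldsymbol d_\tau=(d_1,\dots,d_r,\tau)$, $\boldsymbol\varrho_\tau=(\rho_1/h_\tau,\dots,\rho_r/h_\tau,1)$, $f_{j,\tau}=\kappa_{\varrho_{1,\tau},d_{1,\tau}+\delta_{1,j}}*_+\cdots*_+\kappa_{\varrho_{q,\tau},d_{q,\tau}+\delta_{q,j}}$ with $(f*_+g)(y)=\int_0^yf(u)g(y-u)\,\mathrm du$, $V_{j,\tau}(t)=h_\tau f_{j,\tau}(y_\tau(t))$, $y_\tau(t)=\tau+h_\tau(\widehat a_*-t)$. (Relation to the original Laguerre matrix of the second kind, with rows $F^{\mathrm{II}}_{j;\tau}=f_{j,\tau}/\sigma_{j,\tau}$,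 $\sigma_{j,\tau}=\varrho_{j,\tau}\prod_h\varrho_{h,\tau}^{d_{h,\tau}}$, and columns $\mathrm e^{-\xi_iy/h_\tau}$: component vectors transform as $\widetilde A^{(i)}_\tau(t)=\mathrm e^{-\xi_i(\tau/h_\tau+\widehat a_* )}A^{(i),\mathrm{II}}_\tau(y_\tau(t))$, $\widetilde B^{(j)}_\tau(t)=\sigma_{j,\tau}^{-1}B^{(j),\mathrm{II}}_\tau(y_\tau(t))$.) For a matrix $[U_jV_i]$ of weights on $\mathbb R$: $A$-problem: polynomial vectors $(A_i)_{i\le p}$, $\deg A_i\le m_i-1$, with $\int t^kU_j\sum_iA_iV_i\,\mathrm dt=0$, $0\le k<\lambda_j$, in the balance $|\boldsymbol m|=|\boldsymbol\lambda|+1$. $B$-problem: $(B_j)_{j\le q}$, $\deg B_j\le\lambda_j-1$, with $\int t^kV_i\sum_jB_jU_j\,\mathrm dt=0$, $0\le k<m_i$, in the balance $|\boldsymbol\lambda|=|\boldsymbol m|+1$. Zero index = zero component. Weakly normal = one-dimensional solution space; strongly normal = additionally every component with positive index attains its maximal degree. The limiting Hermite problems are weakly normal under the stated hypotheses. $C$ and $\mathbf p$ (with $N=|\boldsymbol\lambda|$, $|\boldsymbol m|=N-1$): $L_F(z)=\mathrm e^{\widehat a_*z+z^2/4}\prod_h(\rho_h/(\rho_h+z))^{d_h}$, $\Lambda_h=\frac{\rho_h}{\rho_h+z}L_F$ ($h\le r$), $\Lambda_q=L_F$, $\mathrm e^{uz-z^2/4}=\sum_\ell H_\ell(u)z^\ell/\ell!$,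 $\Phi_{j,k}=\frac{\prod_h(\rho_h+z)^{n_h}}{L_F}H_k(\partial_z)\Lambda_j$ (polynomials of degree $<N$), $C_{\nu,(j,k)}=[z^\nu]\Phi_{j,k}$ for $0\le\nu<N$, $1\le j\le q$, $0\le k<\lambda_j$; $p_\nu=[z^\nu]\prod_i(\xi_i-z)^{m_i}$; $C[(j,k)\leftarrow\mathbf p]$ replaces column $(j,k)$ by $\mathbf p$. *)

theory Defs
  imports
    "HOL-Analysis.Analysis"
    "HOL-Library.Landau_Symbols"
    "HOL-Library.Function_Algebras"
    "HOL-Computational_Algebra.Polynomial"
    "Jordan_Normal_Form.Determinant"
begin

text \<open>
  All families (\<open>\<rho>\<close>, \<open>d\<close>, \<open>\<xi>\<close>, rows, columns, multi-indices) are functions on \<open>nat\<close> that are only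
  used at the indices \<open>1..r\<close>, \<open>1..p\<close>, \<open>1..q\<close>, where \<open>q = r + 1\<close>. A row multi-index
  \<open>(n\<^sub>1, \<dots>, n\<^sub>r, \<eta>)\<close> is a single function \<open>lam\<close> with \<open>lam h = n\<^sub>h\<close> for \<open>h \<le> r\<close> and
  \<open>lam (r + 1) = \<eta>\<close>.
\<close>

section \<open>Mixed orthogonality problems and normality\<close>

text \<open>
  Polynomial vectors of length \<open>s\<close> vanish outside \<open>{1..s}\<close>, so that they form an honest
  finite-dimensional real vector space inside \<open>nat \<Rightarrow> real poly\<close>.
\<close>

definition poly_vectors :: "nat \<Rightarrow> (nat \<Rightarrow> nat) \<Rightarrow> (nat \<Rightarrow> real poly) set" where
  "poly_vectors s m =
     {A. (\<forall>i\<in>{1..s}. if m i = 0 then A i = 0 else degree (A i) \<le> m i - 1) \<and>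
         (\<forall>i. i \<notin> {1..s} \<longrightarrow> A i = 0)}"

text \<open>
  The orthogonality relations include the existence of the integral; a bare
  \<open>integral\<^sup>L lborel f = 0\<close> would also hold for every non-integrable \<open>f\<close>.
\<close>

definition A_solutions ::
  "nat \<Rightarrow> nat \<Rightarrow> (nat \<Rightarrow> nat) \<Rightarrow> (nat \<Rightarrow> nat) \<Rightarrow> (nat \<Rightarrow> real \<Rightarrow> real) \<Rightarrow> (nat \<Rightarrow> real \<Rightarrow> real)
     \<Rightarrow> (nat \<Rightarrow> real poly) set" where
  "A_solutions q p lam m U V =
     {A \<in> poly_vectors p m. \<forall>j\<in>{1..q}. \<forall>k<lam j.
        has_bochner_integral lborel (\<lambda>t. t ^ k * U j t * (\<Sum>i=1..p. poly (A i) t * V i t)) 0}"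

definition B_solutions ::
  "nat \<Rightarrow> nat \<Rightarrow> (nat \<Rightarrow> nat) \<Rightarrow> (nat \<Rightarrow> nat) \<Rightarrow> (nat \<Rightarrow> real \<Rightarrow> real) \<Rightarrow> (nat \<Rightarrow> real \<Rightarrow> real)
     \<Rightarrow> (nat \<Rightarrow> real poly) set" where
  "B_solutions q p lam m U V =
     {B \<in> poly_vectors q lam. \<forall>i\<in>{1..p}. \<forall>k<m i.
        has_bochner_integral lborel (\<lambda>t. t ^ k * V i t * (\<Sum>j=1..q. poly (B j) t * U j t)) 0}"

interpretation poly_vec: vector_space "\<lambda>c (A :: nat \<Rightarrow> real poly) i. Polynomial.smult c (A i)"
  by unfold_locales (auto simp: fun_eq_iff smult_add_right smult_add_left)

definition weakly_normal :: "(nat \<Rightarrow> real poly) set \<Rightarrow> bool" where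
  "weakly_normal S \<longleftrightarrow> poly_vec.dim S = 1"

text \<open>
  \<open>A i \<noteq> 0\<close> is needed for \<open>m i = 1\<close>, because \<open>degree 0 = 0\<close>.
\<close>

definition strongly_normal :: "nat \<Rightarrow> (nat \<Rightarrow> nat) \<Rightarrow> (nat \<Rightarrow> real poly) set \<Rightarrow> bool" where
  "strongly_normal s m S \<longleftrightarrow> weakly_normal S \<and>
     (\<forall>A\<in>S. A \<noteq> 0 \<longrightarrow> (\<forall>i\<in>{1..s}. m i > 0 \<longrightarrow> A i \<noteq> 0 \<and> degree (A i) = m i - 1))"

text \<open>
  \<open>S \<tau>\<close> and \<open>S\<^sub>H\<close> are the solution spaces of the transformed problems and of the limiting problem
  (vectors of length \<open>s\<close>). Whatever nonzero coefficient, at position \<open>(i0, k0)\<close>, of the limiting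
  vector is normalized to one, the transformed solution with the same coefficient equal to one
  eventually exists, is unique, and converges coefficientwise with the stated rate.
\<close>

definition normalized_convergence ::
  "nat \<Rightarrow> (real \<Rightarrow> (nat \<Rightarrow> real poly) set) \<Rightarrow> (nat \<Rightarrow> real poly) set \<Rightarrow> bool" where
  "normalized_convergence s S S\<^sub>H \<longleftrightarrow>
     (\<forall>A\<in>S\<^sub>H. \<forall>i0\<in>{1..s}. \<forall>k0. coeff (A i0) k0 = 1 \<longrightarrow>
        (\<forall>\<^sub>F \<tau> in at_top. \<exists>!X. X \<in> S \<tau> \<and> coeff (X i0) k0 = 1) \<and>
        (\<forall>X. (\<forall>\<^sub>F \<tau> in at_top. X \<tau> \<in> S \<tau> \<and> coeff (X \<tau> i0) k0 = 1) \<longrightarrow>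
           (\<forall>i\<in>{1..s}. \<forall>k.
              ((\<lambda>\<tau>. coeff (X \<tau> i) k) \<longlongrightarrow> coeff (A i) k) at_top \<and>
              (\<lambda>\<tau>. coeff (X \<tau> i) k - coeff (A i) k) \<in> O[at_top](\<lambda>\<tau>. \<tau> powr (-1/2)))))"

section \<open>The weights\<close>

definition exp_col :: "(nat \<Rightarrow> real) \<Rightarrow> nat \<Rightarrow> real \<Rightarrow> real" where
  "exp_col \<xi> i t = exp (\<xi> i * t)"

definition gamma_kernel :: "real \<Rightarrow> real \<Rightarrow> real \<Rightarrow> real" where
  "gamma_kernel \<rho> d u =
     (if u > 0 then \<rho> powr d / Gamma d * u powr (d - 1) * exp (- \<rho> * u) else 0)"

definition gamma_op :: "real \<Rightarrow> real \<Rightarrow> (real \<Rightarrow> real) \<Rightarrow> real \<Rightarrow> real" where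
  "gamma_op \<rho> d f t = (LBINT u:{0<..}. gamma_kernel \<rho> d u * f (t + u))"

definition gauss :: "real \<Rightarrow> real \<Rightarrow> real" where
  "gauss a t = exp (- (t - a)\<^sup>2) / sqrt pi"

definition hermite_base ::
  "nat \<Rightarrow> (nat \<Rightarrow> real) \<Rightarrow> (nat \<Rightarrow> real) \<Rightarrow> real \<Rightarrow> real \<Rightarrow> real" where
  "hermite_base r \<rho> d a = foldr (\<lambda>h. gamma_op (\<rho> h) (d h)) [1..<r + 1] (gauss a)"

definition hermite_row ::
  "nat \<Rightarrow> (nat \<Rightarrow> real) \<Rightarrow> (nat \<Rightarrow> real) \<Rightarrow> real \<Rightarrow> nat \<Rightarrow> real \<Rightarrow> real" where
  "hermite_row r \<rho> d a j =
     (if j \<le> r then gamma_op (\<rho> j) 1 (hermite_base r \<rho> d a) else hermite_base r \<rho> d a)"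

definition conv_plus :: "(real \<Rightarrow> real) \<Rightarrow> (real \<Rightarrow> real) \<Rightarrow> real \<Rightarrow> real" where
  "conv_plus f g y = (LBINT u:{0..y}. f u * g (y - u))"

definition h_scale :: "real \<Rightarrow> real" where
  "h_scale \<tau> = sqrt (2 * \<tau>)"

definition shape :: "nat \<Rightarrow> (nat \<Rightarrow> real) \<Rightarrow> real \<Rightarrow> nat \<Rightarrow> real" where
  "shape r d \<tau> h = (if h \<le> r then d h else \<tau>)"

definition rate :: "nat \<Rightarrow> (nat \<Rightarrow> real) \<Rightarrow> real \<Rightarrow> nat \<Rightarrow> real" where
  "rate r \<rho> \<tau> h = (if h \<le> r then \<rho> h / h_scale \<tau> else 1)"

definition laguerre_f ::
  "nat \<Rightarrow> (nat \<Rightarrow> real) \<Rightarrow> (nat \<Rightarrow> real) \<Rightarrow> real \<Rightarrow> nat \<Rightarrow> real \<Rightarrow> real" where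
  "laguerre_f r \<rho> d \<tau> j =
     (let g = (\<lambda>h. gamma_kernel (rate r \<rho> \<tau> h) (shape r d \<tau> h + (if h = j then 1 else 0)))
      in foldl conv_plus (g 1) (map g [2..<r + 2]))"

definition transformed_row ::
  "nat \<Rightarrow> (nat \<Rightarrow> real) \<Rightarrow> (nat \<Rightarrow> real) \<Rightarrow> real \<Rightarrow> real \<Rightarrow> nat \<Rightarrow> real \<Rightarrow> real" where
  "transformed_row r \<rho> d a \<tau> j t =
     h_scale \<tau> * laguerre_f r \<rho> d \<tau> j (\<tau> + h_scale \<tau> * (a - t))"

section \<open>The determinant criterion\<close>

text \<open>
  The normalization of the Hermite polynomials is the one with generating function
  \<open>exp (u * z - z\<^sup>2 / 4)\<close>, which determines them; see \<open>hermite_generating_function\<close>.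
\<close>

definition hermite :: "nat \<Rightarrow> real poly" where
  "hermite l = (\<Sum>i\<le>l div 2. monom (fact l / (fact i * fact (l - 2 * i)) * (-1/4) ^ i) (l - 2 * i))"

lemma hermite_generating_function:
  "(\<lambda>l. poly (hermite l) u * z ^ l / fact l) sums exp (u * z - z\<^sup>2 / 4)"
proof -
  define a where "a n = (if even n then (- z\<^sup>2 / 4) ^ (n div 2) / fact (n div 2) else 0)" for n :: nat
  define b where "b n = (u * z) ^ n / fact n" for n :: nat
  have e: "(\<lambda>n. x ^ n / fact n) sums exp x" for x :: real
    using exp_converges[of x] by (simp add: scaleR_conv_of_real field_simps)
  have mono: "strict_mono (\<lambda>n::nat. 2 * n)"
    by (simp add: strict_mono_def)
  have "n \<in> range (\<lambda>n::nat. 2 * n)" if "even n" for n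
    using that by (auto elim: evenE)
  then have z0: "n \<notin> range (\<lambda>n::nat. 2 * n) \<Longrightarrow> a n = 0" for n
    by (auto simp: a_def)
  then have z1: "n \<notin> range (\<lambda>n::nat. 2 * n) \<Longrightarrow> norm (a n) = 0" for n
    by simp
  have a: "a sums exp (- z\<^sup>2 / 4)"
    using e[of "- z\<^sup>2 / 4"] z0 by (subst sums_mono_reindex[OF mono, symmetric]) (simp_all add: a_def)
  have "(\<lambda>n. norm (a (2 * n))) sums exp (z\<^sup>2 / 4)"
    using e[of "z\<^sup>2 / 4"] by (simp add: a_def power_abs abs_divide)
  then have "(\<lambda>n. norm (a n)) sums exp (z\<^sup>2 / 4)"
    using z1 by (subst sums_mono_reindex[OF mono, symmetric])
  then have na: "summable (\<lambda>n. norm (a n))"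
    by (simp add: sums_iff)
  have b: "b sums exp (u * z)"
    using e[of "u * z"] by (simp add: b_def[abs_def])
  have nb: "summable (\<lambda>n. norm (b n))"
    using e[of "\<bar>u * z\<bar>"] by (simp add: b_def sums_iff power_abs abs_divide)
  have c: "(\<Sum>i\<le>l. a i * b (l - i)) = poly (hermite l) u * z ^ l / fact l" for l
  proof -
    have "(\<Sum>i\<le>l. a i * b (l - i)) = (\<Sum>i\<in>(\<lambda>n. 2 * n) ` {..l div 2}. a i * b (l - i))"
      by (rule sum.mono_neutral_right) (auto simp: a_def image_iff elim!: evenE)
    also have "\<dots> = (\<Sum>i\<le>l div 2. a (2 * i) * b (l - 2 * i))"
      by (subst sum.reindex) (auto simp: inj_on_def)
    also have "\<dots> = (\<Sum>i\<le>l div 2.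
        poly (monom (fact l / (fact i * fact (l - 2 * i)) * (-1/4) ^ i) (l - 2 * i)) u * z ^ l / fact l)"
    proof (rule sum.cong)
      fix i assume "i \<in> {..l div 2}"
      then have "l = 2 * i + (l - 2 * i)" by auto
      then have zl: "z ^ l = (z\<^sup>2) ^ i * z ^ (l - 2 * i)"
        by (metis power_add power_mult)
      have s: "(- z\<^sup>2 / 4) ^ i = (-1/4) ^ i * (z\<^sup>2) ^ i"
        by (simp flip: power_mult_distrib)
      have "a (2 * i) = (- z\<^sup>2 / 4) ^ i / fact i"
        by (simp add: a_def)
      then have ai: "a (2 * i) = (-1/4) ^ i * (z\<^sup>2) ^ i / fact i"
        by (simp only: s)
      show "a (2 * i) * b (l - 2 * i) =
        poly (monom (fact l / (fact i * fact (l - 2 * i)) * (-1/4) ^ i) (l - 2 * i)) u * z ^ l / fact l"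
        unfolding ai b_def poly_monom zl power_mult_distrib by (simp add: field_simps)
    qed simp
    also have "\<dots> = poly (hermite l) u * z ^ l / fact l"
      by (simp add: hermite_def poly_sum sum_distrib_right sum_divide_distrib)
    finally show ?thesis .
  qed
  have "(\<lambda>l. \<Sum>i\<le>l. a i * b (l - i)) sums (exp (- z\<^sup>2 / 4) * exp (u * z))"
    using Cauchy_product_sums[OF na nb] a b by (simp add: sums_iff)
  then show ?thesis
    by (simp add: c flip: exp_add)
qed

definition poly_deriv_op :: "real poly \<Rightarrow> (real \<Rightarrow> real) \<Rightarrow> real \<Rightarrow> real" where
  "poly_deriv_op P f z = (\<Sum>i\<le>degree P. coeff P i * (deriv ^^ i) f z)"

text \<open>
  The functions \<open>L_F\<close>, \<open>Lam\<close>, \<open>Phi\<close> are only meaningful for \<open>z > - \<rho> h\<close>, an open set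
  containing 0, which is all that the Taylor coefficients at 0 depend on.
\<close>

definition L_F :: "nat \<Rightarrow> (nat \<Rightarrow> real) \<Rightarrow> (nat \<Rightarrow> real) \<Rightarrow> real \<Rightarrow> real \<Rightarrow> real" where
  "L_F r \<rho> d a z = exp (a * z + z\<^sup>2 / 4) * (\<Prod>h=1..r. (\<rho> h / (\<rho> h + z)) powr d h)"

definition Lam :: "nat \<Rightarrow> (nat \<Rightarrow> real) \<Rightarrow> (nat \<Rightarrow> real) \<Rightarrow> real \<Rightarrow> nat \<Rightarrow> real \<Rightarrow> real" where
  "Lam r \<rho> d a j z = (if j \<le> r then \<rho> j / (\<rho> j + z) * L_F r \<rho> d a z else L_F r \<rho> d a z)"

definition Phi ::
  "nat \<Rightarrow> (nat \<Rightarrow> real) \<Rightarrow> (nat \<Rightarrow> real) \<Rightarrow> real \<Rightarrow> (nat \<Rightarrow> nat) \<Rightarrow> nat \<times> nat \<Rightarrow> real \<Rightarrow> real" where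
  "Phi r \<rho> d a lam = (\<lambda>(j, k) z.
     (\<Prod>h=1..r. (\<rho> h + z) ^ lam h) / L_F r \<rho> d a z *
       poly_deriv_op (hermite k) (Lam r \<rho> d a j) z)"

definition taylor_coeff :: "(real \<Rightarrow> real) \<Rightarrow> nat \<Rightarrow> real" where
  "taylor_coeff f \<nu> = (deriv ^^ \<nu>) f 0 / fact \<nu>"

text \<open>
  The columns \<open>(j, k)\<close> are ordered lexicographically. For \<open>z\<close> near 0 each \<open>Phi\<close> with
  \<open>k < lam j\<close> is a polynomial of degree less than \<open>N\<close>, with the entries of \<open>C_col\<close> as its
  coefficients.
\<close>

definition col_indices :: "nat \<Rightarrow> (nat \<Rightarrow> nat) \<Rightarrow> (nat \<times> nat) list" where
  "col_indices q lam = concat (map (\<lambda>j. map (\<lambda>k. (j, k)) [0..<lam j]) [1..<q + 1])"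

definition C_col ::
  "nat \<Rightarrow> (nat \<Rightarrow> real) \<Rightarrow> (nat \<Rightarrow> real) \<Rightarrow> real \<Rightarrow> (nat \<Rightarrow> nat) \<Rightarrow> nat \<Rightarrow> nat \<times> nat \<Rightarrow> real vec" where
  "C_col r \<rho> d a lam N jk = Matrix.vec N (taylor_coeff (Phi r \<rho> d a lam jk))"

definition p_col :: "nat \<Rightarrow> (nat \<Rightarrow> real) \<Rightarrow> (nat \<Rightarrow> nat) \<Rightarrow> nat \<Rightarrow> real vec" where
  "p_col p \<xi> m N = Matrix.vec N (coeff (\<Prod>i=1..p. [:\<xi> i, -1:] ^ m i))"

definition C_replaced ::
  "nat \<Rightarrow> nat \<Rightarrow> (nat \<Rightarrow> real) \<Rightarrow> (nat \<Rightarrow> real) \<Rightarrow> real \<Rightarrow> (nat \<Rightarrow> real) \<Rightarrow> (nat \<Rightarrow> nat) \<Rightarrow> (nat \<Rightarrow> nat)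
     \<Rightarrow> nat \<times> nat \<Rightarrow> real mat" where
  "C_replaced r p \<rho> d a \<xi> lam m jk =
     (let N = (\<Sum>j=1..r+1. lam j) in
      mat_of_cols N
        (map (\<lambda>jk'. if jk' = jk then p_col p \<xi> m N else C_col r \<rho> d a lam N jk')
             (col_indices (r + 1) lam)))"

end

theory Submission
  imports Defs "HOL-Probability.Distributions" "HOL-Real_Asymp.Real_Asymp"
begin

text \<open>
  Orthogonality against \<open>e\<^sup>\<xi>\<^sup>t\<close> only involves the moments of the tilted weights, that is, the Taylor
  coefficients at the nodes \<open>\<xi>\<^sub>i\<close> of the exponential moment functions of the rows. For a Hermite row this
  function is \<open>\<Lambda>\<^sub>j\<close>; for a transformed row it is \<open>\<Lambda>\<^sub>j\<close> times an explicit factor \<open>Y\<close>. A first-order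
  differential equation for \<open>Y\<close> with coefficients of size \<open>O(\<tau> powr (-1/2))\<close> shows that the Taylor coefficients
  of \<open>Y\<close> are those of \<open>1\<close> up to \<open>O(\<tau> powr (-1/2))\<close>, so the linear systems converge at this rate.

  In the limit, every nontrivial combination of the \<open>\<partial>\<^sup>k \<Lambda>\<^sub>j\<close>, \<open>k < \<lambda>\<^sub>j\<close>, is \<open>L\<^sub>F / (\<Prod>\<^sub>h (\<rho>\<^sub>h + z)\<^bsup>\<lambda>\<^sub>h\<^esup>)\<close> times a polynomial of
  degree less than \<open>N\<close>, which is nonzero by comparing poles and growth at infinity. Prescribed vanishing
  orders at the nodes of total size \<open>N\<close> therefore kill the combination, while total size \<open>N - 1\<close> leaves the
  multiples of \<open>\<Prod>\<^sub>i (\<xi>\<^sub>i - z)\<^bsup>m\<^sub>i\<^esup>\<close>. Hence a suitable coefficient determines the limiting solution,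
  and this property, with the rate of convergence, is stable under small perturbations of the system.
\<close>

section \<open>Exponential moments of the weights\<close>

text \<open>The scale h = sqrt(2 tau) makes the quadratic term of tau (s - ln (1 + s)), s = z / h,
  equal to the Gaussian exponent z^2/4; the cubic term, of size tau / h^3, is the source of the
  rate. Each derivative multiplies the leading term of row h at its pole -rho_h by -(d_h + k + 1),
  which is never zero, and contributes a factor z/2 at infinity. So terms of highest order can be
  separated: rows h <= r by their poles, then row q by growth. Admissibility enters twice: it keeps
  the numerators polynomials of degree below N, and as soon as a derivative occurs it makes every
  pole of L_F'/L_F the pole of a row with lambda_h > 0, where the rates are distinct. The two sides
  differ. Deleting any top coefficient from the A-problem leaves a square system whose transpose has
  trivial kernel, so strong normality comes for free. In the B-problem the solution is the expansion
  of the product of the (xi_i - z)^m_i in the columns Phi_jk, and its coefficient at (j, lambda_j -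
  1) may vanish; by Cramer's rule it is governed by the determinant of C with that column replaced
  by p.\<close>

definition laplace_on :: "real set \<Rightarrow> (real \<Rightarrow> real) \<Rightarrow> (real \<Rightarrow> real) \<Rightarrow> bool" where
  "laplace_on S f L \<longleftrightarrow> f \<in> borel_measurable borel \<and> (\<forall>t. 0 \<le> f t) \<and> (\<forall>z\<in>S. 0 \<le> L z) \<and>
     (\<forall>z\<in>S. (\<integral>\<^sup>+t. ennreal (exp (z * t) * f t) \<partial>lborel) = ennreal (L z))"

lemma laplace_on_subset: "laplace_on S f L \<Longrightarrow> T \<subseteq> S \<Longrightarrow> laplace_on T f L"
  unfolding laplace_on_def by blast

lemma laplace_on_cong: "laplace_on S f L \<Longrightarrow> (\<And>z. z \<in> S \<Longrightarrow> L z = M z) \<Longrightarrow> laplace_on S f M"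
  unfolding laplace_on_def by simp

lemma nn_integral_cmult_ennreal:
  fixes f :: "real \<Rightarrow> real"
  assumes "f \<in> borel_measurable borel" "0 \<le> c" "\<And>t. 0 \<le> f t"
  shows "(\<integral>\<^sup>+t. ennreal (c * f t) \<partial>lborel) = ennreal c * (\<integral>\<^sup>+t. ennreal (f t) \<partial>lborel)"
  using assms by (simp add: ennreal_mult nn_integral_cmult)

text \<open>\<open>laplace_on\<close> uses the nonnegative integral, for which Tonelli needs no
  integrability, while \<open>gamma_op\<close> and \<open>conv_plus\<close> are Bochner integrals
  with value 0 wherever the integrand is not integrable. Finiteness of the weighted double integral
  makes the inner integrand integrable for almost every t (here w > 0 matters), so both readings
  agree almost everywhere.\<close>

lemma nn_integral_weight_integral:
  fixes G :: "real \<Rightarrow> real \<Rightarrow> real" and w :: "real \<Rightarrow> real"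
  assumes [measurable]: "case_prod G \<in> borel_measurable (borel \<Otimes>\<^sub>M borel)" "w \<in> borel_measurable borel"
    and G: "\<And>t u. 0 \<le> G t u" and w: "\<And>t. 0 < w t"
    and fin: "(\<integral>\<^sup>+t. \<integral>\<^sup>+u. ennreal (w t * G t u) \<partial>lborel \<partial>lborel) \<noteq> \<infinity>"
  shows "(\<integral>\<^sup>+t. ennreal (w t * (LINT u|lborel. G t u)) \<partial>lborel) =
    (\<integral>\<^sup>+t. \<integral>\<^sup>+u. ennreal (w t * G t u) \<partial>lborel \<partial>lborel)"
proof (rule nn_integral_cong_AE)
  have "AE t in lborel. (\<integral>\<^sup>+u. ennreal (w t * G t u) \<partial>lborel) \<noteq> \<infinity>"
    by (rule nn_integral_PInf_AE[OF _ fin]) measurable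
  then show "AE t in lborel. ennreal (w t * (LINT u|lborel. G t u)) =
      (\<integral>\<^sup>+u. ennreal (w t * G t u) \<partial>lborel)"
  proof eventually_elim
    case (elim t)
    have eq: "(\<integral>\<^sup>+u. ennreal (w t * G t u) \<partial>lborel) = ennreal (w t) * (\<integral>\<^sup>+u. ennreal (G t u) \<partial>lborel)"
      using w[of t] G by (simp add: ennreal_mult nn_integral_cmult less_imp_le)
    have "(\<integral>\<^sup>+u. ennreal (G t u) \<partial>lborel) \<noteq> \<infinity>"
      using elim w[of t] unfolding eq by (auto simp: ennreal_mult_eq_top_iff)
    then have "integrable lborel (G t)"
      by (intro integrableI_nonneg) (use G in \<open>auto simp: top.not_eq_extremum\<close>)
    then have "(\<integral>\<^sup>+u. ennreal (G t u) \<partial>lborel) = ennreal (LINT u|lborel. G t u)"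
      by (rule nn_integral_eq_integral) (use G in auto)
    then show ?case unfolding eq using w[of t] G
      by (simp add: ennreal_mult less_imp_le)
  qed
qed

section \<open>Transforms of the Gaussian and the gamma kernels, and how the operations on weights
  act on transforms\<close>

lemma laplace_on_gauss: "laplace_on UNIV (gauss a) (\<lambda>z. exp (a * z + z\<^sup>2 / 4))"
proof -
  have eq: "exp (z * t) * gauss a t = exp (a * z + z\<^sup>2 / 4) * normal_density (a + z / 2) (1 / sqrt 2) t" for z t
  proof -
    \<comment> \<open>Completing the square: the tilt by e^{zt} moves the mean of the Gaussian to a
      + z/2 and keeps its variance 1/2.\<close>
    have "z * t - (t - a)\<^sup>2 = (a * z + z\<^sup>2 / 4) - (t - (a + z / 2))\<^sup>2"
      by (simp add: power2_eq_square field_simps)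
    then have "exp (z * t) * exp (- (t - a)\<^sup>2) = exp (a * z + z\<^sup>2 / 4) * exp (- (t - (a + z / 2))\<^sup>2)"
      by (simp flip: exp_add)
    then show ?thesis by (simp add: gauss_def normal_density_def power_divide)
  qed
  have "(\<integral>\<^sup>+t. ennreal (exp (z * t) * gauss a t) \<partial>lborel) = ennreal (exp (a * z + z\<^sup>2 / 4))" for z
  proof -
    have "(\<integral>\<^sup>+t. ennreal (normal_density (a + z / 2) (1 / sqrt 2) t) \<partial>lborel) = 1"
      by (subst nn_integral_eq_integral) auto
    then show ?thesis
      unfolding eq by (simp add: ennreal_mult nn_integral_cmult)
  qed
  then show ?thesis
    unfolding laplace_on_def gauss_def by auto
qed

lemma gamma_kernel_nonneg: "d > 0 \<Longrightarrow> gamma_kernel \<rho> d u \<ge> 0"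
  by (auto simp: gamma_kernel_def intro!: mult_nonneg_nonneg divide_nonneg_pos Gamma_real_pos)

lemma gamma_kernel_measurable [measurable]: "gamma_kernel \<rho> d \<in> borel_measurable borel"
  unfolding gamma_kernel_def by measurable

lemma laplace_on_gamma_kernel:
  assumes "\<rho> > 0" "d > 0"
  shows "laplace_on {..<\<rho>} (gamma_kernel \<rho> d) (\<lambda>z. (\<rho> / (\<rho> - z)) powr d)"
proof -
  have "(\<integral>\<^sup>+t. ennreal (exp (z * t) * gamma_kernel \<rho> d t) \<partial>lborel) = ennreal ((\<rho> / (\<rho> - z)) powr d)"
    if "z < \<rho>" for z
  proof -
    \<comment> \<open>The tilt lowers the rate of the gamma kernel to c; the substitution t = c u
      then produces the Gamma integral.\<close>
    define c where "c = \<rho> - z"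
    have c: "c > 0" using that by (simp add: c_def)
    define g where "g t = indicator {0..} t * t powr (d - 1) / exp t" for t :: real
    have [measurable]: "g \<in> borel_measurable borel" unfolding g_def by measurable
    have g0: "g t \<ge> 0" for t by (simp add: g_def)
    have Gp: "Gamma d > 0" using assms by (simp add: Gamma_real_pos)
    have "ennreal (Gamma d) = (\<integral>\<^sup>+t. ennreal (g t) \<partial>lborel)"
      unfolding g_def by (rule Gamma_conv_nn_integral_real[OF assms(2)])
    also have "\<dots> = ennreal c * (\<integral>\<^sup>+u. ennreal (g (0 + c * u)) \<partial>lborel)"
      using c by (subst nn_integral_real_affine[where c = c and t = 0]) auto
    finally have G: "ennreal (Gamma d) = ennreal c * (\<integral>\<^sup>+u. ennreal (g (c * u)) \<partial>lborel)" by simp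
    have eq: "exp (z * u) * gamma_kernel \<rho> d u = (\<rho> / c) powr d / Gamma d * (c * g (c * u))" for u
    proof (cases "u > 0")
      case True
      have "exp (z * u) * exp (- \<rho> * u) = exp (- (c * u))"
        by (simp add: c_def algebra_simps flip: exp_add)
      then have 1: "exp (z * u) * gamma_kernel \<rho> d u = \<rho> powr d / Gamma d * u powr (d - 1) * exp (- (c * u))"
        using True by (simp add: gamma_kernel_def mult_ac)
      have "c * (c * u) powr (d - 1) = c powr d * u powr (d - 1)"
        using c True by (simp add: powr_mult powr_diff)
      then have "c * g (c * u) = c powr d * u powr (d - 1) * exp (- (c * u))"
        using c True by (simp add: g_def exp_minus divide_inverse flip: mult.assoc)
      with 1 show ?thesis using c assms by (simp add: powr_divide)
    next
      case False
      then show ?thesis using c by (auto simp: gamma_kernel_def g_def indicator_def not_less mult_le_0_iff zero_le_mult_iff)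
    qed
    have "(\<integral>\<^sup>+t. ennreal (exp (z * t) * gamma_kernel \<rho> d t) \<partial>lborel)
       = ennreal ((\<rho> / c) powr d / Gamma d) * (ennreal c * (\<integral>\<^sup>+u. ennreal (g (c * u)) \<partial>lborel))"
      unfolding eq using c g0 Gp by (subst nn_integral_cmult_ennreal; simp add: nn_integral_cmult_ennreal)
    also have "\<dots> = ennreal ((\<rho> / c) powr d / Gamma d * Gamma d)"
      unfolding G[symmetric] using Gp by (subst ennreal_mult) auto
    finally show ?thesis using Gp by (simp add: c_def)
  qed
  then show ?thesis unfolding laplace_on_def using gamma_kernel_nonneg[OF assms(2)] by auto
qed

text \<open>\<open>gamma_op\<close> evaluates f at t + u, so it is a correlation rather than a
  convolution: after the translation in t the kernel is tilted by -z. Hence the condition \<rho> + z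
  > 0 in place of z < \<rho>.\<close>

lemma laplace_on_gamma_op:
  assumes f: "laplace_on S f L" and "\<rho> > 0" "d > 0" and S: "\<And>z. z \<in> S \<Longrightarrow> 0 < \<rho> + z"
  shows "laplace_on S (gamma_op \<rho> d f) (\<lambda>z. (\<rho> / (\<rho> + z)) powr d * L z)"
proof -
  note f' = f[unfolded laplace_on_def]
  have [measurable]: "f \<in> borel_measurable borel" using f' by simp
  define k where "k = gamma_kernel \<rho> d"
  have [measurable]: "k \<in> borel_measurable borel" by (simp add: k_def)
  have k: "k u \<ge> 0" for u using gamma_kernel_nonneg[OF assms(3)] by (simp add: k_def)
  have gop: "gamma_op \<rho> d f = (\<lambda>t. LINT u|lborel. k u * f (t + u))"
  proof
    fix t
    show "gamma_op \<rho> d f t = (LINT u|lborel. k u * f (t + u))"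
      unfolding gamma_op_def set_lebesgue_integral_def k_def
      by (rule Bochner_Integration.integral_cong) (auto simp: gamma_kernel_def indicator_def)
  qed
  have nn: "gamma_op \<rho> d f t \<ge> 0" for t
    unfolding gop by (rule Bochner_Integration.integral_nonneg) (use k f' in auto)
  have meas: "gamma_op \<rho> d f \<in> borel_measurable borel"
    unfolding gop by measurable
  have "(\<integral>\<^sup>+t. ennreal (exp (z * t) * gamma_op \<rho> d f t) \<partial>lborel) = ennreal ((\<rho> / (\<rho> + z)) powr d * L z)"
    if z: "z \<in> S" for z
  proof -
    have I1: "(\<integral>\<^sup>+u. ennreal (exp (- z * u) * k u) \<partial>lborel) = ennreal ((\<rho> / (\<rho> + z)) powr d)"
      using laplace_on_gamma_kernel[OF assms(2,3)] S[OF z] unfolding laplace_on_def k_def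
      by (auto dest!: bspec[where x = "- z"])
    have shift: "(\<integral>\<^sup>+t. ennreal (exp (z * t) * (k u * f (t + u))) \<partial>lborel)
        = ennreal (exp (- z * u) * k u) * ennreal (L z)" for u
    proof -
      have "ennreal (L z) = (\<integral>\<^sup>+t. ennreal (exp (z * t) * f t) \<partial>lborel)" using f' z by auto
      also have "\<dots> = (\<integral>\<^sup>+t. ennreal (exp (z * (u + t)) * f (u + t)) \<partial>lborel)"
        by (subst nn_integral_real_affine[where c = 1 and t = u]) auto
      finally have 1: "ennreal (L z) = (\<integral>\<^sup>+t. ennreal (exp (z * (u + t)) * f (u + t)) \<partial>lborel)" .
      have "exp (z * t) * (k u * f (t + u)) = (exp (- z * u) * k u) * (exp (z * (u + t)) * f (u + t))" for t
        by (simp add: algebra_simps exp_add exp_minus)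
      then show ?thesis
        unfolding 1 using k[of u] f' by (simp only:) (rule nn_integral_cmult_ennreal, auto)
    qed
    have "(\<integral>\<^sup>+t. \<integral>\<^sup>+u. ennreal (exp (z * t) * (k u * f (t + u))) \<partial>lborel \<partial>lborel)
        = (\<integral>\<^sup>+u. \<integral>\<^sup>+t. ennreal (exp (z * t) * (k u * f (t + u))) \<partial>lborel \<partial>lborel)"
      by (rule lborel_pair.Fubini') measurable
    also have "\<dots> = (\<integral>\<^sup>+u. ennreal (exp (- z * u) * k u) * ennreal (L z) \<partial>lborel)"
      unfolding shift ..
    also have "\<dots> = ennreal ((\<rho> / (\<rho> + z)) powr d) * ennreal (L z)"
      by (subst nn_integral_multc, measurable) (simp only: I1)
    also have "\<dots> = ennreal ((\<rho> / (\<rho> + z)) powr d * L z)"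
      using f' z by (simp add: ennreal_mult)
    finally have D: "(\<integral>\<^sup>+t. \<integral>\<^sup>+u. ennreal (exp (z * t) * (k u * f (t + u))) \<partial>lborel \<partial>lborel)
        = ennreal ((\<rho> / (\<rho> + z)) powr d * L z)" .
    show ?thesis unfolding D[symmetric] gop
      by (rule nn_integral_weight_integral) (use k f' D in auto)
  qed
  then show ?thesis
    using nn meas f' unfolding laplace_on_def by auto
qed

text \<open>Both factors vanish on the negative axis, so integrating over [0, y] is the same as
  integrating over the whole line, and the usual convolution theorem applies.\<close>

lemma laplace_on_conv_plus:
  assumes f: "laplace_on S f L" and g: "laplace_on S g M"
    and f0: "\<And>t. t < 0 \<Longrightarrow> f t = 0" and g0: "\<And>t. t < 0 \<Longrightarrow> g t = 0"
  shows "laplace_on S (conv_plus f g) (\<lambda>z. L z * M z)"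
proof -
  note f' = f[unfolded laplace_on_def] and g' = g[unfolded laplace_on_def]
  have [measurable]: "f \<in> borel_measurable borel" "g \<in> borel_measurable borel" using f' g' by simp_all
  have cop: "conv_plus f g = (\<lambda>t. LINT u|lborel. f u * g (t - u))"
  proof
    fix t
    show "conv_plus f g t = (LINT u|lborel. f u * g (t - u))"
      unfolding conv_plus_def set_lebesgue_integral_def
    proof (rule Bochner_Integration.integral_cong)
      show "indicat_real {0..t} u *\<^sub>R (f u * g (t - u)) = f u * g (t - u)" for u
        using f0[of u] g0[of "t - u"] by (cases "u < 0"; cases "t < u") (auto simp: indicator_def)
    qed simp
  qed
  have nn: "conv_plus f g t \<ge> 0" for t
    unfolding cop by (rule Bochner_Integration.integral_nonneg) (use f' g' in auto)
  have meas: "conv_plus f g \<in> borel_measurable borel"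
    unfolding cop by measurable
  have "(\<integral>\<^sup>+t. ennreal (exp (z * t) * conv_plus f g t) \<partial>lborel) = ennreal (L z * M z)"
    if z: "z \<in> S" for z
  proof -
    have shift: "(\<integral>\<^sup>+t. ennreal (exp (z * t) * (f u * g (t - u))) \<partial>lborel)
        = ennreal (exp (z * u) * f u) * ennreal (M z)" for u
    proof -
      have "ennreal (M z) = (\<integral>\<^sup>+t. ennreal (exp (z * t) * g t) \<partial>lborel)" using g' z by auto
      also have "\<dots> = (\<integral>\<^sup>+t. ennreal (exp (z * (- u + t)) * g (- u + t)) \<partial>lborel)"
        by (subst nn_integral_real_affine[where c = 1 and t = "- u"]) auto
      finally have 1: "ennreal (M z) = (\<integral>\<^sup>+t. ennreal (exp (z * (- u + t)) * g (- u + t)) \<partial>lborel)" .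
      have "exp (z * t) * (f u * g (t - u)) = (exp (z * u) * f u) * (exp (z * (- u + t)) * g (- u + t))" for t
        by (simp add: algebra_simps exp_add exp_minus exp_diff)
      then show ?thesis
        unfolding 1 using f' g' by (simp only:) (rule nn_integral_cmult_ennreal, auto)
    qed
    have "(\<integral>\<^sup>+t. \<integral>\<^sup>+u. ennreal (exp (z * t) * (f u * g (t - u))) \<partial>lborel \<partial>lborel)
        = (\<integral>\<^sup>+u. \<integral>\<^sup>+t. ennreal (exp (z * t) * (f u * g (t - u))) \<partial>lborel \<partial>lborel)"
      by (rule lborel_pair.Fubini') measurable
    also have "\<dots> = (\<integral>\<^sup>+u. ennreal (exp (z * u) * f u) * ennreal (M z) \<partial>lborel)"
      unfolding shift ..
    also have "\<dots> = ennreal (L z) * ennreal (M z)"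
      using f' z by (subst nn_integral_multc) simp_all
    also have "\<dots> = ennreal (L z * M z)"
      using f' g' z by (simp add: ennreal_mult)
    finally have D: "(\<integral>\<^sup>+t. \<integral>\<^sup>+u. ennreal (exp (z * t) * (f u * g (t - u))) \<partial>lborel \<partial>lborel)
        = ennreal (L z * M z)" .
    show ?thesis unfolding D[symmetric] cop
      by (rule nn_integral_weight_integral) (use f' g' D in auto)
  qed
  then show ?thesis
    using nn meas f' g' unfolding laplace_on_def by auto
qed

text \<open>The passage from the Laguerre variable y = c - h t to t reverses and scales the axis,
  which turns the tilt z into -z / h.\<close>

lemma laplace_on_reflect_affine:
  assumes f: "laplace_on S f L" and h: "h > 0"
  shows "laplace_on {z. - z / h \<in> S} (\<lambda>t. h * f (c - h * t)) (\<lambda>z. exp (z * c / h) * L (- z / h))"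
proof -
  note f' = f[unfolded laplace_on_def]
  have [measurable]: "f \<in> borel_measurable borel" using f' by simp
  have "(\<integral>\<^sup>+t. ennreal (exp (z * t) * (h * f (c - h * t))) \<partial>lborel) = ennreal (exp (z * c / h) * L (- z / h))"
    if z: "- z / h \<in> S" for z
  proof -
    have "ennreal (L (- z / h)) = (\<integral>\<^sup>+t. ennreal (exp (- z / h * t) * f t) \<partial>lborel)" using f' z by auto
    also have "\<dots> = ennreal h * (\<integral>\<^sup>+t. ennreal (exp (- z / h * (c + (- h) * t)) * f (c + (- h) * t)) \<partial>lborel)"
      using h by (subst nn_integral_real_affine[where c = "- h" and t = c]) auto
    finally have 1: "ennreal (L (- z / h)) =
      ennreal h * (\<integral>\<^sup>+t. ennreal (exp (- z / h * (c - h * t)) * f (c - h * t)) \<partial>lborel)" by simp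
    have eq: "exp (z * t) * (h * f (c - h * t)) =
        exp (z * c / h) * (h * (exp (- z / h * (c - h * t)) * f (c - h * t)))" for t
      using h by (simp add: algebra_simps exp_add exp_diff exp_minus diff_divide_distrib)
    have "(\<integral>\<^sup>+t. ennreal (exp (z * t) * (h * f (c - h * t))) \<partial>lborel) = ennreal (exp (z * c / h)) *
        (\<integral>\<^sup>+t. ennreal (h * (exp (- z / h * (c - h * t)) * f (c - h * t))) \<partial>lborel)"
      unfolding eq by (rule nn_integral_cmult_ennreal) (use f' h in auto)
    also have "(\<integral>\<^sup>+t. ennreal (h * (exp (- z / h * (c - h * t)) * f (c - h * t))) \<partial>lborel) = ennreal (L (- z / h))"
      unfolding 1 by (rule nn_integral_cmult_ennreal) (use f' h in auto)
    finally show ?thesis using f' z by (simp add: ennreal_mult)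
  qed
  moreover have "0 \<le> exp (z * c / h) * L (- z / h)" if "- z / h \<in> S" for z
    using f' that by auto
  ultimately show ?thesis
    using f' h unfolding laplace_on_def by auto
qed

lemma laplace_on_foldr_gamma_op:
  assumes "\<forall>h\<in>set hs. d h > 0 \<and> \<rho> h > 0"
    and "\<And>z h. z \<in> S \<Longrightarrow> h \<in> set hs \<Longrightarrow> 0 < \<rho> h + z" and "distinct hs" and "laplace_on S f L"
  shows "laplace_on S (foldr (\<lambda>h. gamma_op (\<rho> h) (d h)) hs f)
    (\<lambda>z. L z * (\<Prod>h\<in>set hs. (\<rho> h / (\<rho> h + z)) powr d h))"
  using assms
proof (induction hs)
  case (Cons h hs)
  then have IH: "laplace_on S (foldr (\<lambda>h. gamma_op (\<rho> h) (d h)) hs f)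
      (\<lambda>z. L z * (\<Prod>h\<in>set hs. (\<rho> h / (\<rho> h + z)) powr d h))" by auto
  show ?case
    unfolding foldr.simps o_def
    by (rule laplace_on_cong[OF laplace_on_gamma_op[OF IH]]) (use Cons.prems in \<open>auto simp: mult_ac\<close>)
qed simp

section \<open>Transforms of the Hermite and the transformed rows\<close>

definition laplace_domain :: "nat \<Rightarrow> (nat \<Rightarrow> real) \<Rightarrow> real set" where
  "laplace_domain r \<rho> = {z. \<forall>h\<in>{1..r}. 0 < \<rho> h + z}"

lemma set_upt_1 [simp]: "set [1..<r + 1] = {1..r}"
  by auto

lemma laplace_on_hermite_base:
  assumes "\<forall>h\<in>{1..r}. d h > 0 \<and> \<rho> h > 0"
  shows "laplace_on (laplace_domain r \<rho>) (hermite_base r \<rho> d a) (L_F r \<rho> d a)"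
proof -
  have "laplace_on (laplace_domain r \<rho>) (foldr (\<lambda>h. gamma_op (\<rho> h) (d h)) [1..<r + 1] (gauss a))
    (\<lambda>z. exp (a * z + z\<^sup>2 / 4) * (\<Prod>h\<in>set [1..<r + 1]. (\<rho> h / (\<rho> h + z)) powr d h))"
    using assms
    by (intro laplace_on_foldr_gamma_op laplace_on_subset[OF laplace_on_gauss])
      (auto simp: laplace_domain_def)
  then show ?thesis
    unfolding hermite_base_def by (rule laplace_on_cong) (simp only: L_F_def set_upt_1)
qed

lemma laplace_on_hermite_row:
  assumes "\<forall>h\<in>{1..r}. d h > 0 \<and> \<rho> h > 0" and "j \<in> {1..r+1}"
  shows "laplace_on (laplace_domain r \<rho>) (hermite_row r \<rho> d a j) (Lam r \<rho> d a j)"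
proof (cases "j \<le> r")
  case True
  have "laplace_on (laplace_domain r \<rho>) (gamma_op (\<rho> j) 1 (hermite_base r \<rho> d a))
      (\<lambda>z. (\<rho> j / (\<rho> j + z)) powr 1 * L_F r \<rho> d a z)"
    using assms True
    by (intro laplace_on_gamma_op laplace_on_hermite_base) (auto simp: laplace_domain_def)
  then have "laplace_on (laplace_domain r \<rho>) (gamma_op (\<rho> j) 1 (hermite_base r \<rho> d a)) (Lam r \<rho> d a j)"
    using assms True by (elim laplace_on_cong) (force simp: laplace_domain_def Lam_def)
  then show ?thesis using True by (simp add: hermite_row_def[abs_def])
next
  case False
  then show ?thesis
    using laplace_on_hermite_base[OF assms(1)] by (simp add: hermite_row_def[abs_def] Lam_def[abs_def])
qed

lemma conv_plus_neg: "t < 0 \<Longrightarrow> conv_plus f g t = 0"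
  by (simp add: conv_plus_def set_lebesgue_integral_def)

lemma laplace_on_foldl_conv_plus:
  assumes "\<forall>h\<in>set hs. laplace_on S (g h) (M h) \<and> (\<forall>t<0. g h t = 0)"
    and "laplace_on S f L" "\<forall>t<0. f t = 0" "distinct hs"
  shows "laplace_on S (foldl conv_plus f (map g hs)) (\<lambda>z. L z * (\<Prod>h\<in>set hs. M h z))"
  using assms
proof (induction hs arbitrary: f L)
  case (Cons h hs)
  have "laplace_on S (conv_plus f (g h)) (\<lambda>z. L z * M h z)"
    using Cons.prems by (intro laplace_on_conv_plus) auto
  then have "laplace_on S (foldl conv_plus (conv_plus f (g h)) (map g hs))
      (\<lambda>z. (L z * M h z) * (\<Prod>h\<in>set hs. M h z))"
    using Cons.prems by (intro Cons.IH) (auto simp: conv_plus_neg)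
  then show ?case
    using Cons.prems by (auto simp: mult_ac elim!: laplace_on_cong)
qed simp

lemma h_scale_pos: "\<tau> > 0 \<Longrightarrow> h_scale \<tau> > 0"
  by (simp add: h_scale_def)

lemma laplace_on_laguerre_f:
  assumes "\<forall>h\<in>{1..r}. d h > 0 \<and> \<rho> h > 0" and "\<tau> > 0"
  defines "e \<equiv> (\<lambda>j h. shape r d \<tau> h + (if h = j then 1 else 0))"
  shows "laplace_on {z. \<forall>h\<in>{1..r+1}. z < rate r \<rho> \<tau> h} (laguerre_f r \<rho> d \<tau> j)
    (\<lambda>z. \<Prod>h=1..r+1. (rate r \<rho> \<tau> h / (rate r \<rho> \<tau> h - z)) powr e j h)"
proof -
  let ?S = "{z. \<forall>h\<in>{1..r+1}. z < rate r \<rho> \<tau> h}"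
  define g where "g h = gamma_kernel (rate r \<rho> \<tau> h) (e j h)" for h
  define M where "M h z = (rate r \<rho> \<tau> h / (rate r \<rho> \<tau> h - z)) powr e j h" for h z
  have r: "rate r \<rho> \<tau> h > 0" "e j h > 0" if "h \<in> {1..r+1}" for h
    using that assms h_scale_pos[OF assms(2)] by (auto simp: rate_def e_def shape_def intro: add_pos_nonneg)
  have g: "laplace_on ?S (g h) (M h)" if "h \<in> {1..r+1}" for h
    unfolding g_def M_def
    by (rule laplace_on_subset[OF laplace_on_gamma_kernel]) (use r that in auto)
  have g0: "\<forall>t<0. g h t = 0" for h
    by (simp add: g_def gamma_kernel_def)
  have "laplace_on ?S (foldl conv_plus (g 1) (map g [2..<r + 2])) (\<lambda>z. M 1 z * (\<Prod>h\<in>set [2..<r + 2]. M h z))"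
    using g g0 by (intro laplace_on_foldl_conv_plus) auto
  moreover have "laguerre_f r \<rho> d \<tau> j = foldl conv_plus (g 1) (map g [2..<r + 2])"
    by (simp add: laguerre_f_def Let_def g_def[abs_def] e_def)
  moreover have "{1..r+1} = insert 1 (set [2..<r + 2])" by auto
  then have "(\<Prod>h=1..r+1. M h z) = M 1 z * (\<Prod>h\<in>set [2..<r + 2]. M h z)" for z by simp
  ultimately show ?thesis by (simp add: M_def)
qed

text \<open>The quotient of the exponential moments of a transformed row and of the Hermite row.\<close>

definition laguerre_ratio :: "real \<Rightarrow> real \<Rightarrow> real \<Rightarrow> real" where
  "laguerre_ratio \<tau> \<delta> z =
     exp (\<tau> * (z / h_scale \<tau>) - (\<tau> + \<delta>) * ln (1 + z / h_scale \<tau>) - z\<^sup>2 / 4)"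

text \<open>After scaling, the rates rho_h / h give back the factors rho_h / (rho_h + z). The raised
  shape of row j supplies the extra factor of \<open>Lam\<close> if j \<le> r; for the last row it
  turns the exponent \<tau> of 1 + z / h into \<tau> + 1, which explains the parameter \<delta>.
  What remains besides \<open>Lam\<close> is the ratio.\<close>

lemma laplace_on_transformed_row:
  assumes pos: "\<forall>h\<in>{1..r}. d h > 0 \<and> \<rho> h > 0" and "\<tau> > 0" and j: "j \<in> {1..r+1}"
  shows "laplace_on (laplace_domain r \<rho> \<inter> {- h_scale \<tau><..}) (transformed_row r \<rho> d a \<tau> j)
    (\<lambda>z. Lam r \<rho> d a j z * laguerre_ratio \<tau> (if j \<le> r then 0 else 1) z)"
proof -
  define H where "H = h_scale \<tau>"
  have H: "H > 0" using h_scale_pos[OF assms(2)] by (simp add: H_def)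
  define e where "e h = shape r d \<tau> h + (if h = j then 1 else 0)" for h
  let ?S = "{z. \<forall>h\<in>{1..r+1}. z < rate r \<rho> \<tau> h}"
  let ?M = "\<lambda>z. \<Prod>h=1..r+1. (rate r \<rho> \<tau> h / (rate r \<rho> \<tau> h - z)) powr e h"
  have "laplace_on {z. - z / H \<in> ?S} (\<lambda>t. H * laguerre_f r \<rho> d \<tau> j ((\<tau> + H * a) - H * t))
      (\<lambda>z. exp (z * (\<tau> + H * a) / H) * ?M (- z / H))"
    unfolding e_def by (rule laplace_on_reflect_affine[OF laplace_on_laguerre_f[OF pos assms(2)] H])
  moreover have "(\<lambda>t. H * laguerre_f r \<rho> d \<tau> j ((\<tau> + H * a) - H * t)) = transformed_row r \<rho> d a \<tau> j"
    by (simp add: transformed_row_def[abs_def] H_def algebra_simps)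
  ultimately have 1: "laplace_on {z. - z / H \<in> ?S} (transformed_row r \<rho> d a \<tau> j)
      (\<lambda>z. exp (z * (\<tau> + H * a) / H) * ?M (- z / H))" by simp
  have sub: "laplace_domain r \<rho> \<inter> {- h_scale \<tau><..} \<subseteq> {z. - z / H \<in> ?S}"
  proof (clarsimp simp del: minus_divide_left)
    fix z h assume z: "z \<in> laplace_domain r \<rho>" "- h_scale \<tau> < z" and h: "Suc 0 \<le> h" "h \<le> Suc r"
    show "- (z / H) < rate r \<rho> \<tau> h"
    proof (cases "h \<le> r")
      case True
      then have "0 < \<rho> h + z" using z h by (auto simp: laplace_domain_def)
      then have "- z / H < \<rho> h / H" using H by (intro divide_strict_right_mono) auto
      then show ?thesis using True by (simp add: rate_def H_def)
    next
      case False
      then show ?thesis using z H by (simp add: rate_def field_simps flip: H_def)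
    qed
  qed
  have 2: "exp (z * (\<tau> + H * a) / H) * ?M (- z / H) =
      Lam r \<rho> d a j z * laguerre_ratio \<tau> (if j \<le> r then 0 else 1) z"
    if z: "z \<in> laplace_domain r \<rho> \<inter> {- h_scale \<tau><..}" for z
  proof -
    have zr: "\<And>h. h \<in> {1..r} \<Longrightarrow> 0 < \<rho> h + z" using z by (auto simp: laplace_domain_def)
    have z1: "1 + z / H > 0" using z H by (auto simp: field_simps simp flip: H_def)
    have q: "rate r \<rho> \<tau> h / (rate r \<rho> \<tau> h - (- z / H)) = \<rho> h / (\<rho> h + z)" if "h \<in> {1..r}" for h
    proof -
      have "rate r \<rho> \<tau> h - (- z / H) = (\<rho> h + z) / H" "rate r \<rho> \<tau> h = \<rho> h / H"
        using that by (auto simp: rate_def add_divide_distrib simp flip: H_def)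
      then show ?thesis using H by simp
    qed
    have "?M (- z / H) = (\<Prod>h=1..r. (\<rho> h / (\<rho> h + z)) powr e h) * (1 / (1 + z / H)) powr e (r + 1)"
    proof -
      have "(\<Prod>h=1..r. (rate r \<rho> \<tau> h / (rate r \<rho> \<tau> h - (- z / H))) powr e h) =
          (\<Prod>h=1..r. (\<rho> h / (\<rho> h + z)) powr e h)"
        by (rule prod.cong) (simp_all only: q)
      moreover have "rate r \<rho> \<tau> (r + 1) / (rate r \<rho> \<tau> (r + 1) - (- z / H)) = 1 / (1 + z / H)"
        by (simp add: rate_def)
      ultimately show ?thesis
        by (simp only: Suc_eq_plus1[symmetric] prod.atLeast_Suc_atMost_Suc_shift[symmetric])
          (simp add: prod.cl_ivl_Suc del: divide_minus_left diff_minus_eq_add)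
    qed
    also have "(1 / (1 + z / H)) powr e (r + 1) = exp (- (\<tau> + (if j \<le> r then 0 else 1)) * ln (1 + z / H))"
      using z1 j by (auto simp: powr_def e_def shape_def ln_div algebra_simps)
    also have "(\<Prod>h=1..r. (\<rho> h / (\<rho> h + z)) powr e h) =
        (\<Prod>h=1..r. (\<rho> h / (\<rho> h + z)) powr d h) * (if j \<le> r then \<rho> j / (\<rho> j + z) else 1)"
    proof -
      have "(\<Prod>h=1..r. (\<rho> h / (\<rho> h + z)) powr e h) =
          (\<Prod>h=1..r. (\<rho> h / (\<rho> h + z)) powr d h * (if h = j then \<rho> j / (\<rho> j + z) else 1))"
      proof (rule prod.cong)
        fix h assume h: "h \<in> {1..r}"
        then have "(\<rho> h / (\<rho> h + z)) powr 1 = \<rho> h / (\<rho> h + z)"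
          using zr pos by (intro powr_one) (auto intro!: divide_nonneg_pos simp: less_imp_le)
        then show "(\<rho> h / (\<rho> h + z)) powr e h =
            (\<rho> h / (\<rho> h + z)) powr d h * (if h = j then \<rho> j / (\<rho> j + z) else 1)"
          using h by (simp only: e_def shape_def powr_add) auto
      qed simp
      then show ?thesis using j by (auto simp: prod.distrib prod.delta)
    qed
    finally have M: "?M (- z / H) = (\<Prod>h=1..r. (\<rho> h / (\<rho> h + z)) powr d h) *
        (if j \<le> r then \<rho> j / (\<rho> j + z) else 1) *
        exp (- (\<tau> + (if j \<le> r then 0 else 1)) * ln (1 + z / H))" .
    have E: "exp (z * (\<tau> + H * a) / H) = exp (\<tau> * (z / H) - z\<^sup>2 / 4) * exp (a * z + z\<^sup>2 / 4)"
      using H by (simp add: field_simps flip: exp_add)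
    have R: "laguerre_ratio \<tau> \<delta> z = exp (\<tau> * (z / H) - z\<^sup>2 / 4) * exp (- (\<tau> + \<delta>) * ln (1 + z / H))" for \<delta>
      unfolding laguerre_ratio_def H_def[symmetric] exp_add[symmetric] by (simp add: algebra_simps)
    show ?thesis
      unfolding M E R Lam_def L_F_def by (cases "j \<le> r") (simp_all only: if_True if_False simp_thms mult_ac mult_1_left)
  qed
  show ?thesis
    by (rule laplace_on_cong[OF laplace_on_subset[OF 1 sub]]) (rule 2)
qed

section \<open>Moments of tilted weights as Taylor coefficients\<close>

lemma has_fps_expansion_nth_deriv:
  fixes f :: "real \<Rightarrow> real"
  assumes "f has_fps_expansion F"
  shows "(deriv ^^ n) f 0 = fact n * fps_nth F n"
proof -
  have "(deriv ^^ n) f has_fps_expansion (fps_deriv ^^ n) F"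
    by (induction n) (auto intro: assms has_fps_expansion_deriv)
  then have "(deriv ^^ n) f 0 = fps_nth ((fps_deriv ^^ n) F) 0"
    by (auto simp: has_fps_expansion_def eval_fps_at_0 dest!: eventually_nhds_x_imp_x)
  also have "fps_nth ((fps_deriv ^^ n) F) k = fps_nth F (n + k) * pochhammer (real k + 1) n" for k
    by (induction n arbitrary: k) (simp_all add: pochhammer_rec algebra_simps)
  finally show ?thesis by (simp add: pochhammer_fact)
qed

lemma has_fps_expansion_unique_real:
  fixes f :: "real \<Rightarrow> real"
  assumes "f has_fps_expansion F" "f has_fps_expansion G"
  shows "F = G"
  using has_fps_expansion_nth_deriv[OF assms(1)] has_fps_expansion_nth_deriv[OF assms(2)]
  by (simp add: fps_eq_iff)

text \<open>The exponential series of e^{wt} may be integrated term by term against the tilted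
  weight, because finiteness of L on both sides of \<xi> makes e^{|w| |t|} times this weight
  integrable.\<close>

lemma laplace_on_moments:
  assumes f: "laplace_on {\<xi> - e<..<\<xi> + e} f L" and e: "e > 0"
  shows "integrable lborel (\<lambda>t. t ^ k * (exp (\<xi> * t) * f t))"
    and "(\<lambda>w. L (\<xi> + w)) has_fps_expansion
      Abs_fps (\<lambda>k. (LINT t|lborel. t ^ k * (exp (\<xi> * t) * f t)) / fact k)"
proof -
  note f' = f[unfolded laplace_on_def]
  have [measurable]: "f \<in> borel_measurable borel" using f' by simp
  define g where "g t = exp (\<xi> * t) * f t" for t
  have [measurable]: "g \<in> borel_measurable borel" unfolding g_def by measurable
  have g0: "g t \<ge> 0" for t using f' by (simp add: g_def)
  have mgf: "integrable lborel (\<lambda>t. exp (w * t) * g t)" "(LINT t|lborel. exp (w * t) * g t) = L (\<xi> + w)"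
    if "\<bar>w\<bar> < e" for w
  proof -
    have inS: "\<xi> + w \<in> {\<xi> - e<..<\<xi> + e}" using that by auto
    have eq: "exp (w * t) * g t = exp ((\<xi> + w) * t) * f t" for t
      by (simp add: g_def algebra_simps exp_add)
    have 1: "(\<integral>\<^sup>+t. ennreal (exp (w * t) * g t) \<partial>lborel) = ennreal (L (\<xi> + w))"
      unfolding eq using f' inS by blast
    have "has_bochner_integral lborel (\<lambda>t. exp (w * t) * g t) (L (\<xi> + w))"
      by (rule has_bochner_integral_nn_integral) (use 1 g0 f' inS in auto)
    then show "integrable lborel (\<lambda>t. exp (w * t) * g t)" "(LINT t|lborel. exp (w * t) * g t) = L (\<xi> + w)"
      by (auto simp: has_bochner_integral_iff)
  qed
  have dom: "integrable lborel (\<lambda>t. exp (\<bar>w\<bar> * \<bar>t\<bar>) * g t)" if "\<bar>w\<bar> < e" for w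
  proof (rule Bochner_Integration.integrable_bound)
    show "integrable lborel (\<lambda>t. exp (w * t) * g t + exp (- w * t) * g t)"
      using that by (intro Bochner_Integration.integrable_add mgf) auto
    show "AE t in lborel. norm (exp (\<bar>w\<bar> * \<bar>t\<bar>) * g t) \<le> norm (exp (w * t) * g t + exp (- w * t) * g t)"
    proof (rule AE_I2)
      fix t
      have "\<bar>w\<bar> * \<bar>t\<bar> = w * t \<or> \<bar>w\<bar> * \<bar>t\<bar> = - w * t" by (auto simp: abs_if)
      then have "exp (\<bar>w\<bar> * \<bar>t\<bar>) * g t = exp (w * t) * g t \<or> exp (\<bar>w\<bar> * \<bar>t\<bar>) * g t = exp (- w * t) * g t" by metis
      moreover have "0 \<le> exp (w * t) * g t" "0 \<le> exp (- w * t) * g t" using g0 by auto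
      ultimately show "norm (exp (\<bar>w\<bar> * \<bar>t\<bar>) * g t) \<le> norm (exp (w * t) * g t + exp (- w * t) * g t)"
        by (auto simp del: mult_minus_left)
    qed
  qed measurable
  have powb: "\<bar>w * t\<bar> ^ k / fact k \<le> exp (\<bar>w\<bar> * \<bar>t\<bar>)" for k and w t :: real
  proof -
    have "(\<lambda>n. \<bar>w * t\<bar> ^ n / fact n) sums exp \<bar>w * t\<bar>"
      using exp_converges[of "\<bar>w * t\<bar>"] by (simp add: divide_inverse mult.commute)
    then show ?thesis
      using sum_le_suminf[of "\<lambda>n. \<bar>w * t\<bar> ^ n / fact n" "{k}"] by (auto simp: sums_iff abs_mult)
  qed
  have int: "integrable lborel (\<lambda>t. t ^ k * g t)" for k
  proof -
    define w where "w = e / 2"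
    have w: "w > 0" "\<bar>w\<bar> < e" using e by (auto simp: w_def)
    show ?thesis
    proof (rule Bochner_Integration.integrable_bound)
      show "integrable lborel (\<lambda>t. (fact k / w ^ k) * (exp (\<bar>w\<bar> * \<bar>t\<bar>) * g t))"
        by (rule integrable_mult_right, rule dom, rule w)
      show "AE t in lborel. norm (t ^ k * g t) \<le> norm (fact k / w ^ k * (exp (\<bar>w\<bar> * \<bar>t\<bar>) * g t))"
      proof (rule AE_I2)
        fix t
        have "\<bar>t\<bar> ^ k \<le> fact k / w ^ k * exp (\<bar>w\<bar> * \<bar>t\<bar>)"
          using powb[of w t k] w by (simp add: abs_mult power_mult_distrib field_simps)
        then have "\<bar>t\<bar> ^ k * g t \<le> fact k / w ^ k * exp (\<bar>w\<bar> * \<bar>t\<bar>) * g t"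
          by (rule mult_right_mono) (rule g0)
        then show "norm (t ^ k * g t) \<le> norm (fact k / w ^ k * (exp (\<bar>w\<bar> * \<bar>t\<bar>) * g t))"
          using g0[of t] w by (simp add: abs_mult power_abs)
      qed
    qed measurable
  qed
  then show "integrable lborel (\<lambda>t. t ^ k * (exp (\<xi> * t) * f t))" by (simp add: g_def)
  let ?M = "\<lambda>k. LINT t|lborel. t ^ k * g t"
  have sums: "(\<lambda>k. ?M k / fact k * w ^ k) sums L (\<xi> + w)" if w: "\<bar>w\<bar> < e" for w
  proof -
    define G where "G k t = (w * t) ^ k / fact k * g t" for k t
    have Gi: "integrable lborel (G k)" for k
    proof -
      have "G k = (\<lambda>t. (w ^ k / fact k) * (t ^ k * g t))"
        by (auto simp: G_def power_mult_distrib)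
      then show ?thesis using int[of k] by simp
    qed
    have ex: "(\<lambda>n. x ^ n / fact n) sums exp x" for x :: real
      using exp_converges[of x] by (simp add: divide_inverse mult.commute)
    have Gs: "(\<lambda>k. G k t) sums (exp (w * t) * g t)" for t
      unfolding G_def by (intro sums_mult2 ex)
    have nG: "norm (G k t) = \<bar>w * t\<bar> ^ k / fact k * g t" for k t
      using g0[of t] by (simp add: G_def abs_mult power_abs)
    have Gn: "(\<lambda>k. norm (G k t)) sums (exp \<bar>w * t\<bar> * g t)" for t
      unfolding nG by (intro sums_mult2 ex)
    have S: "summable (\<lambda>k. LINT t|lborel. norm (G k t))"
    proof (rule bounded_imp_summable)
      show "0 \<le> (LINT t|lborel. norm (G k t))" for k by simp
      show "(\<Sum>k\<le>n. LINT t|lborel. norm (G k t)) \<le> (LINT t|lborel. exp (\<bar>w\<bar> * \<bar>t\<bar>) * g t)" for n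
      proof -
        have "(\<Sum>k\<le>n. LINT t|lborel. norm (G k t)) = (LINT t|lborel. (\<Sum>k\<le>n. norm (G k t)))"
          by (rule Bochner_Integration.integral_sum[symmetric]) (intro integrable_norm Gi)
        also have "\<dots> \<le> (LINT t|lborel. exp (\<bar>w\<bar> * \<bar>t\<bar>) * g t)"
        proof (rule Bochner_Integration.integral_mono)
          show "integrable lborel (\<lambda>t. \<Sum>k\<le>n. norm (G k t))"
            by (intro Bochner_Integration.integrable_sum integrable_norm Gi)
          show "integrable lborel (\<lambda>t. exp (\<bar>w\<bar> * \<bar>t\<bar>) * g t)" by (rule dom[OF w])
          show "(\<Sum>k\<le>n. norm (G k t)) \<le> exp (\<bar>w\<bar> * \<bar>t\<bar>) * g t" for t
            using sum_le_suminf[of "\<lambda>k. norm (G k t)" "{..n}"] Gn[of t] by (simp add: sums_iff abs_mult)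
        qed
        finally show ?thesis .
      qed
    qed
    have "(\<lambda>k. integral\<^sup>L lborel (G k)) sums (LINT t|lborel. (\<Sum>k. G k t))"
      by (rule sums_integral[OF Gi _ S]) (use Gn in \<open>auto simp: sums_iff\<close>)
    also have "(\<lambda>t. \<Sum>k. G k t) = (\<lambda>t. exp (w * t) * g t)"
      using Gs by (auto simp: sums_iff)
    also have "(LINT t|lborel. exp (w * t) * g t) = L (\<xi> + w)" by (rule mgf(2)[OF w])
    also have "(\<lambda>k. integral\<^sup>L lborel (G k)) = (\<lambda>k. ?M k / fact k * w ^ k)"
    proof
      fix k
      have "G k = (\<lambda>t. (w ^ k / fact k) * (t ^ k * g t))"
        by (auto simp: G_def power_mult_distrib)
      then show "integral\<^sup>L lborel (G k) = ?M k / fact k * w ^ k" by simp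
    qed
    finally show ?thesis .
  qed
  have "(\<lambda>w. L (\<xi> + w)) has_fps_expansion Abs_fps (\<lambda>k. ?M k / fact k)"
    unfolding has_fps_expansion_def
  proof
    have "norm (e / 2) \<le> fps_conv_radius (Abs_fps (\<lambda>k. ?M k / fact k))"
      unfolding fps_conv_radius_def
      by (rule conv_radius_geI) (use sums[of "e / 2"] e in \<open>auto simp: sums_iff\<close>)
    then show "0 < fps_conv_radius (Abs_fps (\<lambda>k. ?M k / fact k))"
      using e by (elim less_le_trans[rotated]) auto
    have "eventually (\<lambda>w::real. \<bar>w\<bar> < e) (nhds 0)"
      using e by (intro eventually_nhds_in_open[of "{-e<..<e}" 0, THEN eventually_mono]) auto
    then show "eventually (\<lambda>w. eval_fps (Abs_fps (\<lambda>k. ?M k / fact k)) w = L (\<xi> + w)) (nhds 0)"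
      by eventually_elim (use sums in \<open>auto simp: eval_fps_def sums_iff\<close>)
  qed
  then show "(\<lambda>w. L (\<xi> + w)) has_fps_expansion
      Abs_fps (\<lambda>k. (LINT t|lborel. t ^ k * (exp (\<xi> * t) * f t)) / fact k)"
    by (simp add: g_def)
qed

section \<open>Perturbation of linear systems with one-dimensional kernel\<close>

text \<open>Gaussian elimination over arbitrary finite index sets: the inserted equation is solved
  for a pivot unknown, and \<open>M'\<close> is the matrix of what remains.\<close>

lemma nonzero_kernel_vector:
  fixes M :: "'e \<Rightarrow> 'i \<Rightarrow> real"
  assumes "finite E" "finite I" "card E < card I"
  shows "\<exists>x. (\<exists>i\<in>I. x i \<noteq> 0) \<and> (\<forall>e\<in>E. (\<Sum>i\<in>I. M e i * x i) = 0)"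
  using assms
proof (induction E arbitrary: I M rule: finite_induct)
  case empty
  then obtain i where "i \<in> I" by (metis card_gt_0_iff card.empty ex_in_conv)
  then show ?case by (intro exI[of _ "\<lambda>_. 1"]) auto
next
  case (insert j E)
  show ?case
  proof (cases "\<forall>i\<in>I. M j i = 0")
    case True
    obtain x where "\<exists>i\<in>I. x i \<noteq> 0" "\<forall>e\<in>E. (\<Sum>i\<in>I. M e i * x i) = 0"
      using insert.IH[of I M] insert.prems insert.hyps by auto
    with True show ?thesis by (intro exI[of _ x]) auto
  next
    case False
    then obtain i where i: "i \<in> I" "M j i \<noteq> 0" by auto
    define J where "J = I - {i}"
    have I: "I = insert i J" "i \<notin> J" "finite J" using i insert.prems by (auto simp: J_def)
    define M' where "M' e k = M e k - M e i / M j i * M j k" for e k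
    have "card E < card J" using insert.prems insert.hyps I by simp
    then obtain x where x: "\<exists>i\<in>J. x i \<noteq> 0" "\<forall>e\<in>E. (\<Sum>i\<in>J. M' e i * x i) = 0"
      using insert.IH[OF I(3), of M'] by auto
    define y where "y = x(i := - (\<Sum>k\<in>J. M j k * x k) / M j i)"
    have yJ: "(\<Sum>k\<in>J. M e k * y k) = (\<Sum>k\<in>J. M e k * x k)" for e
      using I by (intro sum.cong) (auto simp: y_def)
    have eq: "(\<Sum>k\<in>I. M e k * y k) = (\<Sum>k\<in>J. M' e k * x k)" for e
    proof -
      have "(\<Sum>k\<in>I. M e k * y k) = M e i * y i + (\<Sum>k\<in>J. M e k * x k)"
        unfolding I(1) using I yJ by simp
      also have "M e i * y i = - (M e i / M j i) * (\<Sum>k\<in>J. M j k * x k)"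
        by (simp add: y_def)
      also have "\<dots> + (\<Sum>k\<in>J. M e k * x k) = (\<Sum>k\<in>J. M' e k * x k)"
        by (simp add: M'_def left_diff_distrib sum_subtractf sum_distrib_left sum_negf mult.assoc)
      finally show ?thesis .
    qed
    have "M' j k = 0" for k using i by (simp add: M'_def)
    with x eq show ?thesis
      using I by (intro exI[of _ y]) (auto simp: y_def)
  qed
qed

text \<open>A linear map with trivial kernel on a finite-dimensional space is bounded below;
  eliminating a pivot unknown gives the constant by recursion. This constant is what makes the later
  perturbation argument quantitative.\<close>

lemma injective_system_bound:
  fixes M :: "'e \<Rightarrow> 'i \<Rightarrow> real"
  assumes "finite I" "finite E"
    and "\<And>x. \<forall>e\<in>E. (\<Sum>i\<in>I. M e i * x i) = 0 \<Longrightarrow> \<forall>i\<in>I. x i = 0"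
  shows "\<exists>C\<ge>0. \<forall>x. (\<Sum>i\<in>I. \<bar>x i\<bar>) \<le> C * (\<Sum>e\<in>E. \<bar>\<Sum>i\<in>I. M e i * x i\<bar>)"
  using assms
proof (induction I arbitrary: E M rule: finite_induct)
  case empty
  then show ?case by (intro exI[of _ 0]) auto
next
  case (insert i I)
  have "\<exists>j\<in>E. M j i \<noteq> 0"
  proof (rule ccontr)
    assume "\<not> ?thesis"
    then have "\<forall>e\<in>E. (\<Sum>k\<in>insert i I. M e k * (if k = i then 1 else 0)) = 0"
      using insert.hyps by (auto simp: sum.delta intro!: sum.neutral)
    from insert.prems(2)[OF this] show False by auto
  qed
  then obtain j where j: "j \<in> E" "M j i \<noteq> 0" by auto
  define E' where "E' = E - {j}"
  have E': "finite E'" "E = insert j E'" "j \<notin> E'" using insert.prems j by (auto simp: E'_def)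
  define M' where "M' e k = M e k - M e i / M j i * M j k" for e k
  have sumM': "(\<Sum>k\<in>I. M' e k * x k) = (\<Sum>k\<in>I. M e k * x k) - (M e i / M j i) * (\<Sum>k\<in>I. M j k * x k)" for e x
    by (simp add: M'_def left_diff_distrib sum_subtractf sum_distrib_left mult.assoc)
  have "\<forall>k\<in>I. x k = 0" if x: "\<forall>e\<in>E'. (\<Sum>k\<in>I. M' e k * x k) = 0" for x
  proof -
    define y where "y = x(i := - (\<Sum>k\<in>I. M j k * x k) / M j i)"
    have yJ: "(\<Sum>k\<in>I. M e k * y k) = (\<Sum>k\<in>I. M e k * x k)" for e
      using insert.hyps by (intro sum.cong) (auto simp: y_def)
    have eq: "(\<Sum>k\<in>insert i I. M e k * y k) = (\<Sum>k\<in>I. M' e k * x k)" for e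
    proof -
      have "(\<Sum>k\<in>insert i I. M e k * y k) = M e i * y i + (\<Sum>k\<in>I. M e k * x k)"
        using insert.hyps yJ by simp
      also have "M e i * y i = - (M e i / M j i) * (\<Sum>k\<in>I. M j k * x k)"
        by (simp add: y_def)
      finally show ?thesis by (simp add: sumM')
    qed
    have "M' j k = 0" for k using j by (simp add: M'_def)
    then have "\<forall>e\<in>E. (\<Sum>k\<in>insert i I. M e k * y k) = 0"
      using x eq E' by auto
    from insert.prems(2)[OF this] show ?thesis
      using insert.hyps by (auto simp: y_def split: if_splits)
  qed
  from insert.IH[OF E'(1) this] obtain C where C: "C \<ge> 0"
      "\<And>x. (\<Sum>k\<in>I. \<bar>x k\<bar>) \<le> C * (\<Sum>e\<in>E'. \<bar>\<Sum>k\<in>I. M' e k * x k\<bar>)" by auto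
  define K where "K = (\<Sum>e\<in>E'. \<bar>M e i / M j i\<bar>)"
  define B where "B = (\<Sum>k\<in>I. \<bar>M j k\<bar>)"
  have KB: "K \<ge> 0" "B \<ge> 0" by (auto simp: K_def B_def sum_nonneg)
  \<comment> \<open>The summand C * (1 + K) bounds the remaining unknowns through the reduced
    system; the quotient bounds the pivot unknown, which is recovered from equation j.\<close>
  define C' where "C' = C * (1 + K) + (1 + B * (C * (1 + K))) / \<bar>M j i\<bar>"
  have "(\<Sum>k\<in>insert i I. \<bar>x k\<bar>) \<le> C' * (\<Sum>e\<in>E. \<bar>\<Sum>k\<in>insert i I. M e k * x k\<bar>)" for x
  proof -
    define R where "R e = (\<Sum>k\<in>insert i I. M e k * x k)" for e
    define T where "T = (\<Sum>e\<in>E. \<bar>R e\<bar>)"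
    have T: "T = \<bar>R j\<bar> + (\<Sum>e\<in>E'. \<bar>R e\<bar>)" using E' by (simp add: T_def)
    have Rj: "\<bar>R j\<bar> \<le> T" by (simp add: T sum_nonneg)
    have RI: "(\<Sum>k\<in>I. M e k * x k) = R e - M e i * x i" for e
      using insert.hyps by (simp add: R_def)
    have 1: "(\<Sum>k\<in>I. M' e k * x k) = R e - M e i / M j i * R j" for e
      unfolding sumM' RI using j by (simp add: field_simps)
    have "(\<Sum>e\<in>E'. \<bar>\<Sum>k\<in>I. M' e k * x k\<bar>) \<le> (\<Sum>e\<in>E'. \<bar>R e\<bar> + \<bar>M e i / M j i\<bar> * \<bar>R j\<bar>)"
      unfolding 1 by (intro sum_mono) (metis abs_mult abs_triangle_ineq4)
    also have "\<dots> = (\<Sum>e\<in>E'. \<bar>R e\<bar>) + K * \<bar>R j\<bar>"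
      by (simp add: sum.distrib K_def sum_distrib_right)
    also have "\<dots> \<le> T + K * T"
      using KB Rj by (intro add_mono mult_left_mono) (auto simp: T)
    finally have "(\<Sum>k\<in>I. \<bar>x k\<bar>) \<le> C * (T + K * T)"
      using C by (meson mult_left_mono order_trans)
    then have 2: "(\<Sum>k\<in>I. \<bar>x k\<bar>) \<le> C * (1 + K) * T" by (simp add: algebra_simps)
    have "\<bar>\<Sum>k\<in>I. M j k * x k\<bar> \<le> (\<Sum>k\<in>I. \<bar>M j k\<bar> * \<bar>x k\<bar>)"
      by (rule order_trans[OF sum_abs]) (simp add: abs_mult)
    also have "\<dots> \<le> (\<Sum>k\<in>I. B * \<bar>x k\<bar>)"
      unfolding B_def using insert.hyps by (intro sum_mono mult_right_mono member_le_sum) auto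
    also have "\<dots> \<le> B * (C * (1 + K) * T)"
      using 2 KB by (simp flip: sum_distrib_left add: mult_left_mono)
    finally have 3: "\<bar>\<Sum>k\<in>I. M j k * x k\<bar> \<le> B * (C * (1 + K) * T)" .
    have "\<bar>M j i\<bar> * \<bar>x i\<bar> = \<bar>R j - (\<Sum>k\<in>I. M j k * x k)\<bar>"
      unfolding RI by (simp add: abs_mult)
    also have "\<dots> \<le> T + B * (C * (1 + K) * T)" using 3 Rj by linarith
    finally have "\<bar>x i\<bar> \<le> (T + B * (C * (1 + K) * T)) / \<bar>M j i\<bar>"
      using j by (simp add: pos_le_divide_eq mult.commute)
    also have "\<dots> = (1 + B * (C * (1 + K))) / \<bar>M j i\<bar> * T"
      by (simp add: algebra_simps)
    finally have "(\<Sum>k\<in>insert i I. \<bar>x k\<bar>) \<le> C' * T"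
      using 2 insert.hyps by (simp add: C'_def distrib_right)
    then show ?thesis by (simp add: T_def R_def)
  qed
  moreover have "C' \<ge> 0" using C KB by (simp add: C'_def)
  ultimately show ?case by blast
qed

text \<open>Row rank equals column rank. If x_i \<noteq> 0, dropping column i leaves fewer
  conditions on b than b has entries, so some nonzero b kills all other columns; pairing b with M x
  = 0 shows that it kills column i as well.\<close>

lemma square_system_right_injective:
  fixes M :: "'e \<Rightarrow> 'i \<Rightarrow> real"
  assumes fin: "finite E" "finite I" and card: "card I = card E"
    and left: "\<And>b. \<forall>i\<in>I. (\<Sum>e\<in>E. b e * M e i) = 0 \<Longrightarrow> \<forall>e\<in>E. b e = 0"
    and x: "\<forall>e\<in>E. (\<Sum>i\<in>I. M e i * x i) = 0"
  shows "\<forall>i\<in>I. x i = 0"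
proof (rule ccontr)
  assume "\<not> ?thesis"
  then obtain i where i: "i \<in> I" "x i \<noteq> 0" by auto
  have "card (I - {i}) < card E" using card i fin by (metis card_Diff1_less)
  then obtain b where b: "\<exists>e\<in>E. b e \<noteq> 0" "\<forall>k\<in>I - {i}. (\<Sum>e\<in>E. M e k * b e) = 0"
    using nonzero_kernel_vector[of "I - {i}" E "\<lambda>k e. M e k"] fin by auto
  have "0 = (\<Sum>e\<in>E. b e * (\<Sum>k\<in>I. M e k * x k))" using x by simp
  also have "\<dots> = (\<Sum>k\<in>I. x k * (\<Sum>e\<in>E. M e k * b e))"
    by (simp add: sum_distrib_left sum_distrib_right mult_ac sum.swap[of _ I E])
  also have "\<dots> = x i * (\<Sum>e\<in>E. M e i * b e)"
    using i fin b by (subst sum.remove[of I i]) auto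
  finally have "(\<Sum>e\<in>E. M e i * b e) = 0" using i by simp
  then have "\<forall>k\<in>I. (\<Sum>e\<in>E. b e * M e k) = 0" using b by (auto simp: mult.commute)
  from left[OF this] b show False by auto
qed

section \<open>Spaces of polynomial vectors as kernels of linear systems\<close>

definition index_set :: "nat \<Rightarrow> (nat \<Rightarrow> nat) \<Rightarrow> (nat \<times> nat) set" where
  "index_set s m = (SIGMA i:{1..s}. {..<m i})"

lemma finite_index_set [simp]: "finite (index_set s m)"
  by (simp add: index_set_def)

lemma card_index_set: "card (index_set s m) = (\<Sum>i=1..s. m i)"
  by (simp add: index_set_def)

lemma sum_index_set: "(\<Sum>x\<in>index_set s m. f x) = (\<Sum>i=1..s. \<Sum>l<m i. f (i, l))"
  unfolding index_set_def by (subst sum.Sigma) auto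

text \<open>This form absorbs both the degree bounds and the convention that a zero index means a
  zero component, so that membership is a linear condition on coefficients.\<close>

lemma poly_vectors_iff: "A \<in> poly_vectors s m \<longleftrightarrow> (\<forall>i l. (i, l) \<notin> index_set s m \<longrightarrow> coeff (A i) l = 0)"
proof
  assume A: "A \<in> poly_vectors s m"
  show "\<forall>i l. (i, l) \<notin> index_set s m \<longrightarrow> coeff (A i) l = 0"
  proof (intro allI impI)
    fix i l assume "(i, l) \<notin> index_set s m"
    then consider "i \<notin> {1..s}" | "i \<in> {1..s}" "l \<ge> m i" by (force simp: index_set_def)
    then show "coeff (A i) l = 0"
    proof cases
      case 2
      then have "A i = 0 \<or> degree (A i) < l"
        using A by (cases "m i = 0") (force simp: poly_vectors_def)+
      then show ?thesis by (auto simp: coeff_eq_0)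
    qed (use A in \<open>auto simp: poly_vectors_def\<close>)
  qed
next
  assume A: "\<forall>i l. (i, l) \<notin> index_set s m \<longrightarrow> coeff (A i) l = 0"
  have "A i = 0" if "i \<notin> {1..s}" for i
    using A that by (auto simp: poly_eq_iff index_set_def)
  moreover have "A i = 0" if "m i = 0" for i
    using A that by (auto simp: poly_eq_iff index_set_def)
  moreover have "degree (A i) \<le> m i - 1" if "m i \<noteq> 0" for i
  proof (intro degree_le allI impI)
    fix k assume "m i - 1 < k"
    then have "\<not> k < m i" by linarith
    then have "(i, k) \<notin> index_set s m" by (simp add: index_set_def)
    with A show "coeff (A i) k = 0" by simp
  qed
  ultimately show "A \<in> poly_vectors s m" by (auto simp: poly_vectors_def)
qed

lemma poly_vectors_eq_0:
  assumes "A \<in> poly_vectors s m" "\<forall>(i, l)\<in>index_set s m. coeff (A i) l = 0"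
  shows "A = 0"
  using assms unfolding poly_vectors_iff by (fastforce simp: fun_eq_iff poly_eq_iff)

definition vector_of_coeffs :: "nat \<Rightarrow> (nat \<Rightarrow> nat) \<Rightarrow> (nat \<times> nat \<Rightarrow> real) \<Rightarrow> nat \<Rightarrow> real poly" where
  "vector_of_coeffs s m x i = (\<Sum>l<m i. if i \<in> {1..s} then monom (x (i, l)) l else 0)"

lemma coeff_vector_of_coeffs:
  "coeff (vector_of_coeffs s m x i) l = (if (i, l) \<in> index_set s m then x (i, l) else 0)"
  by (cases "i \<in> {1..s}") (auto simp: vector_of_coeffs_def index_set_def coeff_sum sum.delta)

lemma vector_of_coeffs_in: "vector_of_coeffs s m x \<in> poly_vectors s m"
  by (simp add: poly_vectors_iff coeff_vector_of_coeffs)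

text \<open>One form for both problems, whose moment matrices are transposes of each other:
  \<open>E\<close> is polymorphic so that either the row conditions or the column conditions can
  index the equations.\<close>

definition system_kernel ::
  "nat \<Rightarrow> (nat \<Rightarrow> nat) \<Rightarrow> 'e set \<Rightarrow> ('e \<Rightarrow> nat \<times> nat \<Rightarrow> real) \<Rightarrow> (nat \<Rightarrow> real poly) set" where
  "system_kernel s m E M =
     {A \<in> poly_vectors s m. \<forall>e\<in>E. (\<Sum>x\<in>index_set s m. M e x * coeff (A (fst x)) (snd x)) = 0}"

lemma system_kernel_combination:
  assumes "A \<in> system_kernel s m E M" "B \<in> system_kernel s m E M"
  shows "(\<lambda>i. A i - Polynomial.smult c (B i)) \<in> system_kernel s m E M"
proof -
  have "(\<Sum>x\<in>index_set s m. M e x * (coeff (A (fst x)) (snd x) - c * coeff (B (fst x)) (snd x))) =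
      (\<Sum>x\<in>index_set s m. M e x * coeff (A (fst x)) (snd x)) -
        c * (\<Sum>x\<in>index_set s m. M e x * coeff (B (fst x)) (snd x))" for e
    by (simp add: right_diff_distrib sum_subtractf sum_distrib_left mult_ac)
  then show ?thesis using assms by (simp add: system_kernel_def poly_vectors_iff)
qed

lemma system_kernel_smult:
  assumes "A \<in> system_kernel s m E M"
  shows "(\<lambda>i. Polynomial.smult c (A i)) \<in> system_kernel s m E M"
proof -
  have "(\<Sum>x\<in>index_set s m. M e x * (c * coeff (A (fst x)) (snd x))) =
      c * (\<Sum>x\<in>index_set s m. M e x * coeff (A (fst x)) (snd x))" for e
    by (simp add: sum_distrib_left mult_ac)
  then show ?thesis using assms by (simp add: system_kernel_def poly_vectors_iff)
qed

lemma system_kernel_nonzero: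
  assumes "finite E" "card E < card (index_set s m)"
  obtains A where "A \<in> system_kernel s m E M" "A \<noteq> 0"
proof -
  obtain x where x: "\<exists>i\<in>index_set s m. x i \<noteq> 0" "\<forall>e\<in>E. (\<Sum>i\<in>index_set s m. M e i * x i) = 0"
    using nonzero_kernel_vector[OF assms(1) finite_index_set assms(2)] by blast
  have "vector_of_coeffs s m x \<in> system_kernel s m E M"
    using x(2) by (simp add: system_kernel_def vector_of_coeffs_in coeff_vector_of_coeffs cong: sum.cong)
  moreover have "vector_of_coeffs s m x \<noteq> 0"
  proof
    assume 0: "vector_of_coeffs s m x = 0"
    from x(1) obtain i l where "(i, l) \<in> index_set s m" "x (i, l) \<noteq> 0" by auto
    then show False using coeff_vector_of_coeffs[of s m x i l] 0 by simp
  qed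
  ultimately show ?thesis by (rule that)
qed

text \<open>For a linear space S this says that the coefficient at x is an injective functional.
  With fewer equations than unknowns it yields at once that the kernel is a line and that its
  generator has a nonzero coefficient at x; unlike a dimension it passes to nearby systems by an
  inequality.\<close>

definition detected_by :: "(nat \<Rightarrow> real poly) set \<Rightarrow> nat \<times> nat \<Rightarrow> bool" where
  "detected_by S x \<longleftrightarrow> (\<forall>A\<in>S. coeff (A (fst x)) (snd x) = 0 \<longrightarrow> A = 0)"

lemma detected_byD: "detected_by S x \<Longrightarrow> A \<in> S \<Longrightarrow> coeff (A (fst x)) (snd x) = 0 \<Longrightarrow> A = 0"
  by (auto simp: detected_by_def)

lemma weakly_normal_system_kernel:
  assumes E: "finite E" "card E < card (index_set s m)" and x: "detected_by (system_kernel s m E M) x"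
  shows "weakly_normal (system_kernel s m E M)"
proof -
  obtain A where A: "A \<in> system_kernel s m E M" "A \<noteq> 0" using system_kernel_nonzero[OF E] .
  then have cA: "coeff (A (fst x)) (snd x) \<noteq> 0" using x by (auto simp: detected_by_def)
  have "system_kernel s m E M \<subseteq> poly_vec.span {A}"
  proof
    fix B assume B: "B \<in> system_kernel s m E M"
    define c where "c = coeff (B (fst x)) (snd x) / coeff (A (fst x)) (snd x)"
    have "(\<lambda>i. B i - Polynomial.smult c (A i)) \<in> system_kernel s m E M"
      by (rule system_kernel_combination[OF B A(1)])
    moreover have "coeff (B (fst x) - Polynomial.smult c (A (fst x))) (snd x) = 0"
      using cA by (simp add: c_def)
    ultimately have "(\<lambda>i. B i - Polynomial.smult c (A i)) = 0"
      by (rule detected_byD[OF x])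
    then have "B = (\<lambda>i. Polynomial.smult c (A i))" by (auto simp: fun_eq_iff)
    then show "B \<in> poly_vec.span {A}" by (auto simp: poly_vec.span_singleton)
  qed
  then have "poly_vec.dim (system_kernel s m E M) = 1"
    using A by (intro poly_vec.dim_unique[of "{A}"]) (auto simp: poly_vec.independent_insert)
  then show ?thesis by (simp add: weakly_normal_def)
qed

lemma strongly_normal_system_kernel:
  assumes E: "finite E" "card E < card (index_set s m)"
    and x: "\<And>i. i \<in> {1..s} \<Longrightarrow> m i > 0 \<Longrightarrow> detected_by (system_kernel s m E M) (i, m i - 1)"
  shows "strongly_normal s m (system_kernel s m E M)"
proof -
  \<comment> \<open>Having fewer equations than unknowns forces a component with positive index, so
    at least one top coefficient is available for weak normality.\<close>
  have "index_set s m \<noteq> {}" using E by auto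
  then obtain i l where il: "(i, l) \<in> index_set s m" by auto
  then have "detected_by (system_kernel s m E M) (i, m i - 1)"
    by (intro x) (auto simp: index_set_def)
  then have "weakly_normal (system_kernel s m E M)" by (rule weakly_normal_system_kernel[OF E])
  moreover have "A i \<noteq> 0 \<and> degree (A i) = m i - 1"
    if A: "A \<in> system_kernel s m E M" "A \<noteq> 0" and i: "i \<in> {1..s}" "m i > 0" for A i
  proof -
    have c: "coeff (A i) (m i - 1) \<noteq> 0" using x[OF i] A by (auto simp: detected_by_def)
    moreover have "degree (A i) \<le> m i - 1"
      using A i by (auto simp: system_kernel_def poly_vectors_def split: if_splits)
    ultimately show ?thesis using le_degree[OF c] by auto
  qed
  ultimately show ?thesis by (auto simp: strongly_normal_def)
qed

section \<open>Stability under perturbation of the matrix\<close>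

lemma detected_by_bound:
  assumes E: "finite E" and x: "x \<in> index_set s m" "detected_by (system_kernel s m E M) x"
  obtains C where "C \<ge> 0"
    "\<And>A. A \<in> poly_vectors s m \<Longrightarrow> coeff (A (fst x)) (snd x) = 0 \<Longrightarrow>
      (\<Sum>y\<in>index_set s m. \<bar>coeff (A (fst y)) (snd y)\<bar>) \<le>
      C * (\<Sum>e\<in>E. \<bar>\<Sum>y\<in>index_set s m. M e y * coeff (A (fst y)) (snd y)\<bar>)"
proof -
  \<comment> \<open>Fixing the coefficient at x to be zero removes one unknown; detection says that
    the reduced homogeneous system is injective, hence bounded below.\<close>
  let ?I = "index_set s m - {x}"
  have "\<forall>i\<in>?I. v i = 0" if v: "\<forall>e\<in>E. (\<Sum>i\<in>?I. M e i * v i) = 0" for v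
  proof -
    define A where "A = vector_of_coeffs s m (v(x := 0))"
    have cA: "coeff (A (fst y)) (snd y) = (if y \<in> ?I then v y else 0)" for y
      by (cases y) (auto simp: A_def coeff_vector_of_coeffs)
    have "(\<Sum>y\<in>index_set s m. M e y * coeff (A (fst y)) (snd y)) = (\<Sum>i\<in>?I. M e i * v i)" for e
      unfolding cA by (rule sum.mono_neutral_cong_right) auto
    then have "A \<in> system_kernel s m E M" using v by (simp add: system_kernel_def A_def vector_of_coeffs_in)
    moreover have "coeff (A (fst x)) (snd x) = 0" unfolding cA by simp
    ultimately have "A = 0" using x by (auto simp: detected_by_def)
    then show ?thesis using cA by (metis coeff_0 zero_fun_apply)
  qed
  from injective_system_bound[OF _ E this] obtain C where C: "C \<ge> 0"
      "\<And>v. (\<Sum>i\<in>?I. \<bar>v i\<bar>) \<le> C * (\<Sum>e\<in>E. \<bar>\<Sum>i\<in>?I. M e i * v i\<bar>)" by auto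
  show ?thesis
  proof (rule that[OF C(1)])
    fix A :: "nat \<Rightarrow> real poly" assume A: "coeff (A (fst x)) (snd x) = 0"
    show "(\<Sum>y\<in>index_set s m. \<bar>coeff (A (fst y)) (snd y)\<bar>) \<le>
      C * (\<Sum>e\<in>E. \<bar>\<Sum>y\<in>index_set s m. M e y * coeff (A (fst y)) (snd y)\<bar>)"
      using C(2)[of "\<lambda>y. coeff (A (fst y)) (snd y)"] x A by (simp add: sum.remove)
  qed
qed

text \<open>With N the sum of the absolute values of the coefficients, replacing one matrix by the
  other costs at most C * D * N. Once C * D < 1/2 this is absorbed into the left-hand side at the
  price of doubling C.\<close>

lemma perturbed_bound:
  fixes M :: "real \<Rightarrow> 'e \<Rightarrow> nat \<times> nat \<Rightarrow> real"
  assumes E: "finite E" and x: "x \<in> index_set s m" "detected_by (system_kernel s m E M0) x"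
    and lim: "\<And>e y. e \<in> E \<Longrightarrow> y \<in> index_set s m \<Longrightarrow> ((\<lambda>\<tau>. M \<tau> e y) \<longlongrightarrow> M0 e y) at_top"
  obtains C where "C \<ge> 0"
    "\<forall>\<^sub>F \<tau> in at_top. \<forall>A. A \<in> poly_vectors s m \<longrightarrow> coeff (A (fst x)) (snd x) = 0 \<longrightarrow>
      (\<Sum>y\<in>index_set s m. \<bar>coeff (A (fst y)) (snd y)\<bar>) \<le>
      C * (\<Sum>e\<in>E. \<bar>\<Sum>y\<in>index_set s m. M \<tau> e y * coeff (A (fst y)) (snd y)\<bar>)"
proof -
  let ?I = "index_set s m"
  obtain C where C: "C \<ge> 0" "\<And>A. A \<in> poly_vectors s m \<Longrightarrow> coeff (A (fst x)) (snd x) = 0 \<Longrightarrow>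
      (\<Sum>y\<in>?I. \<bar>coeff (A (fst y)) (snd y)\<bar>) \<le>
      C * (\<Sum>e\<in>E. \<bar>\<Sum>y\<in>?I. M0 e y * coeff (A (fst y)) (snd y)\<bar>)"
    using detected_by_bound[OF E x] by blast
  define D where "D \<tau> = (\<Sum>e\<in>E. \<Sum>y\<in>?I. \<bar>M0 e y - M \<tau> e y\<bar>)" for \<tau>
  have "((\<lambda>\<tau>. C * D \<tau>) \<longlongrightarrow> C * (\<Sum>e\<in>E. \<Sum>y\<in>?I. \<bar>M0 e y - M0 e y\<bar>)) at_top"
    unfolding D_def by (intro tendsto_intros lim)
  then have "\<forall>\<^sub>F \<tau> in at_top. C * D \<tau> < 1 / 2"
    by (intro order_tendstoD) auto
  then have "\<forall>\<^sub>F \<tau> in at_top. \<forall>A. A \<in> poly_vectors s m \<longrightarrow> coeff (A (fst x)) (snd x) = 0 \<longrightarrow>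
      (\<Sum>y\<in>?I. \<bar>coeff (A (fst y)) (snd y)\<bar>) \<le>
      (2 * C) * (\<Sum>e\<in>E. \<bar>\<Sum>y\<in>?I. M \<tau> e y * coeff (A (fst y)) (snd y)\<bar>)"
  proof eventually_elim
    case (elim \<tau>)
    show ?case
    proof (intro allI impI)
      fix A assume A: "A \<in> poly_vectors s m" "coeff (A (fst x)) (snd x) = 0"
      define c where "c y = coeff (A (fst y)) (snd y)" for y
      define N where "N = (\<Sum>y\<in>?I. \<bar>c y\<bar>)"
      have N0: "N \<ge> 0" by (simp add: N_def sum_nonneg)
      have cN: "\<bar>c y\<bar> \<le> N" if "y \<in> ?I" for y
        unfolding N_def by (rule member_le_sum) (use that in auto)
      have "(\<Sum>e\<in>E. \<bar>\<Sum>y\<in>?I. M0 e y * c y\<bar>) \<le>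
          (\<Sum>e\<in>E. \<bar>\<Sum>y\<in>?I. M \<tau> e y * c y\<bar> + (\<Sum>y\<in>?I. \<bar>M0 e y - M \<tau> e y\<bar> * N))"
      proof (rule sum_mono)
        fix e assume "e \<in> E"
        have "(\<Sum>y\<in>?I. M0 e y * c y) = (\<Sum>y\<in>?I. M \<tau> e y * c y) + (\<Sum>y\<in>?I. (M0 e y - M \<tau> e y) * c y)"
          by (simp add: left_diff_distrib sum_subtractf)
        moreover have "\<bar>\<Sum>y\<in>?I. (M0 e y - M \<tau> e y) * c y\<bar> \<le> (\<Sum>y\<in>?I. \<bar>M0 e y - M \<tau> e y\<bar> * N)"
          by (rule order_trans[OF sum_abs]) (auto simp: abs_mult intro!: sum_mono mult_left_mono cN)
        ultimately show "\<bar>\<Sum>y\<in>?I. M0 e y * c y\<bar> \<le>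
            \<bar>\<Sum>y\<in>?I. M \<tau> e y * c y\<bar> + (\<Sum>y\<in>?I. \<bar>M0 e y - M \<tau> e y\<bar> * N)" by linarith
      qed
      also have "\<dots> = (\<Sum>e\<in>E. \<bar>\<Sum>y\<in>?I. M \<tau> e y * c y\<bar>) + D \<tau> * N"
        by (simp add: sum.distrib D_def sum_distrib_right)
      finally have "C * (\<Sum>e\<in>E. \<bar>\<Sum>y\<in>?I. M0 e y * c y\<bar>) \<le>
          C * ((\<Sum>e\<in>E. \<bar>\<Sum>y\<in>?I. M \<tau> e y * c y\<bar>) + D \<tau> * N)"
        using C(1) by (rule mult_left_mono)
      moreover have "N \<le> C * (\<Sum>e\<in>E. \<bar>\<Sum>y\<in>?I. M0 e y * c y\<bar>)"
        using C(2)[OF A] by (simp add: N_def c_def)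
      moreover have "(C * D \<tau>) * N \<le> 1 / 2 * N"
        using elim N0 by (intro mult_right_mono) auto
      ultimately have "N \<le> 2 * C * (\<Sum>e\<in>E. \<bar>\<Sum>y\<in>?I. M \<tau> e y * c y\<bar>)"
        by (simp add: algebra_simps)
      then show "(\<Sum>y\<in>?I. \<bar>coeff (A (fst y)) (snd y)\<bar>) \<le>
          (2 * C) * (\<Sum>e\<in>E. \<bar>\<Sum>y\<in>?I. M \<tau> e y * coeff (A (fst y)) (snd y)\<bar>)"
        by (simp add: N_def c_def)
    qed
  qed
  with C(1) show ?thesis by (intro that[of "2 * C"]) auto
qed

lemma eventually_detected_by:
  fixes M :: "real \<Rightarrow> 'e \<Rightarrow> nat \<times> nat \<Rightarrow> real"
  assumes E: "finite E" and x: "x \<in> index_set s m" "detected_by (system_kernel s m E M0) x"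
    and lim: "\<And>e y. e \<in> E \<Longrightarrow> y \<in> index_set s m \<Longrightarrow> ((\<lambda>\<tau>. M \<tau> e y) \<longlongrightarrow> M0 e y) at_top"
  shows "\<forall>\<^sub>F \<tau> in at_top. detected_by (system_kernel s m E (M \<tau>)) x"
proof -
  let ?I = "index_set s m"
  obtain C where "C \<ge> 0"
    and ev: "\<forall>\<^sub>F \<tau> in at_top. \<forall>A. A \<in> poly_vectors s m \<longrightarrow> coeff (A (fst x)) (snd x) = 0 \<longrightarrow>
      (\<Sum>y\<in>?I. \<bar>coeff (A (fst y)) (snd y)\<bar>) \<le>
      C * (\<Sum>e\<in>E. \<bar>\<Sum>y\<in>?I. M \<tau> e y * coeff (A (fst y)) (snd y)\<bar>)"
    using perturbed_bound[OF E x lim] by blast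
  show ?thesis
    using ev
  proof eventually_elim
    case (elim \<tau>)
    show ?case unfolding detected_by_def
    proof (intro ballI impI)
      fix A assume A: "A \<in> system_kernel s m E (M \<tau>)" and 0: "coeff (A (fst x)) (snd x) = 0"
      then have "(\<Sum>y\<in>?I. \<bar>coeff (A (fst y)) (snd y)\<bar>) \<le> 0"
        using elim[rule_format, of A] by (simp add: system_kernel_def)
      then have "\<forall>y\<in>?I. \<bar>coeff (A (fst y)) (snd y)\<bar> = 0"
        by (subst sum_nonneg_eq_0_iff[symmetric]) (auto simp: sum_nonneg intro!: antisym)
      then show "A = 0" using A by (intro poly_vectors_eq_0[of A s m]) (auto simp: system_kernel_def)
    qed
  qed
qed

text \<open>The difference between the normalized solution for \<tau> and A has coefficient 0 at the
  normalized position, and its residual in the system for \<tau> is (M0 - M \<tau>) applied to A.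
  \<open>perturbed_bound\<close> therefore bounds every coefficient of the difference by a constant
  times the error of the matrix.\<close>

theorem normalized_convergence_system_kernel:
  fixes M :: "real \<Rightarrow> 'e \<Rightarrow> nat \<times> nat \<Rightarrow> real"
  assumes E: "finite E" "card E < card (index_set s m)"
    and x: "detected_by (system_kernel s m E M0) x1"
    and rate: "\<And>e y. e \<in> E \<Longrightarrow> y \<in> index_set s m \<Longrightarrow>
      (\<lambda>\<tau>. M \<tau> e y - M0 e y) \<in> O[at_top](\<lambda>\<tau>. \<tau> powr (-1/2))"
    and lim: "\<And>e y. e \<in> E \<Longrightarrow> y \<in> index_set s m \<Longrightarrow> ((\<lambda>\<tau>. M \<tau> e y) \<longlongrightarrow> M0 e y) at_top"
    and S: "\<forall>\<^sub>F \<tau> in at_top. S \<tau> = system_kernel s m E (M \<tau>)"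
  shows "normalized_convergence s S (system_kernel s m E M0)"
  unfolding normalized_convergence_def
proof (intro ballI allI impI conjI)
  fix A i0 k0
  assume A: "A \<in> system_kernel s m E M0" and i0: "i0 \<in> {1..s}" and c1: "coeff (A i0) k0 = 1"
  let ?I = "index_set s m"
  have x0: "(i0, k0) \<in> ?I"
    using A c1 by (auto simp: system_kernel_def poly_vectors_iff intro: ccontr)
  \<comment> \<open>All limiting solutions are multiples of A, so every position at which A has a
    nonzero coefficient detects the kernel, not only the given \<open>x1\<close>.\<close>
  have det: "detected_by (system_kernel s m E M0) (i0, k0)"
    unfolding detected_by_def
  proof (intro ballI impI)
    fix B assume B: "B \<in> system_kernel s m E M0" and 0: "coeff (B (fst (i0, k0))) (snd (i0, k0)) = 0"
    have cA: "coeff (A (fst x1)) (snd x1) \<noteq> 0"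
      using x A c1 by (auto simp: detected_by_def)
    define c where "c = coeff (B (fst x1)) (snd x1) / coeff (A (fst x1)) (snd x1)"
    have "(\<lambda>i. B i - Polynomial.smult c (A i)) \<in> system_kernel s m E M0"
      by (rule system_kernel_combination[OF B A])
    moreover have "coeff (B (fst x1) - Polynomial.smult c (A (fst x1))) (snd x1) = 0"
      using cA by (simp add: c_def)
    ultimately have "(\<lambda>i. B i - Polynomial.smult c (A i)) = 0"
      by (rule detected_byD[OF x])
    then have Bc: "B = (\<lambda>i. Polynomial.smult c (A i))" by (auto simp: fun_eq_iff)
    with 0 c1 have "c = 0" by simp
    with Bc show "B = 0" by (auto simp: fun_eq_iff)
  qed
  obtain C where C: "C \<ge> 0"
    and ev: "\<forall>\<^sub>F \<tau> in at_top. \<forall>A. A \<in> poly_vectors s m \<longrightarrow> coeff (A i0) k0 = 0 \<longrightarrow>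
      (\<Sum>y\<in>?I. \<bar>coeff (A (fst y)) (snd y)\<bar>) \<le>
      C * (\<Sum>e\<in>E. \<bar>\<Sum>y\<in>?I. M \<tau> e y * coeff (A (fst y)) (snd y)\<bar>)"
    using perturbed_bound[OF E(1) x0 det lim] by auto
  have evd: "\<forall>\<^sub>F \<tau> in at_top. detected_by (system_kernel s m E (M \<tau>)) (i0, k0)"
    by (rule eventually_detected_by[OF E(1) x0 det lim])
  have unique: "\<exists>!X. X \<in> S \<tau> \<and> coeff (X i0) k0 = 1"
    if S: "S \<tau> = system_kernel s m E (M \<tau>)" and d: "detected_by (system_kernel s m E (M \<tau>)) (i0, k0)" for \<tau>
  proof -
    obtain X where X: "X \<in> system_kernel s m E (M \<tau>)" "X \<noteq> 0" by (rule system_kernel_nonzero[OF E])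
    then have cX: "coeff (X i0) k0 \<noteq> 0" using d by (auto simp: detected_by_def)
    show ?thesis
    proof (rule ex1I)
      show "(\<lambda>i. Polynomial.smult (1 / coeff (X i0) k0) (X i)) \<in> S \<tau> \<and> coeff (Polynomial.smult (1 / coeff (X i0) k0) (X i0)) k0 = 1"
        using system_kernel_smult[OF X(1)] cX S by simp
      fix Y assume Y: "Y \<in> S \<tau> \<and> coeff (Y i0) k0 = 1"
      have "(\<lambda>i. Y i - Polynomial.smult (1 / coeff (X i0) k0) (X i)) \<in> system_kernel s m E (M \<tau>)"
        by (rule system_kernel_combination) (use X Y S in auto)
      then have "(\<lambda>i. Y i - Polynomial.smult (1 / coeff (X i0) k0) (X i)) = 0"
        by (rule detected_byD[OF d]) (use Y cX in simp)
      then show "Y = (\<lambda>i. Polynomial.smult (1 / coeff (X i0) k0) (X i))"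
        by (auto simp: fun_eq_iff)
    qed
  qed
  show "\<forall>\<^sub>F \<tau> in at_top. \<exists>!X. X \<in> S \<tau> \<and> coeff (X i0) k0 = 1"
    using evd S by eventually_elim (rule unique)
  fix X i k assume X: "\<forall>\<^sub>F \<tau> in at_top. X \<tau> \<in> S \<tau> \<and> coeff (X \<tau> i0) k0 = 1" and i: "i \<in> {1..s}"
  define D where "D \<tau> = C * (\<Sum>e\<in>E. \<bar>\<Sum>y\<in>?I. (M \<tau> e y - M0 e y) * coeff (A (fst y)) (snd y)\<bar>)" for \<tau>
  have D: "\<forall>\<^sub>F \<tau> in at_top. \<bar>coeff (X \<tau> i) k - coeff (A i) k\<bar> \<le> D \<tau>"
    using X S ev
  proof eventually_elim
    case (elim \<tau>)
    define B where "B i = X \<tau> i - Polynomial.smult 1 (A i)" for i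
    have XK: "X \<tau> \<in> system_kernel s m E (M \<tau>)" using elim by simp
    have B: "B \<in> poly_vectors s m"
      using XK A by (simp add: B_def system_kernel_def poly_vectors_iff)
    moreover have "coeff (B i0) k0 = 0" using elim c1 by (simp add: B_def)
    ultimately have "(\<Sum>y\<in>?I. \<bar>coeff (B (fst y)) (snd y)\<bar>) \<le>
        C * (\<Sum>e\<in>E. \<bar>\<Sum>y\<in>?I. M \<tau> e y * coeff (B (fst y)) (snd y)\<bar>)"
      using elim by blast
    also have "(\<Sum>e\<in>E. \<bar>\<Sum>y\<in>?I. M \<tau> e y * coeff (B (fst y)) (snd y)\<bar>) =
        (\<Sum>e\<in>E. \<bar>\<Sum>y\<in>?I. (M \<tau> e y - M0 e y) * coeff (A (fst y)) (snd y)\<bar>)"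
    proof (rule sum.cong)
      fix e assume e: "e \<in> E"
      have "(\<Sum>y\<in>?I. M \<tau> e y * coeff (B (fst y)) (snd y)) =
          (\<Sum>y\<in>?I. M \<tau> e y * coeff (X \<tau> (fst y)) (snd y)) - (\<Sum>y\<in>?I. M \<tau> e y * coeff (A (fst y)) (snd y))"
        by (simp add: B_def right_diff_distrib sum_subtractf)
      also have "\<dots> = - ((\<Sum>y\<in>?I. M \<tau> e y * coeff (A (fst y)) (snd y)) - (\<Sum>y\<in>?I. M0 e y * coeff (A (fst y)) (snd y)))"
        using XK A e by (simp add: system_kernel_def)
      also have "\<dots> = - (\<Sum>y\<in>?I. (M \<tau> e y - M0 e y) * coeff (A (fst y)) (snd y))"
        by (simp add: left_diff_distrib sum_subtractf)
      finally show "\<bar>\<Sum>y\<in>?I. M \<tau> e y * coeff (B (fst y)) (snd y)\<bar> =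
          \<bar>\<Sum>y\<in>?I. (M \<tau> e y - M0 e y) * coeff (A (fst y)) (snd y)\<bar>" by simp
    qed simp
    finally have bound: "(\<Sum>y\<in>?I. \<bar>coeff (B (fst y)) (snd y)\<bar>) \<le> D \<tau>" by (simp add: D_def)
    have "\<bar>coeff (B i) k\<bar> \<le> (\<Sum>y\<in>?I. \<bar>coeff (B (fst y)) (snd y)\<bar>)"
    proof (cases "(i, k) \<in> ?I")
      case True
      then show ?thesis
        using member_le_sum[of "(i, k)" ?I "\<lambda>y. \<bar>coeff (B (fst y)) (snd y)\<bar>"] by simp
    next
      case False
      then show ?thesis using B by (simp add: poly_vectors_iff sum_nonneg)
    qed
    with bound show ?case by (simp add: B_def)
  qed
  have DO: "D \<in> O[at_top](\<lambda>\<tau>. \<tau> powr (-1/2))"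
  proof -
    have mult: "(\<lambda>\<tau>. f \<tau> * c) \<in> O[at_top](\<lambda>\<tau>. \<tau> powr (-1/2))"
      if "f \<in> O[at_top](\<lambda>\<tau>. \<tau> powr (-1/2))" for c and f :: "real \<Rightarrow> real"
      using that by (cases "c = 0") auto
    have "(\<lambda>\<tau>. (\<Sum>e\<in>E. \<bar>\<Sum>y\<in>?I. (M \<tau> e y - M0 e y) * coeff (A (fst y)) (snd y)\<bar>) * C)
        \<in> O[at_top](\<lambda>\<tau>. \<tau> powr (-1/2))"
      by (intro mult big_sum_in_bigo landau_o.big.abs_in_iff[THEN iffD2] rate)
    then show ?thesis by (simp only: D_def[abs_def] mult.commute[of C])
  qed
  have "((\<lambda>\<tau>. C * (\<Sum>e\<in>E. \<bar>\<Sum>y\<in>?I. (M \<tau> e y - M0 e y) * coeff (A (fst y)) (snd y)\<bar>))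
      \<longlongrightarrow> C * (\<Sum>e\<in>E. \<bar>\<Sum>y\<in>?I. (M0 e y - M0 e y) * coeff (A (fst y)) (snd y)\<bar>)) at_top"
    by (intro tendsto_intros lim)
  then have D0: "(D \<longlongrightarrow> 0) at_top" by (simp add: D_def[abs_def])
  have "((\<lambda>\<tau>. coeff (X \<tau> i) k - coeff (A i) k) \<longlongrightarrow> 0) at_top"
    by (rule Lim_null_comparison[OF _ D0]) (use D in simp)
  then show "((\<lambda>\<tau>. coeff (X \<tau> i) k) \<longlongrightarrow> coeff (A i) k) at_top"
    by (simp add: LIM_zero_iff)
  have "\<forall>\<^sub>F \<tau> in at_top. norm (coeff (X \<tau> i) k - coeff (A i) k) \<le> norm (D \<tau>)"
    using D by eventually_elim auto
  then show "(\<lambda>\<tau>. coeff (X \<tau> i) k - coeff (A i) k) \<in> O[at_top](\<lambda>\<tau>. \<tau> powr (-1/2))"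
    by (rule landau_o.big.trans[OF landau_o.big_mono DO])
qed

section \<open>Convergence of the moments\<close>

lemma open_laplace_domain: "open (laplace_domain r \<rho>)"
proof -
  have "0 < \<rho> h + z \<longleftrightarrow> - \<rho> h < z" for h z by linarith
  then have "laplace_domain r \<rho> = (\<Inter>h\<in>{1..r}. {- \<rho> h<..})"
    by (simp add: laplace_domain_def set_eq_iff)
  then show ?thesis by (simp add: open_INT)
qed

lemma laplace_on_open_moments:
  assumes f: "laplace_on S f L" and S: "open S" "\<xi> \<in> S"
  shows "integrable lborel (\<lambda>t. t ^ k * (exp (\<xi> * t) * f t))"
    and "(\<lambda>w. L (\<xi> + w)) has_fps_expansion
      Abs_fps (\<lambda>k. (LINT t|lborel. t ^ k * (exp (\<xi> * t) * f t)) / fact k)"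
proof -
  obtain e where e: "e > 0" "ball \<xi> e \<subseteq> S" using S by (auto simp: open_contains_ball)
  then have "{\<xi> - e<..<\<xi> + e} \<subseteq> S" by (simp add: ball_eq_greaterThanLessThan)
  from laplace_on_moments[OF laplace_on_subset[OF f this] e(1)]
  show "integrable lborel (\<lambda>t. t ^ k * (exp (\<xi> * t) * f t))"
    and "(\<lambda>w. L (\<xi> + w)) has_fps_expansion
      Abs_fps (\<lambda>k. (LINT t|lborel. t ^ k * (exp (\<xi> * t) * f t)) / fact k)" by auto
qed

section \<open>The ratio of the exponential moments and its Taylor coefficients\<close>

lemma h_scale_square: "\<tau> > 0 \<Longrightarrow> h_scale \<tau> * h_scale \<tau> = 2 * \<tau>"
  by (simp add: h_scale_def)

text \<open>
  The ratio \<open>Y\<close> satisfies \<open>(1 + z / h) Y' = - (\<delta> + z\<^sup>2 / 2) Y / h\<close>, whose right-hand side is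
  \<open>O(1 / h)\<close>.
\<close>

lemma laguerre_ratio_deriv:
  assumes "\<tau> > 0" "1 + z / h_scale \<tau> > 0"
  shows "\<exists>D. (laguerre_ratio \<tau> \<delta> has_field_derivative D) (at z) \<and>
    (1 + z / h_scale \<tau>) * D = - (1 / h_scale \<tau>) * (\<delta> + z\<^sup>2 / 2) * laguerre_ratio \<tau> \<delta> z"
proof (intro exI conjI)
  define h where "h = h_scale \<tau>"
  have h: "h > 0" "h * h = 2 * \<tau>" using assms by (auto simp: h_def h_scale_pos h_scale_square)
  have hz: "1 + z / h > 0" using assms by (simp add: h_def)
  let ?D = "laguerre_ratio \<tau> \<delta> z * (\<tau> / h - (\<tau> + \<delta>) * ((1 / h) / (1 + z / h)) - z / 2)"
  show "(laguerre_ratio \<tau> \<delta> has_field_derivative ?D) (at z)"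
    unfolding laguerre_ratio_def[abs_def] h_def[symmetric]
    using h(1) hz by (auto intro!: derivative_eq_intros)
  have "(1 + z / h) * (\<tau> / h - (\<tau> + \<delta>) * ((1 / h) / (1 + z / h)) - z / 2) =
      (1 + z / h) * (\<tau> / h - z / 2) - (\<tau> + \<delta>) * (1 / h)"
    using hz by (simp add: right_diff_distrib)
  also have "\<dots> = - (1 / h) * (\<delta> + z\<^sup>2 / 2)"
  proof -
    \<comment> \<open>With this relation the terms \<tau> / h cancel, and so do the terms z / 2;
      only terms of size 1 / h are left.\<close>
    have "\<tau> = h * h / 2" using h(2) by simp
    then show ?thesis using h(1) by (simp add: field_simps power2_eq_square)
  qed
  finally have K: "(1 + z / h) * (\<tau> / h - (\<tau> + \<delta>) * ((1 / h) / (1 + z / h)) - z / 2) =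
      - (1 / h) * (\<delta> + z\<^sup>2 / 2)" .
  have "(1 + z / h) * ?D = laguerre_ratio \<tau> \<delta> z *
      ((1 + z / h) * (\<tau> / h - (\<tau> + \<delta>) * ((1 / h) / (1 + z / h)) - z / 2))"
    by (rule mult.left_commute)
  also have "\<dots> = - (1 / h) * (\<delta> + z\<^sup>2 / 2) * laguerre_ratio \<tau> \<delta> z"
    unfolding K by (rule mult.commute)
  finally show "(1 + z / h_scale \<tau>) * ?D = - (1 / h_scale \<tau>) * (\<delta> + z\<^sup>2 / 2) * laguerre_ratio \<tau> \<delta> z"
    unfolding h_def .
qed

text \<open>The differential equation expanded at \<xi>: each coefficient of positive order is of
  size 1 / h relative to earlier ones, which is where the decay comes from. The term with the factor
  n is the part w / h of the left-hand factor; the others come from \<delta> + (\<xi> + w)^2 /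
  2.\<close>

lemma laguerre_ratio_fps_recursion:
  assumes \<tau>: "\<tau> > 0" "1 + \<xi> / h_scale \<tau> > 0"
    and G: "(\<lambda>w. laguerre_ratio \<tau> \<delta> (\<xi> + w)) has_fps_expansion G"
  shows "(1 + \<xi> / h_scale \<tau>) * (real (n + 1) * fps_nth G (n + 1)) =
    - (1 / h_scale \<tau>) * (real n * fps_nth G n + (\<delta> + \<xi>\<^sup>2 / 2) * fps_nth G n +
      \<xi> * (if n = 0 then 0 else fps_nth G (n - 1)) + (if n < 2 then 0 else fps_nth G (n - 2)) / 2)"
proof -
  define h where "h = h_scale \<tau>"
  have h: "h > 0" using \<tau> by (simp add: h_def h_scale_pos)
  let ?Y = "\<lambda>w. laguerre_ratio \<tau> \<delta> (\<xi> + w)"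
  have "open {w::real. 1 + (\<xi> + w) / h > 0}"
    by (intro open_Collect_less continuous_intros) (use h in auto)
  then have "\<forall>\<^sub>F w in nhds 0. w \<in> {w::real. 1 + (\<xi> + w) / h > 0}"
    by (rule eventually_nhds_in_open) (use \<tau> in \<open>simp add: h_def\<close>)
  then have ev: "\<forall>\<^sub>F w in nhds 0. ((1 + \<xi> / h) + (1 / h) * w) * deriv ?Y w =
      - (1 / h) * (((\<delta> + \<xi>\<^sup>2 / 2) + \<xi> * w + (1 / 2) * w ^ 2) * ?Y w)"
  proof eventually_elim
    case (elim w)
    then obtain D where D: "(laguerre_ratio \<tau> \<delta> has_field_derivative D) (at (\<xi> + w))"
        "(1 + (\<xi> + w) / h) * D = - (1 / h) * (\<delta> + (\<xi> + w)\<^sup>2 / 2) * laguerre_ratio \<tau> \<delta> (\<xi> + w)"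
      using laguerre_ratio_deriv[OF \<tau>(1), of "\<xi> + w" \<delta>] by (auto simp flip: h_def)
    have "deriv ?Y w = D"
      using D(1) DERIV_shift[of "laguerre_ratio \<tau> \<delta>" D w \<xi>]
      by (intro DERIV_imp_deriv) (simp add: add.commute)
    moreover have "1 + (\<xi> + w) / h = (1 + \<xi> / h) + (1 / h) * w" by (simp add: add_divide_distrib)
    moreover have "\<delta> + (\<xi> + w)\<^sup>2 / 2 = (\<delta> + \<xi>\<^sup>2 / 2) + \<xi> * w + (1 / 2) * w ^ 2"
      by (simp add: power2_eq_square field_simps)
    ultimately show ?case using D(2) by (metis mult.assoc)
  qed
  have L: "(\<lambda>w. ((1 + \<xi> / h) + (1 / h) * w) * deriv ?Y w) has_fps_expansion
      (fps_const (1 + \<xi> / h) + fps_const (1 / h) * fps_X) * fps_deriv G"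
    by (intro fps_expansion_intros G)
  have R: "(\<lambda>w. - (1 / h) * (((\<delta> + \<xi>\<^sup>2 / 2) + \<xi> * w + (1 / 2) * w ^ 2) * ?Y w)) has_fps_expansion
      fps_const (- (1 / h)) * ((fps_const (\<delta> + \<xi>\<^sup>2 / 2) + fps_const \<xi> * fps_X + fps_const (1 / 2) * fps_X ^ 2) * G)"
    by (intro fps_expansion_intros G)
  have "(\<lambda>w. - (1 / h) * (((\<delta> + \<xi>\<^sup>2 / 2) + \<xi> * w + (1 / 2) * w ^ 2) * ?Y w)) has_fps_expansion
      (fps_const (1 + \<xi> / h) + fps_const (1 / h) * fps_X) * fps_deriv G"
    using L ev unfolding has_fps_expansion_def by (auto elim: eventually_elim2)
  from has_fps_expansion_unique_real[OF this R]
  have "fps_nth ((fps_const (1 + \<xi> / h) + fps_const (1 / h) * fps_X) * fps_deriv G) n =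
    fps_nth (fps_const (- (1 / h)) * ((fps_const (\<delta> + \<xi>\<^sup>2 / 2) + fps_const \<xi> * fps_X + fps_const (1 / 2) * fps_X ^ 2) * G)) n"
    by simp
  then have "(1 + \<xi> / h) * (real (n + 1) * fps_nth G (n + 1)) + (1 / h) * (real n * fps_nth G n) =
    - (1 / h) * ((\<delta> + \<xi>\<^sup>2 / 2) * fps_nth G n +
      \<xi> * (if n = 0 then 0 else fps_nth G (n - 1)) + (1 / 2) * (if n < 2 then 0 else fps_nth G (n - 2)))"
    by (simp only: distrib_right mult.assoc fps_add_nth fps_mult_left_const_nth fps_X_mult_nth
        fps_X_power_mult_nth fps_deriv_nth) (cases n; simp)
  then show ?thesis unfolding h_def by (simp add: algebra_simps)
qed

lemma h_scale_at_top: "filterlim h_scale at_top at_top"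
  unfolding h_scale_def by real_asymp

lemma bigo_cmult:
  fixes f g :: "real \<Rightarrow> real"
  shows "f \<in> O[F](g) \<Longrightarrow> (\<lambda>x. c * f x) \<in> O[F](g)"
  by (cases "c = 0") auto

text \<open>With s = x / h the exponent is \<tau> (s - ln (1 + s) - s^2 / 2) - \<delta> ln (1 + s),
  because \<tau> s^2 / 2 = x^2 / 4. The first term is of order \<tau> s^3 and the second of order s,
  and both orders are \<tau> powr (-1/2).\<close>

lemma laguerre_ratio_rate:
  "(\<lambda>\<tau>. laguerre_ratio \<tau> \<delta> x - 1) \<in> O[at_top](\<lambda>\<tau>. \<tau> powr (-1/2))"
proof (cases "x = 0")
  \<comment> \<open>For x = 0 the quantity s vanishes identically, so asymptotics in a punctured
    neighbourhood of 0 could not be composed with it.\<close>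
  case True
  then show ?thesis by (simp add: laguerre_ratio_def)
next
  case False
  define s where "s \<tau> = x / h_scale \<tau>" for \<tau>
  have s0: "(s \<longlongrightarrow> 0) at_top"
    unfolding s_def by (intro real_tendsto_divide_at_top[OF tendsto_const] h_scale_at_top)
  have s: "filterlim s (at 0) at_top"
    unfolding filterlim_at
  proof
    show "\<forall>\<^sub>F \<tau> in at_top. s \<tau> \<in> UNIV \<and> s \<tau> \<noteq> 0"
      using eventually_gt_at_top[of 0]
      by eventually_elim (use False h_scale_pos in \<open>force simp: s_def\<close>)
  qed (rule s0)
  have sO: "s \<in> O[at_top](\<lambda>\<tau>. \<tau> powr (-1/2))"
  proof -
    have "(\<lambda>\<tau>. 1 / h_scale \<tau>) \<in> O[at_top](\<lambda>\<tau>. \<tau> powr (-1/2))"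
      unfolding h_scale_def by real_asymp
    then have "(\<lambda>\<tau>. x * (1 / h_scale \<tau>)) \<in> O[at_top](\<lambda>\<tau>. \<tau> powr (-1/2))"
      by (rule bigo_cmult)
    then show ?thesis by (simp add: s_def[abs_def])
  qed
  have "(\<lambda>s::real. s - ln (1 + s) - s\<^sup>2 / 2) \<in> O[at 0](\<lambda>s. s ^ 3)"
    by real_asymp
  from landau_o.big.compose[OF this s]
  have "(\<lambda>\<tau>. s \<tau> - ln (1 + s \<tau>) - (s \<tau>)\<^sup>2 / 2) \<in> O[at_top](\<lambda>\<tau>. (\<tau> powr (-1/2)) ^ 3)"
    by (rule landau_o.big.trans[OF _ landau_o.big_power[OF sO]])
  then have "(\<lambda>\<tau>. \<tau> * (s \<tau> - ln (1 + s \<tau>) - (s \<tau>)\<^sup>2 / 2)) \<in> O[at_top](\<lambda>\<tau>. \<tau> * (\<tau> powr (-1/2)) ^ 3)"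
    by (rule landau_o.big.mult[OF landau_o.big_refl])
  moreover have "(\<lambda>\<tau>::real. \<tau> * (\<tau> powr (-1/2)) ^ 3) \<in> O[at_top](\<lambda>\<tau>. \<tau> powr (-1/2))"
    by real_asymp
  ultimately have 1: "(\<lambda>\<tau>. \<tau> * (s \<tau> - ln (1 + s \<tau>) - (s \<tau>)\<^sup>2 / 2)) \<in> O[at_top](\<lambda>\<tau>. \<tau> powr (-1/2))"
    by (rule landau_o.big.trans)
  have "(\<lambda>s::real. ln (1 + s)) \<in> O[at 0](\<lambda>s. s)"
    by real_asymp
  from landau_o.big.compose[OF this s]
  have "(\<lambda>\<tau>. ln (1 + s \<tau>)) \<in> O[at_top](\<lambda>\<tau>. \<tau> powr (-1/2))"
    by (rule landau_o.big.trans[OF _ sO])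
  then have 2: "(\<lambda>\<tau>. \<delta> * ln (1 + s \<tau>)) \<in> O[at_top](\<lambda>\<tau>. \<tau> powr (-1/2))"
    by (rule bigo_cmult)
  define E where "E \<tau> = \<tau> * (s \<tau> - ln (1 + s \<tau>) - (s \<tau>)\<^sup>2 / 2) - \<delta> * ln (1 + s \<tau>)" for \<tau>
  have E: "E \<in> O[at_top](\<lambda>\<tau>. \<tau> powr (-1/2))"
    unfolding E_def[abs_def] by (rule sum_in_bigo[OF 1 2])
  have "E \<in> o[at_top](\<lambda>_. 1::real)"
    by (rule landau_o.big_small_trans[OF E]) real_asymp
  then have E0: "filterlim E (nhds 0) at_top" by (auto dest: smalloD_tendsto)
  have "(\<lambda>u::real. exp u - 1) \<in> O[at 0](\<lambda>u. u)" by real_asymp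
  then obtain c where c: "\<forall>\<^sub>F u in at (0::real). norm (exp u - 1) \<le> c * norm u"
    by (auto elim: landau_o.bigE)
  \<comment> \<open>\<open>E\<close> may take the value 0, so the punctured neighbourhood is filled
    in; at u = 0 the inequality is trivial.\<close>
  have "\<forall>\<^sub>F u in nhds (0::real). norm (exp u - 1) \<le> c * norm u"
    using c by (auto simp: eventually_at_filter elim: eventually_mono)
  then have "\<forall>\<^sub>F \<tau> in at_top. norm (exp (E \<tau>) - 1) \<le> c * norm (E \<tau>)"
    using E0 by (auto simp: filterlim_iff)
  then have "(\<lambda>\<tau>. exp (E \<tau>) - 1) \<in> O[at_top](E)" by (rule bigoI)
  then have "(\<lambda>\<tau>. exp (E \<tau>) - 1) \<in> O[at_top](\<lambda>\<tau>. \<tau> powr (-1/2))"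
    by (rule landau_o.big.trans[OF _ E])
  moreover have "\<forall>\<^sub>F \<tau> in at_top. laguerre_ratio \<tau> \<delta> x - 1 = exp (E \<tau>) - 1"
    using eventually_gt_at_top[of 0]
  proof eventually_elim
    case (elim \<tau>)
    have "\<tau> * (s \<tau>)\<^sup>2 / 2 = x\<^sup>2 / 4"
      using h_scale_square[OF elim] h_scale_pos[OF elim] elim
      by (simp add: s_def power2_eq_square field_simps)
    then show ?case
      by (simp add: laguerre_ratio_def E_def algebra_simps flip: s_def)
  qed
  ultimately show ?thesis by (simp only: landau_o.big.in_cong)
qed

lemma eventually_h_scale_gt: "\<forall>\<^sub>F \<tau> in at_top. h_scale \<tau> > c"
  using h_scale_at_top by (auto simp: filterlim_at_top_dense)

text \<open>The value of the ratio at \<xi> starts the induction; afterwards the recursion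
  multiplies bounded earlier coefficients by a factor of size 1 / h.\<close>

lemma laguerre_ratio_fps_rate:
  assumes G: "\<forall>\<^sub>F \<tau> in at_top. (\<lambda>w. laguerre_ratio \<tau> \<delta> (\<xi> + w)) has_fps_expansion G \<tau>"
  shows "(\<lambda>\<tau>. fps_nth (G \<tau>) n - (if n = 0 then 1 else 0)) \<in> O[at_top](\<lambda>\<tau>. \<tau> powr (-1/2))"
proof (induction n rule: less_induct)
  case (less n)
  show ?case
  proof (cases n)
    case 0
    have "\<forall>\<^sub>F \<tau> in at_top. fps_nth (G \<tau>) n - (if n = 0 then 1 else 0) = laguerre_ratio \<tau> \<delta> \<xi> - 1"
      using G
    proof eventually_elim
      case (elim \<tau>)
      from has_fps_expansion_nth_deriv[OF this, of 0] 0 show ?case by simp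
    qed
    then show ?thesis
      by (rule landau_o.big.in_cong[THEN iffD2]) (rule laguerre_ratio_rate)
  next
    case (Suc k)
    have bounded: "(\<lambda>\<tau>. fps_nth (G \<tau>) i) \<in> O[at_top](\<lambda>_. 1)" if "i < n" for i
    proof -
      have "(\<lambda>\<tau>. fps_nth (G \<tau>) i - (if i = 0 then 1 else 0)) \<in> O[at_top](\<lambda>_. 1::real)"
        by (rule landau_o.big.trans[OF less.IH[OF that]]) real_asymp
      moreover have "(\<lambda>_. if i = 0 then 1 else 0) \<in> O[at_top](\<lambda>_::real. 1::real)" by simp
      ultimately have "(\<lambda>\<tau>. (fps_nth (G \<tau>) i - (if i = 0 then 1 else 0)) + (if i = 0 then 1 else 0)) \<in> O[at_top](\<lambda>_. 1)"
        by (rule sum_in_bigo)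
      then show ?thesis by simp
    qed
    define R where "R \<tau> = real k * fps_nth (G \<tau>) k + (\<delta> + \<xi>\<^sup>2 / 2) * fps_nth (G \<tau>) k +
      \<xi> * (if k = 0 then 0 else fps_nth (G \<tau>) (k - 1)) + (if k < 2 then 0 else fps_nth (G \<tau>) (k - 2)) / 2" for \<tau>
    have R: "R \<in> O[at_top](\<lambda>_. 1)"
    proof -
      have 1: "(\<lambda>\<tau>. if k = 0 then 0 else fps_nth (G \<tau>) (k - 1)) \<in> O[at_top](\<lambda>_. 1)"
        using bounded[of "k - 1"] Suc by (cases "k = 0") auto
      have 2: "(\<lambda>\<tau>. (1/2) * (if k < 2 then 0 else fps_nth (G \<tau>) (k - 2))) \<in> O[at_top](\<lambda>_. 1)"
        using bounded[of "k - 2"] Suc by (cases "k < 2") auto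
      have 0: "(\<lambda>\<tau>. fps_nth (G \<tau>) k) \<in> O[at_top](\<lambda>_. 1)" using bounded[of k] Suc by simp
      show ?thesis
        unfolding R_def[abs_def] using 2 by (intro sum_in_bigo bigo_cmult 0 1) simp
    qed
    have q: "(\<lambda>\<tau>. - (1 / h_scale \<tau>) / (1 + \<xi> / h_scale \<tau>) / real n) \<in> O[at_top](\<lambda>\<tau>. \<tau> powr (-1/2))"
    proof -
      have n: "real n > 0" using Suc by simp
      consider "\<xi> = 0" | "\<xi> > 0" | "\<xi> < 0" by linarith
      then show ?thesis
        unfolding h_scale_def using n by cases (simp, real_asymp+)
    qed
    have "\<forall>\<^sub>F \<tau> in at_top. fps_nth (G \<tau>) n = - (1 / h_scale \<tau>) / (1 + \<xi> / h_scale \<tau>) / real n * R \<tau>"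
      using G eventually_gt_at_top[of 0] eventually_h_scale_gt[of "- \<xi>"]
    proof eventually_elim
      case (elim \<tau>)
      have p: "1 + \<xi> / h_scale \<tau> > 0" using elim h_scale_pos[of \<tau>] by (simp add: field_simps)
      have "(1 + \<xi> / h_scale \<tau>) * (real n * fps_nth (G \<tau>) n) = - (1 / h_scale \<tau>) * R \<tau>"
        using laguerre_ratio_fps_recursion[OF elim(2) p elim(1), of k] Suc by (simp add: R_def)
      then have "(1 + \<xi> / h_scale \<tau>) * real n * fps_nth (G \<tau>) n = - (1 / h_scale \<tau>) * R \<tau>"
        by (simp only: mult.assoc)
      then have "fps_nth (G \<tau>) n = (- (1 / h_scale \<tau>) * R \<tau>) / ((1 + \<xi> / h_scale \<tau>) * real n)"
        using p Suc by (metis nonzero_mult_div_cancel_left less_irrefl mult_eq_0_iff of_nat_eq_0_iff nat.distinct(1))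
      then show ?case by simp
    qed
    moreover have "(\<lambda>\<tau>. - (1 / h_scale \<tau>) / (1 + \<xi> / h_scale \<tau>) / real n * R \<tau>) \<in> O[at_top](\<lambda>\<tau>. \<tau> powr (-1/2))"
      using landau_o.big.mult[OF q R] by simp
    ultimately have "(\<lambda>\<tau>. fps_nth (G \<tau>) n) \<in> O[at_top](\<lambda>\<tau>. \<tau> powr (-1/2))"
      by (rule landau_o.big.in_cong[THEN iffD2])
    then show ?thesis using Suc by simp
  qed
qed

section \<open>Rate of convergence of the moments\<close>

lemma Lam_pos:
  assumes "\<forall>h\<in>{1..r}. d h > 0 \<and> \<rho> h > 0" "j \<in> {1..r+1}" "z \<in> laplace_domain r \<rho>"
  shows "Lam r \<rho> d a j z > 0"
proof -
  have q: "0 < \<rho> h / (\<rho> h + z)" if "h \<in> {1..r}" for h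
    using that assms by (auto simp: laplace_domain_def)
  then have "(\<rho> h / (\<rho> h + z)) powr d h > 0" if "h \<in> {1..r}" for h
    using that by (metis powr_gt_zero less_irrefl)
  then have "L_F r \<rho> d a z > 0"
    unfolding L_F_def by (intro mult_pos_pos prod_pos) auto
  then show ?thesis
    using assms(2) mult_pos_pos[OF q[of j]] by (auto simp: Lam_def)
qed

text \<open>The moment series T of the transformed row is the series L of the Hermite row times that
  of the ratio. The latter is obtained as the quotient T / L, possible since L has a nonzero
  constant term; the error of a moment is then a coefficient of the Cauchy product of L with the
  error of the ratio.\<close>

theorem transformed_moment_rate:
  assumes pos: "\<forall>h\<in>{1..r}. d h > 0 \<and> \<rho> h > 0" and j: "j \<in> {1..r+1}" and \<xi>: "\<xi> \<in> laplace_domain r \<rho>"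
  shows "(\<lambda>\<tau>. (LINT t|lborel. t ^ n * (exp (\<xi> * t) * transformed_row r \<rho> d a \<tau> j t)) -
    (LINT t|lborel. t ^ n * (exp (\<xi> * t) * hermite_row r \<rho> d a j t))) \<in> O[at_top](\<lambda>\<tau>. \<tau> powr (-1/2))"
    and "\<forall>\<^sub>F \<tau> in at_top. \<forall>n. integrable lborel (\<lambda>t. t ^ n * (exp (\<xi> * t) * transformed_row r \<rho> d a \<tau> j t))"
proof -
  define \<delta> :: real where "\<delta> = (if j \<le> r then 0 else 1)"
  define T where "T \<tau> = Abs_fps (\<lambda>k. (LINT t|lborel. t ^ k * (exp (\<xi> * t) * transformed_row r \<rho> d a \<tau> j t)) / fact k)" for \<tau>
  define L where "L = Abs_fps (\<lambda>k. (LINT t|lborel. t ^ k * (exp (\<xi> * t) * hermite_row r \<rho> d a j t)) / fact k)"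
  let ?S = "\<lambda>\<tau>. laplace_domain r \<rho> \<inter> {- h_scale \<tau><..}"
  have ev: "\<forall>\<^sub>F \<tau> in at_top. \<tau> > 0 \<and> \<xi> \<in> ?S \<tau>"
    using eventually_gt_at_top[of 0] eventually_h_scale_gt[of "- \<xi>"]
    by eventually_elim (use \<xi> in auto)
  have oS: "open (?S \<tau>)" for \<tau> by (intro open_Int open_laplace_domain open_greaterThan)
  show "\<forall>\<^sub>F \<tau> in at_top. \<forall>n. integrable lborel (\<lambda>t. t ^ n * (exp (\<xi> * t) * transformed_row r \<rho> d a \<tau> j t))"
    using ev by eventually_elim (use laplace_on_open_moments(1)[OF laplace_on_transformed_row[OF pos _ j] oS] in blast)
  have L: "(\<lambda>w. Lam r \<rho> d a j (\<xi> + w)) has_fps_expansion L"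
    unfolding L_def
    by (rule laplace_on_open_moments(2)[OF laplace_on_hermite_row[OF pos j] open_laplace_domain \<xi>])
  have L0: "fps_nth L 0 \<noteq> 0"
    using has_fps_expansion_nth_deriv[OF L, of 0] Lam_pos[OF pos j \<xi>, of a] by simp
  have G: "\<forall>\<^sub>F \<tau> in at_top. (\<lambda>w. laguerre_ratio \<tau> \<delta> (\<xi> + w)) has_fps_expansion T \<tau> / L"
    using ev
  proof eventually_elim
    case (elim \<tau>)
    have T: "(\<lambda>w. Lam r \<rho> d a j (\<xi> + w) * laguerre_ratio \<tau> \<delta> (\<xi> + w)) has_fps_expansion T \<tau>"
      unfolding T_def \<delta>_def
      by (rule laplace_on_open_moments(2)[OF laplace_on_transformed_row[OF pos _ j] oS]) (use elim in auto)
    have Q: "(\<lambda>w. (Lam r \<rho> d a j (\<xi> + w) * laguerre_ratio \<tau> \<delta> (\<xi> + w)) / Lam r \<rho> d a j (\<xi> + w)) has_fps_expansion T \<tau> / L"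
      by (rule has_fps_expansion_divide'[OF T L L0])
    have "open ((\<lambda>w. \<xi> + w) -` laplace_domain r \<rho>)"
      by (intro open_vimage open_laplace_domain continuous_intros)
    then have "\<forall>\<^sub>F w in nhds 0. w \<in> (\<lambda>w. \<xi> + w) -` laplace_domain r \<rho>"
      by (rule eventually_nhds_in_open) (use \<xi> in simp)
    then have "\<forall>\<^sub>F w in nhds 0. (Lam r \<rho> d a j (\<xi> + w) * laguerre_ratio \<tau> \<delta> (\<xi> + w)) / Lam r \<rho> d a j (\<xi> + w)
        = laguerre_ratio \<tau> \<delta> (\<xi> + w)"
    proof eventually_elim
      case (elim w)
      then have "Lam r \<rho> d a j (\<xi> + w) > 0" by (intro Lam_pos[OF pos j]) simp
      then show ?case by simp
    qed
    with Q show ?case unfolding has_fps_expansion_def by (auto elim: eventually_elim2)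
  qed
  define g where "g i \<tau> = fps_nth (T \<tau> / L) i - (if i = 0 then 1 else 0)" for i \<tau>
  have g: "g i \<in> O[at_top](\<lambda>\<tau>. \<tau> powr (-1/2))" for i
    unfolding g_def by (rule laguerre_ratio_fps_rate[OF G])
  have "fps_nth (T \<tau>) n - fps_nth L n = (\<Sum>i=0..n. g i \<tau> * fps_nth L (n - i))" for \<tau>
  proof -
    have "T \<tau> = (T \<tau> / L) * L" using L0 by (simp add: fps_divide_unit mult.assoc inverse_mult_eq_1)
    then have "fps_nth (T \<tau>) n = (\<Sum>i=0..n. fps_nth (T \<tau> / L) i * fps_nth L (n - i))"
      by (metis fps_mult_nth)
    also have "\<dots> = (\<Sum>i=0..n. g i \<tau> * fps_nth L (n - i) + (if i = 0 then fps_nth L (n - i) else 0))"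
      by (rule sum.cong) (auto simp: g_def algebra_simps)
    finally show ?thesis by (simp add: sum.distrib)
  qed
  then have eq: "(LINT t|lborel. t ^ n * (exp (\<xi> * t) * transformed_row r \<rho> d a \<tau> j t)) -
    (LINT t|lborel. t ^ n * (exp (\<xi> * t) * hermite_row r \<rho> d a j t)) = fact n * (\<Sum>i=0..n. g i \<tau> * fps_nth L (n - i))" for \<tau>
    by (simp add: T_def L_def field_simps)
  have "(\<lambda>\<tau>. \<Sum>i=0..n. g i \<tau> * fps_nth L (n - i)) \<in> O[at_top](\<lambda>\<tau>. \<tau> powr (-1/2))"
  proof (rule big_sum_in_bigo)
    fix i
    show "(\<lambda>\<tau>. g i \<tau> * fps_nth L (n - i)) \<in> O[at_top](\<lambda>\<tau>. \<tau> powr (-1/2))"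
      using g[of i] by (cases "fps_nth L (n - i) = 0") auto
  qed
  then show "(\<lambda>\<tau>. (LINT t|lborel. t ^ n * (exp (\<xi> * t) * transformed_row r \<rho> d a \<tau> j t)) -
    (LINT t|lborel. t ^ n * (exp (\<xi> * t) * hermite_row r \<rho> d a j t))) \<in> O[at_top](\<lambda>\<tau>. \<tau> powr (-1/2))"
    unfolding eq by simp
qed

lemma hermite_row_integrable:
  assumes "\<forall>h\<in>{1..r}. d h > 0 \<and> \<rho> h > 0" "j \<in> {1..r+1}" "\<xi> \<in> laplace_domain r \<rho>"
  shows "integrable lborel (\<lambda>t. t ^ n * (exp (\<xi> * t) * hermite_row r \<rho> d a j t))"
  by (rule laplace_on_open_moments(1)[OF laplace_on_hermite_row open_laplace_domain]) (use assms in auto)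

lemma hermite_row_moment:
  assumes "\<forall>h\<in>{1..r}. d h > 0 \<and> \<rho> h > 0" "j \<in> {1..r+1}" "\<xi> \<in> laplace_domain r \<rho>"
  shows "(\<lambda>w. Lam r \<rho> d a j (\<xi> + w)) has_fps_expansion
      Abs_fps (\<lambda>k. (LINT t|lborel. t ^ k * (exp (\<xi> * t) * hermite_row r \<rho> d a j t)) / fact k)"
  by (rule laplace_on_open_moments(2)[OF laplace_on_hermite_row open_laplace_domain]) (use assms in auto)

lemma rate_imp_tendsto:
  fixes f :: "real \<Rightarrow> real"
  assumes "(\<lambda>\<tau>. f \<tau> - c) \<in> O[at_top](\<lambda>\<tau>. \<tau> powr (-1/2))"
  shows "(f \<longlongrightarrow> c) at_top"
proof -
  have "(\<lambda>\<tau>. f \<tau> - c) \<in> o[at_top](\<lambda>_. 1::real)"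
    by (rule landau_o.big_small_trans[OF assms]) real_asymp
  then have "((\<lambda>\<tau>. f \<tau> - c) \<longlongrightarrow> 0) at_top" by (auto dest: smalloD_tendsto)
  then show ?thesis by (simp add: LIM_zero_iff)
qed

section \<open>The rational structure of the derivatives of the limiting transforms\<close>

lemma coeff_mult_top:
  fixes p q :: "real poly"
  assumes "degree p \<le> m" "degree q \<le> n"
  shows "coeff (p * q) (m + n) = coeff p m * coeff q n"
proof -
  have "coeff (p * q) (m + n) = (\<Sum>i\<le>m + n. coeff p i * coeff q (m + n - i))"
    by (rule coeff_mult)
  also have "\<dots> = (\<Sum>i\<in>{m}. coeff p i * coeff q (m + n - i))"
  proof (rule sum.mono_neutral_right)
    show "\<forall>i\<in>{..m + n} - {m}. coeff p i * coeff q (m + n - i) = 0"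
    proof
      fix i assume "i \<in> {..m + n} - {m}"
      then have "degree p < i \<or> degree q < m + n - i" using assms by auto
      then show "coeff p i * coeff q (m + n - i) = 0" by (auto simp: coeff_eq_0)
    qed
  qed auto
  finally show ?thesis by simp
qed

lemma degree_mult_le_add:
  fixes p q :: "real poly"
  shows "degree p \<le> m \<Longrightarrow> degree q \<le> n \<Longrightarrow> degree (p * q) \<le> m + n"
  by (meson add_mono degree_mult_le order_trans)

locale hermite_rows =
  fixes r :: nat and d \<rho> :: "nat \<Rightarrow> real" and a :: real and lam :: "nat \<Rightarrow> nat"
  assumes pos: "\<forall>h\<in>{1..r}. d h > 0 \<and> \<rho> h > 0"
    and admissible: "\<forall>i\<in>{1..r+1}. \<forall>j\<in>{1..r+1}. lam i \<le> lam j + 1"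
    and inj_rates: "inj_on \<rho> {h \<in> {1..r}. lam h > 0}"
begin

text \<open>A row with lambda_h = 0 contributes no column, but its pole is still present in L_F. If
  such a row exists, admissibility bounds every lambda_j by 1, so no derivative of L_F is ever
  taken.\<close>

definition active :: "nat set" where "active = {h \<in> {1..r}. lam h > 0}"

definition lin :: "nat \<Rightarrow> real poly" where "lin h = [:\<rho> h, 1:]"

definition den :: "real poly" where "den = (\<Prod>h\<in>active. lin h)"

definition den_without :: "nat \<Rightarrow> real poly" where "den_without h = (\<Prod>i\<in>active - {h}. lin i)"

definition row_factor :: "nat \<Rightarrow> real poly" where "row_factor j = (if j \<le> r then lin j else 1)"

text \<open>
  The numerators in \<open>\<partial>\<^sup>k \<Lambda>\<^sub>j = L\<^sub>F num\<^sub>j\<^sub>k / (den\<^sup>k (\<rho>\<^sub>j + z))\<close>, without the last factor for \<open>j = q\<close>. The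
  recursion comes from \<open>L\<^sub>F' / L\<^sub>F = a + z / 2 - (\<Sum>h. d\<^sub>h / (\<rho>\<^sub>h + z))\<close>, where only active \<open>h\<close> occur as
  soon as \<open>k > 0\<close>.
\<close>

definition multiplier :: "nat \<Rightarrow> nat \<Rightarrow> real poly" where
  "multiplier j k = [:a, 1/2:] * den - (\<Sum>h\<in>active. Polynomial.smult (d h) (den_without h)) -
     Polynomial.smult (real k) (pderiv den) - (if j \<le> r then den_without j else 0)"

primrec num :: "nat \<Rightarrow> nat \<Rightarrow> real poly" where
  "num j 0 = (if j \<le> r then [:\<rho> j:] else 1)"
| "num j (Suc k) = den * pderiv (num j k) + num j k * multiplier j k"

lemma finite_active [simp]: "finite active" by (simp add: active_def)

lemma active_subset: "h \<in> active \<Longrightarrow> h \<in> {1..r} \<and> lam h > 0" by (simp add: active_def)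

lemma activeI: "j \<in> {1..r+1} \<Longrightarrow> k < lam j \<Longrightarrow> j \<le> r \<Longrightarrow> j \<in> active"
  by (auto simp: active_def)

lemma den_split: "h \<in> active \<Longrightarrow> den = lin h * den_without h"
  by (simp add: den_def den_without_def prod.remove)

lemma active_eq_all:
  assumes "j \<in> {1..r+1}" "Suc k < lam j" shows "active = {1..r}"
proof -
  have "lam h > 0" if "h \<in> {1..r}" for h
  proof -
    have "lam j \<le> lam h + 1" using admissible assms(1) that by auto
    then show ?thesis using assms(2) by simp
  qed
  then show ?thesis by (auto simp: active_def)
qed

lemma poly_lin_pos: "z \<in> laplace_domain r \<rho> \<Longrightarrow> h \<in> {1..r} \<Longrightarrow> poly (lin h) z > 0"
  by (auto simp: laplace_domain_def lin_def)

lemma poly_den_pos: "z \<in> laplace_domain r \<rho> \<Longrightarrow> poly den z > 0"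
  unfolding den_def poly_prod by (intro prod_pos poly_lin_pos) (auto dest: active_subset)

lemma poly_row_factor_pos: "z \<in> laplace_domain r \<rho> \<Longrightarrow> j \<in> {1..r+1} \<Longrightarrow> poly (row_factor j) z > 0"
  using poly_lin_pos[of z j] by (auto simp: row_factor_def)

lemma L_F_pos: "z \<in> laplace_domain r \<rho> \<Longrightarrow> L_F r \<rho> d a z > 0"
  using Lam_pos[OF pos, of "r + 1" z a] by (simp add: Lam_def)

lemma L_F_deriv:
  assumes z: "z \<in> laplace_domain r \<rho>"
  shows "(L_F r \<rho> d a has_field_derivative
    L_F r \<rho> d a z * (a + z / 2 - (\<Sum>h=1..r. d h / (\<rho> h + z)))) (at z)"
proof -
  let ?g = "\<lambda>z. exp (a * z + z\<^sup>2 / 4 + (\<Sum>h=1..r. d h * (ln (\<rho> h) - ln (\<rho> h + z))))"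
  have eq: "L_F r \<rho> d a x = ?g x" if x: "x \<in> laplace_domain r \<rho>" for x
  proof -
    have "(\<rho> h / (\<rho> h + x)) powr d h = exp (d h * (ln (\<rho> h) - ln (\<rho> h + x)))" if "h \<in> {1..r}" for h
    proof -
      have "\<rho> h > 0" "\<rho> h + x > 0" using x that pos by (auto simp: laplace_domain_def)
      then show ?thesis by (simp add: powr_def ln_div)
    qed
    then show ?thesis by (simp add: L_F_def exp_add exp_sum)
  qed
  have p: "0 < \<rho> h + z" if "h \<in> {1..r}" for h using z that by (auto simp: laplace_domain_def)
  have "((\<lambda>z. \<Sum>h=1..r. d h * (ln (\<rho> h) - ln (\<rho> h + z))) has_field_derivative
      (\<Sum>h=1..r. - (d h / (\<rho> h + z)))) (at z)"
    by (rule DERIV_sum) (use p in \<open>force intro!: derivative_eq_intros\<close>)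
  then have "((\<lambda>z. a * z + z\<^sup>2 / 4 + (\<Sum>h=1..r. d h * (ln (\<rho> h) - ln (\<rho> h + z)))) has_field_derivative
      a + z / 2 + (\<Sum>h=1..r. - (d h / (\<rho> h + z)))) (at z)"
    by (intro DERIV_add) (auto intro!: derivative_eq_intros)
  then have "(?g has_field_derivative ?g z * (a + z / 2 + (\<Sum>h=1..r. - (d h / (\<rho> h + z))))) (at z)"
    by (rule DERIV_fun_exp)
  then have g: "(?g has_field_derivative L_F r \<rho> d a z * (a + z / 2 - (\<Sum>h=1..r. d h / (\<rho> h + z)))) (at z)"
    unfolding eq[OF z] by (simp add: sum_negf)
  show ?thesis
    by (rule has_field_derivative_transform_within_open[OF g open_laplace_domain z]) (simp add: eq)
qed

text \<open>The identity is cleared of denominators and proved on the whole open domain, so that it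
  can be differentiated. The step to k + 1 has k + 1 < lambda_j; then all rows h \<le> r are active,
  and every denominator rho_h + z of the logarithmic derivative of L_F divides
  \<open>den\<close>.\<close>

lemma higher_deriv_Lam:
  assumes j: "j \<in> {1..r+1}" and k: "k < lam j" and z: "z \<in> laplace_domain r \<rho>"
  shows "(deriv ^^ k) (Lam r \<rho> d a j) z * (poly den z ^ k * poly (row_factor j) z) = L_F r \<rho> d a z * poly (num j k) z"
  using k z
proof (induction k arbitrary: z)
  case 0
  then show ?case
    using poly_lin_pos[of z j] j by (auto simp: Lam_def row_factor_def lin_def)
next
  case (Suc k)
  let ?L = "L_F r \<rho> d a" and ?f = "(deriv ^^ k) (Lam r \<rho> d a j)"
  have all: "active = {1..r}" using active_eq_all[OF j Suc.prems(1)] .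
  note z = Suc.prems(2)
  have id: "?f x * (poly den x ^ k * poly (row_factor j) x) = ?L x * poly (num j k) x" if "x \<in> laplace_domain r \<rho>" for x
    using Suc.IH[OF _ that] Suc.prems by simp
  define S where "S = den ^ k * row_factor j"
  have S: "poly S x = poly den x ^ k * poly (row_factor j) x" for x by (simp add: S_def)
  have S0: "poly S x \<noteq> 0" if "x \<in> laplace_domain r \<rho>" for x
    using poly_den_pos[OF that] poly_row_factor_pos[OF that j] by (simp add: S)
  define L' where "L' = ?L z * (a + z / 2 - (\<Sum>h=1..r. d h / (\<rho> h + z)))"
  have DL: "(?L has_field_derivative L') (at z)" unfolding L'_def by (rule L_F_deriv[OF z])
  have Dr: "((\<lambda>x. ?L x * poly (num j k) x) has_field_derivative
      L' * poly (num j k) z + ?L z * poly (pderiv (num j k)) z) (at z)"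
    by (rule DERIV_cong[OF DERIV_mult[OF DL poly_DERIV]]) (simp add: mult.commute)
  have "((\<lambda>x. ?L x * poly (num j k) x / poly S x) has_field_derivative
      ((L' * poly (num j k) z + ?L z * poly (pderiv (num j k)) z) * poly S z -
        (?L z * poly (num j k) z) * poly (pderiv S) z) / (poly S z * poly S z)) (at z)"
    by (rule DERIV_divide[OF Dr poly_DERIV S0[OF z]])
  then have Df: "(?f has_field_derivative
      ((L' * poly (num j k) z + ?L z * poly (pderiv (num j k)) z) * poly S z -
        (?L z * poly (num j k) z) * poly (pderiv S) z) / (poly S z * poly S z)) (at z)"
  proof (rule has_field_derivative_transform_within_open[OF _ open_laplace_domain z])
    fix x assume "x \<in> laplace_domain r \<rho>"
    then show "?L x * poly (num j k) x / poly S x = ?f x"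
      using id[of x] S0[of x] by (metis S nonzero_eq_divide_eq)
  qed
  define Q Q' where "Q = poly (num j k) z" and "Q' = poly (pderiv (num j k)) z"
  define D D' where "D = poly den z" and "D' = poly (pderiv den) z"
  define s where "s = poly (row_factor j) z"
  define W where "W = poly (multiplier j k) z"
  have "deriv ?f z = ((L' * Q + ?L z * Q') * poly S z - (?L z * Q) * poly (pderiv S) z) / (poly S z * poly S z)"
    using DERIV_imp_deriv[OF Df] by (simp add: Q_def Q'_def)
  have f': "deriv ?f z * (poly S z * D) = (L' * D) * Q + ?L z * D * Q' - ?L z * Q * (poly (pderiv S) z * D / poly S z)"
  proof -
    have "deriv ?f z * poly S z = L' * Q + ?L z * Q' - ?L z * Q * (poly (pderiv S) z / poly S z)"
      using S0[OF z] \<open>deriv ?f z = _\<close> by (simp add: field_simps)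
    then have "deriv ?f z * (poly S z * D) = (L' * Q + ?L z * Q' - ?L z * Q * (poly (pderiv S) z / poly S z)) * D"
      by (simp only: mult.assoc[symmetric])
    then show ?thesis by (simp add: algebra_simps)
  qed
  \<comment> \<open>The derivative of rho_j + z is 1, and \<open>den\<close> supplies the missing
    factor rho_j + z; for the last row both sides are 0.\<close>
  have sD: "poly (pderiv (row_factor j)) z * D = s * (if j \<le> r then poly (den_without j) z else 0)"
  proof (cases "j \<le> r")
    case True
    then have "j \<in> active" using activeI[OF j Suc.prems(1)] by simp
    then have "D = poly (lin j) z * poly (den_without j) z" unfolding D_def using den_split by (metis poly_mult)
    then show ?thesis using True by (simp add: s_def row_factor_def lin_def pderiv_pCons)
  qed (simp add: row_factor_def)
  have S': "poly (pderiv S) z * D / poly S z = real k * D' + (if j \<le> r then poly (den_without j) z else 0)"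
  proof -
    have "poly (pderiv S) z * D = D ^ k * (poly (pderiv (row_factor j)) z * D) + s * (real k * D ^ (k - 1) * D' * D)"
      by (simp add: S_def pderiv_mult pderiv_power D_def D'_def s_def algebra_simps)
    also have "real k * D ^ (k - 1) * D' * D = real k * D' * D ^ k"
      by (cases k) auto
    finally have "poly (pderiv S) z * D = poly S z * (real k * D' + (if j \<le> r then poly (den_without j) z else 0))"
      unfolding sD by (simp add: S D_def s_def algebra_simps)
    then show ?thesis using S0[OF z] by simp
  qed
  have L'D: "L' * D = ?L z * ((a + z / 2) * D - (\<Sum>h\<in>active. d h * poly (den_without h) z))"
  proof -
    have "d h / (\<rho> h + z) * D = d h * poly (den_without h) z" if "h \<in> {1..r}" for h
    proof -
      have "D = (\<rho> h + z) * poly (den_without h) z"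
        unfolding D_def using den_split[of h] that all by (simp add: lin_def algebra_simps)
      then show ?thesis using poly_lin_pos[OF z that] by (simp add: lin_def)
    qed
    then have "(\<Sum>h=1..r. d h / (\<rho> h + z)) * D = (\<Sum>h\<in>active. d h * poly (den_without h) z)"
      unfolding all sum_distrib_right by (intro sum.cong) auto
    then show ?thesis unfolding L'_def by (simp add: algebra_simps)
  qed
  have W: "W = (a + z / 2) * D - (\<Sum>h\<in>active. d h * poly (den_without h) z) - real k * D' -
      (if j \<le> r then poly (den_without j) z else 0)"
    by (simp add: W_def multiplier_def poly_sum D_def D'_def algebra_simps)
  have "deriv ?f z * (poly S z * D) = ?L z * (D * Q' + Q * W)"
    unfolding f' L'D S' W by (simp add: algebra_simps)
  then show ?case
    by (simp add: S D_def Q_def Q'_def W_def mult_ac)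
qed

text \<open>The polynomials \<open>\<partial>\<^sup>k \<Lambda>\<^sub>j \<Prod>\<^sub>h (\<rho>\<^sub>h + z)\<^bsup>\<lambda>\<^sub>h\<^esup> / L\<^sub>F\<close>.\<close>

definition row_poly :: "nat \<Rightarrow> nat \<Rightarrow> real poly" where
  "row_poly j k = num j k * (\<Prod>h\<in>active. lin h ^ (lam h - k - (if h = j then 1 else 0)))"

definition full_den :: "real poly" where "full_den = (\<Prod>h\<in>active. lin h ^ lam h)"

text \<open>The subtractions of natural numbers in the exponents of \<open>row_poly\<close> are
  therefore not truncated: for h \<noteq> j admissibility gives k \<le> lambda_j - 1 \<le>
  lambda_h.\<close>

lemma exponent_le:
  assumes j: "j \<in> {1..r+1}" and k: "k < lam j" and h: "h \<in> active"
  shows "k + (if h = j then 1 else 0) \<le> lam h"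
proof (cases "h = j")
  case False
  have "h \<in> {1..r+1}" using active_subset[OF h] by auto
  then have "lam j \<le> lam h + 1" using admissible j by blast
  then show ?thesis using k False by simp
qed (use k in simp)

lemma row_poly_full_den:
  assumes j: "j \<in> {1..r+1}" and k: "k < lam j"
  shows "row_poly j k * (den ^ k * row_factor j) = num j k * full_den"
proof -
  have rf: "row_factor j = (\<Prod>h\<in>active. if h = j then lin h else 1)"
    using activeI[OF j k] by (auto simp: row_factor_def prod.delta dest: active_subset)
  have "(\<Prod>h\<in>active. lin h ^ (lam h - k - (if h = j then 1 else 0))) * (den ^ k * row_factor j) =
      (\<Prod>h\<in>active. lin h ^ (lam h - k - (if h = j then 1 else 0)) * (lin h ^ k * (if h = j then lin h else 1)))"
    unfolding rf den_def prod_power_distrib prod.distrib ..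
  also have "\<dots> = full_den"
    unfolding full_den_def
  proof (rule prod.cong)
    fix h assume h: "h \<in> active"
    have "lin h ^ (lam h - k - (if h = j then 1 else 0)) * (lin h ^ k * (if h = j then lin h else 1)) =
        lin h ^ ((lam h - k - (if h = j then 1 else 0)) + (k + (if h = j then 1 else 0)))"
      by (simp add: power_add)
    also have "(lam h - k - (if h = j then 1 else 0)) + (k + (if h = j then 1 else 0)) = lam h"
      using exponent_le[OF j k h] by (simp split: if_splits)
    finally show "lin h ^ (lam h - k - (if h = j then 1 else 0)) * (lin h ^ k * (if h = j then lin h else 1)) = lin h ^ lam h" .
  qed simp
  finally show ?thesis unfolding row_poly_def by (simp add: mult.assoc)
qed

lemma poly_full_den: "poly full_den z = (\<Prod>h=1..r. (\<rho> h + z) ^ lam h)"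
proof -
  have "(\<Prod>h=1..r. (\<rho> h + z) ^ lam h) = (\<Prod>h\<in>active. (\<rho> h + z) ^ lam h)"
    by (rule prod.mono_neutral_right) (auto simp: active_def)
  then show ?thesis by (simp add: full_den_def poly_prod lin_def)
qed

lemma higher_deriv_Lam_row_poly:
  assumes j: "j \<in> {1..r+1}" and k: "k < lam j" and z: "z \<in> laplace_domain r \<rho>"
  shows "poly full_den z * (deriv ^^ k) (Lam r \<rho> d a j) z = L_F r \<rho> d a z * poly (row_poly j k) z"
proof -
  define s where "s = poly den z ^ k * poly (row_factor j) z"
  have s: "s \<noteq> 0" using poly_den_pos[OF z] poly_row_factor_pos[OF z j] by (simp add: s_def)
  have 1: "(deriv ^^ k) (Lam r \<rho> d a j) z * s = L_F r \<rho> d a z * poly (num j k) z"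
    unfolding s_def by (rule higher_deriv_Lam[OF j k z])
  have 2: "poly (row_poly j k) z * s = poly (num j k) z * poly full_den z"
    using arg_cong[OF row_poly_full_den[OF j k], of "\<lambda>p. poly p z"] by (simp add: s_def)
  have "(poly full_den z * (deriv ^^ k) (Lam r \<rho> d a j) z) * s = (L_F r \<rho> d a z * poly (row_poly j k) z) * s"
    using 1 2 by (metis mult.assoc mult.commute)
  then show ?thesis using s by simp
qed

section \<open>Degrees, top coefficients and values at the poles\<close>

lemma lin_nonzero: "lin h \<noteq> 0" and degree_lin [simp]: "degree (lin h) = 1"
  by (auto simp: lin_def)

lemma lead_coeff_lin [simp]: "lead_coeff (lin h) = 1" by (simp add: lin_def)

lemma degree_den: "degree den = card active"
  unfolding den_def by (subst degree_prod_eq_sum_degree) (auto simp: lin_nonzero)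

lemma lead_coeff_den: "coeff den (card active) = 1"
proof -
  have "lead_coeff den = 1" unfolding den_def lead_coeff_prod by (rule prod.neutral) (simp only: lead_coeff_lin, simp)
  then show ?thesis by (simp add: degree_den)
qed

lemma den_nonzero: "den \<noteq> 0"
  by (simp add: den_def lin_nonzero)

lemma full_den_nonzero: "full_den \<noteq> 0"
  by (simp add: full_den_def lin_nonzero)

lemma degree_den_without: "h \<in> active \<Longrightarrow> degree (den_without h) = card active - 1"
  unfolding den_without_def by (subst degree_prod_eq_sum_degree) (auto simp: lin_nonzero)

text \<open>Only a + z / 2, the contribution of the exponential factor of L_F, reaches the top
  degree; the pole terms have degree at most the number of active rows.\<close>

lemma degree_multiplier:
  assumes j: "j \<le> r \<longrightarrow> j \<in> active"
  shows "degree (multiplier j k) \<le> card active + 1" and "coeff (multiplier j k) (card active + 1) = 1 / 2"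
proof -
  define R where "R = (\<Sum>h\<in>active. Polynomial.smult (d h) (den_without h)) +
     Polynomial.smult (real k) (pderiv den) + (if j \<le> r then den_without j else 0)"
  have m: "multiplier j k = [:a, 1/2:] * den - R" by (simp add: multiplier_def R_def)
  have R: "degree R \<le> card active"
    unfolding R_def
  proof (intro degree_add_le degree_sum_le)
    fix h assume "h \<in> active"
    then show "degree (Polynomial.smult (d h) (den_without h)) \<le> card active"
      by (intro order_trans[OF degree_smult_le]) (simp add: degree_den_without)
  next
    show "degree (Polynomial.smult (real k) (pderiv den)) \<le> card active"
      by (intro order_trans[OF degree_smult_le]) (simp add: degree_pderiv degree_den)
    show "degree (if j \<le> r then den_without j else 0) \<le> card active"
      using j by (simp add: degree_den_without)
  qed simp
  have T: "degree ([:a, 1/2:] * den) \<le> 1 + card active"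
    by (rule degree_mult_le_add) (auto simp: degree_den)
  show "degree (multiplier j k) \<le> card active + 1"
    unfolding m using R T by (intro degree_diff_le) auto
  have "coeff ([:a, 1/2:] * den) (1 + card active) = 1 / 2 * 1"
    by (subst coeff_mult_top) (auto simp: degree_den lead_coeff_den)
  moreover have "coeff R (1 + card active) = 0" using R by (intro coeff_eq_0) simp
  ultimately show "coeff (multiplier j k) (card active + 1) = 1 / 2" unfolding m by simp
qed

lemma degree_num:
  assumes j: "j \<le> r \<longrightarrow> j \<in> active"
  shows "degree (num j k) \<le> k * (card active + 1)"
proof (induction k)
  case (Suc k)
  have "degree (num j k * multiplier j k) \<le> k * (card active + 1) + (card active + 1)"
    by (rule degree_mult_le_add[OF Suc degree_multiplier(1)[OF j]])
  moreover have "degree (den * pderiv (num j k)) \<le> card active + k * (card active + 1)"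
    using Suc by (intro degree_mult_le_add) (auto simp: degree_den degree_pderiv)
  ultimately show ?case by (simp only: num.simps) (intro degree_add_le; simp)
qed simp

text \<open>Each derivative brings down one factor z / 2 from the Gaussian; this growth later
  separates the derivatives of the last row.\<close>

lemma top_coeff_num: "coeff (num (r + 1) k) (k * (card active + 1)) = (1 / 2) ^ k"
proof (induction k)
  case (Suc k)
  have j: "r + 1 \<le> r \<longrightarrow> r + 1 \<in> active" by simp
  have "coeff (den * pderiv (num (r + 1) k)) (Suc k * (card active + 1)) = 0"
  proof (rule coeff_eq_0)
    have "degree (den * pderiv (num (r + 1) k)) \<le> card active + k * (card active + 1)"
      using degree_num[OF j, of k] by (intro degree_mult_le_add) (auto simp: degree_den degree_pderiv)
    then show "degree (den * pderiv (num (r + 1) k)) < Suc k * (card active + 1)" by simp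
  qed
  moreover have "coeff (num (r + 1) k * multiplier (r + 1) k) (k * (card active + 1) + (card active + 1)) = (1 / 2) ^ k * (1 / 2)"
    by (subst coeff_mult_top[OF degree_num[OF j] degree_multiplier(1)[OF j]])
      (simp only: Suc degree_multiplier(2)[OF j])
  moreover have "k * (card active + 1) + (card active + 1) = Suc k * (card active + 1)" by simp
  ultimately show ?case by (simp only: num.simps coeff_add) simp
qed simp

lemma poly_den_at_pole: "h \<in> active \<Longrightarrow> poly den (- \<rho> h) = 0"
  by (simp add: den_split lin_def)

text \<open>This is where the distinctness of the rates of the active rows enters.\<close>

lemma poly_den_without_at_pole:
  "h \<in> active \<Longrightarrow> i \<in> active \<Longrightarrow> poly (den_without i) (- \<rho> h) = 0 \<longleftrightarrow> i \<noteq> h"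
  using inj_onD[OF inj_rates[folded active_def], of _ h] unfolding den_without_def poly_prod
  by (auto simp: lin_def)

text \<open>At the pole the summand with \<open>den\<close> drops out of the recursion, and the
  multiplier reduces to -(d_h + k + 1) times a nonzero number. The three terms are the orders
  contributed at -rho_h by L_F, by the k-th power of \<open>den\<close> and by the row factor; their
  sum is positive.\<close>

lemma num_at_pole: "h \<in> active \<Longrightarrow> poly (num h k) (- \<rho> h) \<noteq> 0"
proof (induction k)
  case 0
  then have "h \<in> {1..r}" using active_subset by blast
  then have "\<rho> h > 0" "h \<le> r" using pos by auto
  then show ?case by simp
next
  case (Suc k)
  let ?x = "- \<rho> h"
  define v where "v = poly (den_without h) ?x"
  have v: "v \<noteq> 0" using poly_den_without_at_pole[OF Suc.prems Suc.prems] by (simp add: v_def)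
  have hr: "h \<le> r" "d h > 0" using active_subset[OF Suc.prems] pos by auto
  have "poly (pderiv den) ?x = v"
  proof -
    have "pderiv (lin h) = 1" "poly (lin h) ?x = 0" by (simp_all add: lin_def pderiv_pCons)
    then show ?thesis unfolding den_split[OF Suc.prems] pderiv_mult by (simp add: v_def)
  qed
  moreover have "(\<Sum>i\<in>active. d i * poly (den_without i) ?x) = (\<Sum>i\<in>{h}. d i * poly (den_without i) ?x)"
    by (rule sum.mono_neutral_right) (use Suc.prems poly_den_without_at_pole[OF Suc.prems] in auto)
  ultimately have "poly (multiplier h k) ?x = - (d h + real k + 1) * v"
    using hr Suc.prems by (simp add: multiplier_def poly_sum poly_den_at_pole v_def algebra_simps)
  then show ?case using Suc v hr by (simp add: poly_den_at_pole)
qed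

section \<open>Degree bound and linear independence of the numerators\<close>

abbreviation total :: nat where "total \<equiv> \<Sum>j=1..r+1. lam j"

lemma sum_active: "(\<Sum>h\<in>active. lam h) = (\<Sum>h=1..r. lam h)"
  by (rule sum.mono_neutral_left) (auto simp: active_def)

text \<open>Let e be 1 if j \<le> r and 0 otherwise. The k (s + 1) from \<open>num\<close>, with s
  active rows, and the remaining exponents add up to the sum of lambda_h over h \<le> r plus k - e,
  and admissibility gives k - e \<le> lambda_q - 1.\<close>

lemma degree_row_poly:
  assumes j: "j \<in> {1..r+1}" and k: "k < lam j"
  shows "degree (row_poly j k) < total"
proof -
  have ja: "j \<le> r \<longrightarrow> j \<in> active" using activeI[OF j k] by simp
  define e where "e = (\<lambda>h. lam h - k - (if h = j then 1 else 0))"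
  have "degree (\<Prod>h\<in>active. lin h ^ e h) = (\<Sum>h\<in>active. e h)"
    by (subst degree_prod_eq_sum_degree) (auto simp: lin_nonzero degree_power_eq)
  then have deg: "degree (row_poly j k) \<le> k * (card active + 1) + (\<Sum>h\<in>active. e h)"
    unfolding row_poly_def using degree_num[OF ja] by (intro degree_mult_le_add) (simp_all add: e_def)
  have "(\<Sum>h\<in>active. lam h) = (\<Sum>h\<in>active. e h + (k + (if h = j then 1 else 0)))"
    using exponent_le[OF j k] by (intro sum.cong) (auto simp: e_def)
  also have "\<dots> = (\<Sum>h\<in>active. e h) + k * card active + (if j \<le> r then 1 else 0)"
    using ja by (auto simp: sum.distrib sum.delta dest: active_subset)
  finally have s: "(\<Sum>h\<in>active. lam h) = (\<Sum>h\<in>active. e h) + k * card active + (if j \<le> r then 1 else 0)" .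
  have tot: "total = (\<Sum>h\<in>active. lam h) + lam (r + 1)" by (simp add: sum_active)
  show ?thesis
  proof (cases "j \<le> r")
    case True
    have "lam j \<le> lam (r + 1) + 1" using admissible j by auto
    then show ?thesis using deg k s tot True by (simp add: algebra_simps)
  next
    case False
    then have "j = r + 1" using j by auto
    then show ?thesis using deg k s tot by (simp add: algebra_simps)
  qed
qed

text \<open>Consider the highest order K with a nonzero coefficient. Multiplying by den^(K + 1) and
  cancelling \<open>full_den\<close> puts all terms over one denominator; the poles then exclude
  order K for the rows h \<le> r, and growth at infinity excludes it for the last row.\<close>

lemma row_poly_independent:
  fixes b :: "nat \<times> nat \<Rightarrow> real"
  assumes 0: "(\<Sum>(j, k)\<in>index_set (r + 1) lam. Polynomial.smult (b (j, k)) (row_poly j k)) = 0"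
  shows "\<forall>x\<in>index_set (r + 1) lam. b x = 0"
proof (rule ccontr)
  let ?J = "index_set (r + 1) lam"
  assume "\<not> ?thesis"
  then have ne: "{x\<in>?J. b x \<noteq> 0} \<noteq> {}" by auto
  define K where "K = Max (snd ` {x\<in>?J. b x \<noteq> 0})"
  have fin: "finite (snd ` {x\<in>?J. b x \<noteq> 0})" by simp
  have "K \<in> snd ` {x\<in>?J. b x \<noteq> 0}" unfolding K_def by (rule Max_in[OF fin]) (use ne in auto)
  then obtain j0 where j0: "(j0, K) \<in> ?J" "b (j0, K) \<noteq> 0" by force
  have K: "k \<le> K" if "(j, k) \<in> ?J" "b (j, k) \<noteq> 0" for j k
    unfolding K_def by (rule Max_ge[OF fin]) (use that in force)
  \<comment> \<open>Chosen so that \<open>row_factor j * cofactor j = den\<close> for every j that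
    occurs; \<open>T\<close> is then the numerator over the common denominator den^(K + 1).\<close>
  define cofactor where "cofactor j = (if j \<le> r then den_without j else den)" for j
  define T where "T x = num (fst x) (snd x) * (den ^ (K - snd x) * cofactor (fst x))" for x
  define J where "J = {x\<in>?J. snd x \<le> K}"
  have JI: "j \<in> {1..r+1}" "k < lam j" "k \<le> K" "j \<le> r \<Longrightarrow> j \<in> active" if "(j, k) \<in> J" for j k
    using that activeI[of j k] by (auto simp: J_def index_set_def)
  have finJ: "finite J" by (simp add: J_def)
  have T: "row_poly j k * den ^ (K + 1) = full_den * T (j, k)" if "(j, k) \<in> J" for j k
  proof -
    have "row_factor j * cofactor j = den"
      using JI(4)[OF that] by (auto simp: row_factor_def cofactor_def den_split)
    then have "den ^ (K + 1) = den ^ k * row_factor j * (den ^ (K - k) * cofactor j)"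
      using JI(3)[OF that] by (metis (no_types, lifting) le_add_diff_inverse mult.assoc mult.commute power_add power_one_right)
    then have "row_poly j k * den ^ (K + 1) = (row_poly j k * (den ^ k * row_factor j)) * (den ^ (K - k) * cofactor j)"
      by (simp add: mult.assoc)
    also have "\<dots> = full_den * T (j, k)"
      unfolding row_poly_full_den[OF JI(1,2)[OF that]] by (simp add: T_def mult_ac)
    finally show ?thesis .
  qed
  have "(\<Sum>(j, k)\<in>?J. Polynomial.smult (b (j, k)) (row_poly j k)) = (\<Sum>(j, k)\<in>J. Polynomial.smult (b (j, k)) (row_poly j k))"
    by (rule sum.mono_neutral_right) (use K in \<open>auto simp: J_def\<close>)
  then have "0 = (\<Sum>(j, k)\<in>J. Polynomial.smult (b (j, k)) (row_poly j k)) * den ^ (K + 1)"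
    using 0 by simp
  also have "\<dots> = (\<Sum>x\<in>J. Polynomial.smult (b x) (full_den * T x))"
    unfolding sum_distrib_right by (rule sum.cong) (auto dest: T)
  also have "\<dots> = full_den * (\<Sum>x\<in>J. Polynomial.smult (b x) (T x))"
    by (simp add: sum_distrib_left)
  finally have zero: "(\<Sum>x\<in>J. Polynomial.smult (b x) (T x)) = 0"
    using full_den_nonzero by simp
  \<comment> \<open>At -rho_h every term of lower order contains the factor \<open>den\<close>, and
    a term of order K in another row contains \<open>den\<close> or \<open>den_without j\<close>
    with j \<noteq> h; all of these vanish there.\<close>
  have bh: "b (h, K) = 0" if h: "(h, K) \<in> J" "h \<le> r" for h
  proof -
    have ha: "h \<in> active" using JI(4)[OF h(1)] h(2) .
    have "0 = (\<Sum>x\<in>J. b x * poly (T x) (- \<rho> h))"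
      using arg_cong[OF zero, of "\<lambda>p. poly p (- \<rho> h)"] by (simp add: poly_sum)
    also have "\<dots> = (\<Sum>x\<in>{(h, K)}. b x * poly (T x) (- \<rho> h))"
    proof (rule sum.mono_neutral_right[OF finJ])
      show "\<forall>x\<in>J - {(h, K)}. b x * poly (T x) (- \<rho> h) = 0"
      proof
        fix x assume x: "x \<in> J - {(h, K)}"
        obtain j k where jk: "x = (j, k)" by force
        have "poly (den ^ (K - k) * cofactor j) (- \<rho> h) = 0"
        proof (cases "k < K")
          case True
          then show ?thesis using poly_den_at_pole[OF ha] by simp
        next
          case False
          then have "j \<noteq> h" using x jk JI(3)[of j k] by auto
          then show ?thesis
            using poly_den_at_pole[OF ha] poly_den_without_at_pole[OF ha, of j] JI(4)[of j k] x jk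
            by (auto simp: cofactor_def)
        qed
        then show "b x * poly (T x) (- \<rho> h) = 0" by (simp add: T_def jk)
      qed
    qed (use h in auto)
    finally have "b (h, K) * (poly (num h K) (- \<rho> h) * poly (den_without h) (- \<rho> h)) = 0"
      using h by (simp add: T_def cofactor_def)
    then show ?thesis
      using num_at_pole[OF ha] poly_den_without_at_pole[OF ha ha] by simp
  qed
  have "j0 = r + 1"
    using bh[of j0] j0 by (cases "j0 \<le> r") (auto simp: J_def index_set_def)
  then have q: "(r + 1, K) \<in> J" "b (r + 1, K) \<noteq> 0" using j0 by (auto simp: J_def)
  let ?s = "card active"
  \<comment> \<open>This is the degree of \<open>num (r + 1) K * den\<close>. A term of order k < K
    has degree at most K s + k + s, which is smaller, and the terms of order K with j \<le> r have
    just been excluded.\<close>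
  let ?n = "K * (?s + 1) + ?s"
  have "0 = (\<Sum>x\<in>J. b x * coeff (T x) ?n)"
    using arg_cong[OF zero, of "\<lambda>p. coeff p ?n"] by (simp add: coeff_sum)
  also have "\<dots> = (\<Sum>x\<in>{(r + 1, K)}. b x * coeff (T x) ?n)"
  proof (rule sum.mono_neutral_right[OF finJ])
    show "\<forall>x\<in>J - {(r + 1, K)}. b x * coeff (T x) ?n = 0"
    proof
      fix x assume x: "x \<in> J - {(r + 1, K)}"
      obtain j k where jk: "x = (j, k)" by force
      then have jJ: "(j, k) \<in> J" using x by simp
      show "b x * coeff (T x) ?n = 0"
      proof (cases "k = K")
        case True
        then have "j \<le> r" using x jk JI(1)[OF jJ] by auto
        then show ?thesis using bh[of j] jJ jk True by simp
      next
        case False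
        then have kK: "k < K" using JI(3)[OF jJ] by simp
        have c: "degree (cofactor j) \<le> ?s"
          using JI(4)[OF jJ] by (auto simp: cofactor_def degree_den degree_den_without)
        have p: "degree (den ^ (K - k)) \<le> (K - k) * ?s"
          by (simp add: degree_power_eq den_nonzero degree_den)
        have nm: "degree (num j k) \<le> k * (?s + 1)"
          using JI(4)[OF jJ] by (intro degree_num) simp
        have "degree (T x) \<le> k * (?s + 1) + ((K - k) * ?s + ?s)"
          unfolding T_def jk fst_conv snd_conv by (intro degree_mult_le_add c p nm)
        also have "\<dots> = K * ?s + k + ?s"
        proof -
          obtain e where "K = k + e" using kK less_imp_le le_Suc_ex by metis
          then show ?thesis by (simp add: algebra_simps)
        qed
        also have "\<dots> < ?n" using kK by simp
        finally show ?thesis by (simp add: coeff_eq_0)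
      qed
    qed
  qed (use q in auto)
  also have "\<dots> = b (r + 1, K) * (1 / 2) ^ K"
  proof -
    have "T (r + 1, K) = num (r + 1) K * den" by (simp add: T_def cofactor_def)
    moreover have "coeff (num (r + 1) K * den) ?n = (1 / 2) ^ K * 1"
    proof -
      have "degree (num (r + 1) K) \<le> K * (?s + 1)" by (rule degree_num) simp
      then show ?thesis
        by (subst coeff_mult_top) (simp_all only: degree_den order_refl top_coeff_num lead_coeff_den)
    qed
    ultimately show ?thesis by simp
  qed
  finally show False using q by simp
qed

end

section \<open>Orthogonality relations as linear systems for the moments\<close>

definition moment :: "(real \<Rightarrow> real) \<Rightarrow> real \<Rightarrow> nat \<Rightarrow> real" where
  "moment f \<xi> n = (LINT t|lborel. t ^ n * (exp (\<xi> * t) * f t))"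

lemma poly_eq_sum_lessThan:
  fixes p :: "real poly"
  assumes "\<And>l. l \<ge> n \<Longrightarrow> coeff p l = 0"
  shows "poly p t = (\<Sum>l<n. coeff p l * t ^ l)"
proof -
  have "p = (\<Sum>l<n. monom (coeff p l) l)"
    using assms by (auto simp: poly_eq_iff coeff_sum not_less)
  then have "poly p t = poly (\<Sum>l<n. monom (coeff p l) l) t" by simp
  then show ?thesis by (simp add: poly_sum poly_monom)
qed

text \<open>Since all monomial integrals exist, the integrability demanded by an orthogonality
  relation is automatic, and the relation becomes a single linear equation in the
  coefficients.\<close>

lemma orthogonality_iff:
  assumes A: "A \<in> poly_vectors s m"
    and int: "\<And>i n. i \<in> {1..s} \<Longrightarrow> integrable lborel (\<lambda>t. t ^ n * W i t)"
  shows "has_bochner_integral lborel (\<lambda>t. t ^ k * (\<Sum>i=1..s. poly (A i) t * W i t)) c \<longleftrightarrow>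
    c = (\<Sum>x\<in>index_set s m. (LINT t|lborel. t ^ (k + snd x) * W (fst x) t) * coeff (A (fst x)) (snd x))"
proof -
  have eq: "t ^ k * (\<Sum>i=1..s. poly (A i) t * W i t) =
      (\<Sum>x\<in>index_set s m. t ^ (k + snd x) * W (fst x) t * coeff (A (fst x)) (snd x))" for t
  proof -
    have "poly (A i) t = (\<Sum>l<m i. coeff (A i) l * t ^ l)" for i
      using A by (intro poly_eq_sum_lessThan) (auto simp: poly_vectors_iff index_set_def)
    then show ?thesis
      by (simp add: sum_index_set sum_distrib_left sum_distrib_right power_add mult_ac)
  qed
  have "has_bochner_integral lborel
      (\<lambda>t. \<Sum>x\<in>index_set s m. t ^ (k + snd x) * W (fst x) t * coeff (A (fst x)) (snd x))
      (\<Sum>x\<in>index_set s m. (LINT t|lborel. t ^ (k + snd x) * W (fst x) t) * coeff (A (fst x)) (snd x))"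
    by (intro has_bochner_integral_sum has_bochner_integral_mult_left)
      (auto simp: has_bochner_integral_iff index_set_def intro: int)
  then show ?thesis
    unfolding eq by (auto dest: has_bochner_integral_eq)
qed

lemma ball_index_set:
  "(\<forall>e\<in>index_set s m. P (fst e) (snd e)) \<longleftrightarrow> (\<forall>i\<in>{1..s}. \<forall>l<m i. P i l)"
  by (auto simp: index_set_def)

lemma A_solutions_eq_system_kernel:
  assumes "\<And>i j n. i \<in> {1..p} \<Longrightarrow> j \<in> {1..q} \<Longrightarrow> integrable lborel (\<lambda>t. t ^ n * (exp (\<xi> i * t) * U j t))"
  shows "A_solutions q p lam m U (exp_col \<xi>) =
    system_kernel p m (index_set q lam) (\<lambda>e x. moment (U (fst e)) (\<xi> (fst x)) (snd e + snd x))"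
proof (rule Set.set_eqI)
  fix A
  have "t ^ k * U j t * (\<Sum>i=1..p. poly (A i) t * exp_col \<xi> i t) =
      t ^ k * (\<Sum>i=1..p. poly (A i) t * (exp (\<xi> i * t) * U j t))" for k j t
    by (simp add: exp_col_def sum_distrib_left sum_distrib_right mult_ac)
  then have "has_bochner_integral lborel (\<lambda>t. t ^ k * U j t * (\<Sum>i=1..p. poly (A i) t * exp_col \<xi> i t)) 0 \<longleftrightarrow>
      (\<Sum>x\<in>index_set p m. moment (U j) (\<xi> (fst x)) (k + snd x) * coeff (A (fst x)) (snd x)) = 0"
    if "A \<in> poly_vectors p m" "j \<in> {1..q}" for j k
    using orthogonality_iff[of A p m "\<lambda>i t. exp (\<xi> i * t) * U j t" k 0] assms that
    by (simp only: moment_def eq_commute[of 0])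
  then show "A \<in> A_solutions q p lam m U (exp_col \<xi>) \<longleftrightarrow>
    A \<in> system_kernel p m (index_set q lam) (\<lambda>e x. moment (U (fst e)) (\<xi> (fst x)) (snd e + snd x))"
    unfolding A_solutions_def system_kernel_def mem_Collect_eq
      ball_index_set[of q lam "\<lambda>j k. (\<Sum>x\<in>index_set p m. moment (U j) (\<xi> (fst x)) (k + snd x) * coeff (A (fst x)) (snd x)) = 0"]
    by blast
qed

lemma B_solutions_eq_system_kernel:
  assumes "\<And>i j n. i \<in> {1..p} \<Longrightarrow> j \<in> {1..q} \<Longrightarrow> integrable lborel (\<lambda>t. t ^ n * (exp (\<xi> i * t) * U j t))"
  shows "B_solutions q p lam m U (exp_col \<xi>) =
    system_kernel q lam (index_set p m) (\<lambda>e x. moment (U (fst x)) (\<xi> (fst e)) (snd e + snd x))"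
proof (rule Set.set_eqI)
  fix B
  have "t ^ k * exp_col \<xi> i t * (\<Sum>j=1..q. poly (B j) t * U j t) =
      t ^ k * (\<Sum>j=1..q. poly (B j) t * (exp (\<xi> i * t) * U j t))" for k i t
    by (simp add: exp_col_def sum_distrib_left sum_distrib_right mult_ac)
  then have "has_bochner_integral lborel (\<lambda>t. t ^ k * exp_col \<xi> i t * (\<Sum>j=1..q. poly (B j) t * U j t)) 0 \<longleftrightarrow>
      (\<Sum>x\<in>index_set q lam. moment (U (fst x)) (\<xi> i) (k + snd x) * coeff (B (fst x)) (snd x)) = 0"
    if "B \<in> poly_vectors q lam" "i \<in> {1..p}" for i k
    using orthogonality_iff[of B q lam "\<lambda>j t. exp (\<xi> i * t) * U j t" k 0] assms that
    by (simp only: moment_def eq_commute[of 0])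
  then show "B \<in> B_solutions q p lam m U (exp_col \<xi>) \<longleftrightarrow>
    B \<in> system_kernel q lam (index_set p m) (\<lambda>e x. moment (U (fst x)) (\<xi> (fst e)) (snd e + snd x))"
    unfolding B_solutions_def system_kernel_def mem_Collect_eq
      ball_index_set[of p m "\<lambda>i k. (\<Sum>x\<in>index_set q lam. moment (U (fst x)) (\<xi> i) (k + snd x) * coeff (B (fst x)) (snd x)) = 0"]
    by blast
qed

text \<open>Common interface to both problems: one detecting coefficient of the limiting system
  yields everything except strong normality, which asks for detection by every top
  coefficient.\<close>

lemma perturbed_system:
  fixes M :: "real \<Rightarrow> 'e \<Rightarrow> nat \<times> nat \<Rightarrow> real"
  assumes E: "finite E" "card E < card (index_set s m)"
    and x: "x \<in> index_set s m" "detected_by (system_kernel s m E M0) x"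
    and rate: "\<And>e y. e \<in> E \<Longrightarrow> y \<in> index_set s m \<Longrightarrow>
      (\<lambda>\<tau>. M \<tau> e y - M0 e y) \<in> O[at_top](\<lambda>\<tau>. \<tau> powr (-1/2))"
    and S: "\<forall>\<^sub>F \<tau> in at_top. S \<tau> = system_kernel s m E (M \<tau>)"
  shows "weakly_normal (system_kernel s m E M0)"
    and "\<forall>\<^sub>F \<tau> in at_top. weakly_normal (S \<tau>)"
    and "normalized_convergence s S (system_kernel s m E M0)"
    and "(\<And>i. i \<in> {1..s} \<Longrightarrow> m i > 0 \<Longrightarrow> detected_by (system_kernel s m E M0) (i, m i - 1)) \<Longrightarrow>
      \<forall>\<^sub>F \<tau> in at_top. strongly_normal s m (S \<tau>)"
proof -
  have lim: "((\<lambda>\<tau>. M \<tau> e y) \<longlongrightarrow> M0 e y) at_top" if "e \<in> E" "y \<in> index_set s m" for e y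
    by (rule rate_imp_tendsto[OF rate[OF that]])
  show "weakly_normal (system_kernel s m E M0)"
    by (rule weakly_normal_system_kernel[OF E x(2)])
  show "\<forall>\<^sub>F \<tau> in at_top. weakly_normal (S \<tau>)"
  proof -
    have "\<forall>\<^sub>F \<tau> in at_top. detected_by (system_kernel s m E (M \<tau>)) x"
      by (rule eventually_detected_by[OF E(1) x lim])
    with S show ?thesis
      by eventually_elim (simp add: weakly_normal_system_kernel[OF E])
  qed
  show "normalized_convergence s S (system_kernel s m E M0)"
    by (rule normalized_convergence_system_kernel[OF E x(2) rate lim S])
  assume d: "\<And>i. i \<in> {1..s} \<Longrightarrow> m i > 0 \<Longrightarrow> detected_by (system_kernel s m E M0) (i, m i - 1)"
  have "\<forall>\<^sub>F \<tau> in at_top. \<forall>i\<in>{i\<in>{1..s}. m i > 0}. detected_by (system_kernel s m E (M \<tau>)) (i, m i - 1)"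
  proof (rule eventually_ball_finite)
    show "\<forall>i\<in>{i\<in>{1..s}. m i > 0}. \<forall>\<^sub>F \<tau> in at_top. detected_by (system_kernel s m E (M \<tau>)) (i, m i - 1)"
    proof
      fix i assume i: "i \<in> {i\<in>{1..s}. m i > 0}"
      show "\<forall>\<^sub>F \<tau> in at_top. detected_by (system_kernel s m E (M \<tau>)) (i, m i - 1)"
        by (rule eventually_detected_by[OF E(1) _ d lim]) (use i in \<open>auto simp: index_set_def\<close>)
    qed
  qed simp
  then show "\<forall>\<^sub>F \<tau> in at_top. strongly_normal s m (S \<tau>)"
    using S by eventually_elim (auto intro!: strongly_normal_system_kernel[OF E])
qed

section \<open>Vanishing orders at the column nodes\<close>

lemma deriv_shift: "deriv (\<lambda>w. f (x + w)) = (\<lambda>w. deriv f (x + w :: real))"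
proof
  fix w
  show "deriv (\<lambda>w. f (x + w)) w = deriv f (x + w)"
    unfolding deriv_def using DERIV_shift[of f _ w x] by (simp add: add.commute)
qed

lemma higher_deriv_shift: "(deriv ^^ k) (\<lambda>w. f (x + w)) = (\<lambda>w. (deriv ^^ k) f (x + w :: real))"
proof (induction k)
  case (Suc k)
  then show ?case using deriv_shift[of "(deriv ^^ k) f" x] by simp
qed simp

lemma poly_has_fps_expansion: "(\<lambda>z. poly p z) has_fps_expansion fps_of_poly (p :: real poly)"
  by (simp add: has_fps_expansion_def)

lemma neg_linear_power_dvd_iff: "[:\<xi>, -1 :: real:] ^ n dvd P \<longleftrightarrow> [:- \<xi>, 1:] ^ n dvd P"
proof -
  have "[:\<xi>, -1:] = Polynomial.smult (-1) [:- \<xi>, 1:]" by simp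
  then have "[:\<xi>, -1:] ^ n = Polynomial.smult ((-1) ^ n) ([:- \<xi>, 1:] ^ n)"
    by (simp only: smult_power)
  then show ?thesis by (simp add: smult_dvd_iff)
qed

lemma linear_power_dvd:
  fixes P :: "real poly"
  assumes "\<forall>l<n. coeff (pcompose P [:\<xi>, 1:]) l = 0"
  shows "[:\<xi>, -1:] ^ n dvd P"
proof -
  have "monom 1 n dvd pcompose P [:\<xi>, 1:]"
    using assms by (simp add: monom_1_dvd_iff')
  then obtain Q where "pcompose P [:\<xi>, 1:] = monom 1 n * Q" by (elim dvdE)
  then have "pcompose (pcompose P [:\<xi>, 1:]) [:- \<xi>, 1:] = pcompose (monom 1 n) [:- \<xi>, 1:] * pcompose Q [:- \<xi>, 1:]"
    by (simp add: pcompose_mult)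
  moreover have "pcompose (pcompose P [:\<xi>, 1:]) [:- \<xi>, 1:] = P"
    by (simp add: pcompose_pCons pcompose_idR flip: pcompose_assoc)
  moreover have "pcompose (monom 1 n) [:- \<xi>, 1:] = [:- \<xi>, 1:] ^ n"
    by (induction n) (simp_all only: monom_Suc pcompose_pCons, simp_all add: pcompose_1)
  ultimately have "[:- \<xi>, 1:] ^ n dvd P" by (metis dvd_triv_left)
  then show ?thesis by (simp add: neg_linear_power_dvd_iff)
qed

text \<open>Powers of linear factors at distinct nodes are coprime; in terms of root orders, the
  product collected so far has order 0 at the new node.\<close>

lemma prod_linear_powers_dvd:
  fixes P :: "real poly"
  assumes "finite I" "inj_on \<xi> I" "\<forall>i\<in>I. [:\<xi> i, -1:] ^ m i dvd P"
  shows "(\<Prod>i\<in>I. [:\<xi> i, -1:] ^ m i) dvd P"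
  using assms
proof (induction I rule: finite_induct)
  case (insert i I)
  define Q where "Q = (\<Prod>j\<in>I. [:\<xi> j, -1:] ^ m j)"
  have "Q dvd P" using insert by (simp add: Q_def inj_on_def)
  then obtain R where R: "P = Q * R" by (elim dvdE)
  have "[:\<xi> i, -1:] ^ m i dvd R"
  proof (cases "P = 0")
    case True
    have "Q \<noteq> 0" using insert.hyps by (simp add: Q_def)
    then show ?thesis using True R by simp
  next
    case False
    have "poly Q (\<xi> i) \<noteq> 0"
      using insert by (auto simp: Q_def poly_prod inj_on_def)
    then have "Polynomial.order (\<xi> i) Q = 0" by (rule order_0I)
    then have "Polynomial.order (\<xi> i) P = Polynomial.order (\<xi> i) R"
      using False unfolding R by (simp add: order_mult)
    moreover have "[:- \<xi> i, 1:] ^ m i dvd P"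
      using insert.prems by (simp add: neg_linear_power_dvd_iff)
    ultimately show ?thesis
      using False R by (simp add: neg_linear_power_dvd_iff order_divides)
  qed
  then show ?case
    using insert.hyps R by (simp add: mult_dvd_mono mult.commute flip: Q_def)
qed simp

lemma degree_prod_linear_powers:
  "degree (\<Prod>i\<in>I. [:\<xi> i, -1 :: real:] ^ m i) = (\<Sum>i\<in>I. m i)"
proof (cases "finite I")
  case True
  then show ?thesis by (subst degree_prod_eq_sum_degree) (auto simp: degree_power_eq)
qed simp

section \<open>Combinations of rows that vanish at a node\<close>

context hermite_rows
begin

definition combination :: "(nat \<times> nat \<Rightarrow> real) \<Rightarrow> real poly" where
  "combination b = (\<Sum>x\<in>index_set (r + 1) lam. Polynomial.smult (b x) (row_poly (fst x) (snd x)))"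

lemma combination_eq_0: "combination b = 0 \<Longrightarrow> x \<in> index_set (r + 1) lam \<Longrightarrow> b x = 0"
  using row_poly_independent[of b] unfolding combination_def case_prod_unfold prod.collapse by blast

lemma combination_scaled_diff: "combination (\<lambda>x. b x - c * b' x) = combination b - Polynomial.smult c (combination b')"
proof (rule poly_eqI)
  fix n
  show "coeff (combination (\<lambda>x. b x - c * b' x)) n = coeff (combination b - Polynomial.smult c (combination b')) n"
    unfolding combination_def coeff_diff coeff_smult coeff_sum sum_distrib_left sum_subtractf[symmetric]
    by (intro sum.cong refl) (simp only: left_diff_distrib mult.assoc)
qed

lemma degree_combination: "combination b \<noteq> 0 \<Longrightarrow> degree (combination b) < total"
proof -
  assume nz: "combination b \<noteq> 0"
  then obtain j k where "(j, k) \<in> index_set (r + 1) lam"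
    unfolding combination_def by (metis ex_in_conv sum.empty surj_pair)
  then have "degree (row_poly j k) < total" by (intro degree_row_poly) (auto simp: index_set_def)
  then have "total > 0" by linarith
  moreover have "degree (combination b) \<le> total - 1"
    unfolding combination_def
  proof (rule degree_sum_le)
    fix x assume "x \<in> index_set (r + 1) lam"
    then have "degree (row_poly (fst x) (snd x)) < total"
      by (intro degree_row_poly) (auto simp: index_set_def)
    then show "degree (Polynomial.smult (b x) (row_poly (fst x) (snd x))) \<le> total - 1"
      using degree_smult_le[of "b x" "row_poly (fst x) (snd x)"] by linarith
  qed simp
  ultimately show ?thesis by linarith
qed

text \<open>The sums in the hypothesis are the derivatives of order l at \<xi> of the combination of
  the \<open>\<partial>^k \<Lambda>_j\<close>, since differentiating k times raises the order of the
  moment by k. This function is L_F / \<open>full_den\<close> times the polynomial, and the first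
  factor is analytic and nonzero at \<xi>, so the vanishing order carries over.\<close>

lemma combination_vanishing:
  assumes \<xi>: "\<xi> \<in> laplace_domain r \<rho>"
    and 0: "\<forall>l<n. (\<Sum>x\<in>index_set (r + 1) lam. b x * moment (hermite_row r \<rho> d a (fst x)) \<xi> (snd x + l)) = 0"
  shows "[:\<xi>, -1:] ^ n dvd combination b"
proof (rule linear_power_dvd)
  let ?J = "index_set (r + 1) lam"
  define F where "F j = Abs_fps (\<lambda>k. moment (hermite_row r \<rho> d a j) \<xi> k / fact k)" for j
  have F: "(\<lambda>w. Lam r \<rho> d a j (\<xi> + w)) has_fps_expansion F j" if "j \<in> {1..r+1}" for j
    unfolding F_def moment_def by (rule hermite_row_moment[OF pos that \<xi>])
  define G where "G x = (fps_deriv ^^ snd x) (F (fst x))" for x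
  have G: "(\<lambda>w. (deriv ^^ snd x) (Lam r \<rho> d a (fst x)) (\<xi> + w)) has_fps_expansion G x" if "x \<in> ?J" for x
  proof -
    have "(deriv ^^ k) (\<lambda>w. Lam r \<rho> d a (fst x) (\<xi> + w)) has_fps_expansion (fps_deriv ^^ k) (F (fst x))" for k
      using that by (induction k) (auto intro!: has_fps_expansion_deriv F simp: index_set_def)
    then show ?thesis by (simp add: G_def higher_deriv_shift)
  qed
  have Gnth: "fact l * fps_nth (G x) l = moment (hermite_row r \<rho> d a (fst x)) \<xi> (snd x + l)" if "x \<in> ?J" for x l
  proof -
    have "fact l * fps_nth (G x) l = (deriv ^^ l) (\<lambda>w. (deriv ^^ snd x) (Lam r \<rho> d a (fst x)) (\<xi> + w)) 0"
      by (rule has_fps_expansion_nth_deriv[OF G[OF that], symmetric])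
    also have "\<dots> = (deriv ^^ (l + snd x)) (\<lambda>w. Lam r \<rho> d a (fst x) (\<xi> + w)) 0"
      by (simp only: funpow_add o_apply higher_deriv_shift)
    also have "\<dots> = fact (l + snd x) * fps_nth (F (fst x)) (l + snd x)"
      by (rule has_fps_expansion_nth_deriv[OF F]) (use that in \<open>auto simp: index_set_def\<close>)
    finally show ?thesis by (simp add: F_def add.commute)
  qed
  define \<Psi> where "\<Psi> = (\<Sum>x\<in>?J. fps_const (b x) * G x)"
  have \<Psi>: "(\<lambda>w. \<Sum>x\<in>?J. b x * (deriv ^^ snd x) (Lam r \<rho> d a (fst x)) (\<xi> + w)) has_fps_expansion \<Psi>"
    unfolding \<Psi>_def by (intro has_fps_expansion_sum has_fps_expansion_cmult_left G)
  have \<Psi>0: "fps_nth \<Psi> l = 0" if "l < n" for l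
  proof -
    have "fact l * fps_nth \<Psi> l = (\<Sum>x\<in>?J. b x * (fact l * fps_nth (G x) l))"
      by (simp add: \<Psi>_def fps_sum_nth sum_distrib_left mult_ac)
    also have "\<dots> = 0" using 0 that by (simp add: Gnth)
    finally show ?thesis by simp
  qed
  define D where "D = fps_of_poly (pcompose full_den [:\<xi>, 1:])"
  define P where "P = fps_of_poly (pcompose (combination b) [:\<xi>, 1:])"
  have shiftp: "(\<lambda>w. poly p (\<xi> + w)) has_fps_expansion fps_of_poly (pcompose p [:\<xi>, 1:])" for p :: "real poly"
    using poly_has_fps_expansion[of "pcompose p [:\<xi>, 1:]"] by (simp add: poly_pcompose)
  define L where "L = F (r + 1)"
  have L: "(\<lambda>w. L_F r \<rho> d a (\<xi> + w)) has_fps_expansion L"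
    using F[of "r + 1"] by (simp add: L_def Lam_def)
  have L0: "fps_nth L 0 \<noteq> 0"
    using has_fps_expansion_nth_deriv[OF L, of 0] L_F_pos[OF \<xi>] by simp
  have "(\<lambda>w. poly full_den (\<xi> + w) * (\<Sum>x\<in>?J. b x * (deriv ^^ snd x) (Lam r \<rho> d a (fst x)) (\<xi> + w)) /
      L_F r \<rho> d a (\<xi> + w)) has_fps_expansion (D * \<Psi>) / L"
    unfolding D_def by (intro has_fps_expansion_divide' has_fps_expansion_mult shiftp \<Psi> L L0)
  moreover have "\<forall>\<^sub>F w in nhds 0. poly full_den (\<xi> + w) * (\<Sum>x\<in>?J. b x * (deriv ^^ snd x) (Lam r \<rho> d a (fst x)) (\<xi> + w)) /
      L_F r \<rho> d a (\<xi> + w) = poly (combination b) (\<xi> + w)"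
  proof -
    have "open ((\<lambda>w. \<xi> + w) -` laplace_domain r \<rho>)"
      by (intro open_vimage open_laplace_domain continuous_intros)
    then have "\<forall>\<^sub>F w in nhds 0. w \<in> (\<lambda>w. \<xi> + w) -` laplace_domain r \<rho>"
      by (rule eventually_nhds_in_open) (use \<xi> in simp)
    then show ?thesis
    proof eventually_elim
      case (elim w)
      then have z: "\<xi> + w \<in> laplace_domain r \<rho>" by simp
      have "poly full_den (\<xi> + w) * (\<Sum>x\<in>?J. b x * (deriv ^^ snd x) (Lam r \<rho> d a (fst x)) (\<xi> + w)) =
          (\<Sum>x\<in>?J. b x * (poly full_den (\<xi> + w) * (deriv ^^ snd x) (Lam r \<rho> d a (fst x)) (\<xi> + w)))"
        by (simp add: sum_distrib_left mult_ac)
      also have "\<dots> = (\<Sum>x\<in>?J. b x * (L_F r \<rho> d a (\<xi> + w) * poly (row_poly (fst x) (snd x)) (\<xi> + w)))"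
        by (intro sum.cong refl arg_cong2[where f = "(*)"] higher_deriv_Lam_row_poly z) (auto simp: index_set_def)
      also have "\<dots> = L_F r \<rho> d a (\<xi> + w) * poly (combination b) (\<xi> + w)"
        by (simp add: combination_def poly_sum sum_distrib_left mult_ac)
      finally show ?case using L_F_pos[OF z] by simp
    qed
  qed
  ultimately have "(\<lambda>w. poly (combination b) (\<xi> + w)) has_fps_expansion (D * \<Psi>) / L"
    unfolding has_fps_expansion_def by (auto elim: eventually_elim2)
  from has_fps_expansion_unique_real[OF this shiftp]
  \<comment> \<open>A power series times \<Psi> has vanishing coefficients wherever all coefficients
    of \<Psi> up to that order vanish.\<close>
  have P: "P = D * inverse L * \<Psi>" using L0 by (simp add: P_def fps_divide_unit mult_ac)
  show "\<forall>l<n. coeff (pcompose (combination b) [:\<xi>, 1:]) l = 0"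
  proof (intro allI impI)
    fix l assume l: "l < n"
    have "coeff (pcompose (combination b) [:\<xi>, 1:]) l = fps_nth P l" by (simp add: P_def)
    also have "\<dots> = (\<Sum>i=0..l. fps_nth (D * inverse L) i * fps_nth \<Psi> (l - i))"
      unfolding P by (rule fps_mult_nth)
    also have "\<dots> = 0" using \<Psi>0 l by (intro sum.neutral) auto
    finally show "coeff (pcompose (combination b) [:\<xi>, 1:]) l = 0" .
  qed
qed

end

section \<open>Kernels of the two limiting systems\<close>

lemma index_set_update:
  assumes "(i, m i - 1) \<in> index_set s m"
  shows "index_set s m - {(i, m i - 1)} = index_set s (m(i := m i - 1))"
  using assms by (auto simp: index_set_def split: if_splits)

context hermite_rows
begin

abbreviation rows :: "(nat \<times> nat) set" where "rows \<equiv> index_set (r + 1) lam"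

abbreviation row_moment :: "(nat \<Rightarrow> real) \<Rightarrow> nat \<Rightarrow> nat \<Rightarrow> nat \<Rightarrow> real" where
  "row_moment \<xi> j i n \<equiv> moment (hermite_row r \<rho> d a j) (\<xi> i) n"

lemma combination_dvd:
  assumes inj: "inj_on \<xi> {1..p}" and \<xi>: "\<forall>i\<in>{1..p}. \<xi> i \<in> laplace_domain r \<rho>"
    and 0: "\<forall>y\<in>index_set p m. (\<Sum>x\<in>rows. b x * row_moment \<xi> (fst x) (fst y) (snd x + snd y)) = 0"
  shows "(\<Prod>i=1..p. [:\<xi> i, -1:] ^ m i) dvd combination b"
proof (rule prod_linear_powers_dvd)
  show "\<forall>i\<in>{1..p}. [:\<xi> i, -1:] ^ m i dvd combination b"
  proof
    fix i assume i: "i \<in> {1..p}"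
    show "[:\<xi> i, -1:] ^ m i dvd combination b"
    proof (rule combination_vanishing)
      show "\<xi> i \<in> laplace_domain r \<rho>" using \<xi> i by blast
      show "\<forall>l<m i. (\<Sum>x\<in>rows. b x * row_moment \<xi> (fst x) i (snd x + l)) = 0"
      proof (intro allI impI)
        fix l assume "l < m i"
        then have "(i, l) \<in> index_set p m" using i by (simp add: index_set_def)
        from bspec[OF 0 this] show "(\<Sum>x\<in>rows. b x * row_moment \<xi> (fst x) i (snd x + l)) = 0" by simp
      qed
    qed
  qed
qed (use inj in auto)

lemma card_rows: "card rows = total"
  by (rule card_index_set)

text \<open>Degree count: a nonzero combination has degree below N, but would be divisible by a
  polynomial of degree N.\<close>

lemma left_kernel_trivial:
  assumes inj: "inj_on \<xi> {1..p}" and \<xi>: "\<forall>i\<in>{1..p}. \<xi> i \<in> laplace_domain r \<rho>"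
    and m: "(\<Sum>i=1..p. m i) = total"
    and 0: "\<forall>y\<in>index_set p m. (\<Sum>x\<in>rows. b x * row_moment \<xi> (fst x) (fst y) (snd x + snd y)) = 0"
  shows "\<forall>x\<in>rows. b x = 0"
proof -
  have dvd: "(\<Prod>i=1..p. [:\<xi> i, -1:] ^ m i) dvd combination b"
    by (rule combination_dvd[OF inj \<xi> 0])
  have "combination b = 0"
  proof (rule ccontr)
    assume nz: "combination b \<noteq> 0"
    have "total \<le> degree (combination b)"
      using dvd_imp_degree_le[OF dvd nz] by (simp only: degree_prod_linear_powers m)
    then show False using degree_combination[OF nz] by linarith
  qed
  then show ?thesis using combination_eq_0 by blast
qed

lemma A_detected:
  assumes inj: "inj_on \<xi> {1..p}" and \<xi>: "\<forall>i\<in>{1..p}. \<xi> i \<in> laplace_domain r \<rho>"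
    and m: "(\<Sum>i=1..p. m i) = total + 1" and i: "i \<in> {1..p}" "m i > 0"
  shows "detected_by (system_kernel p m rows (\<lambda>e x. row_moment \<xi> (fst e) (fst x) (snd e + snd x))) (i, m i - 1)"
  unfolding detected_by_def
proof (intro ballI impI)
  let ?x = "(i, m i - 1)"
  fix A assume A: "A \<in> system_kernel p m rows (\<lambda>e x. row_moment \<xi> (fst e) (fst x) (snd e + snd x))"
    and c: "coeff (A (fst ?x)) (snd ?x) = 0"
  \<comment> \<open>Setting the top coefficient of component i to zero amounts to lowering
    \<open>m i\<close> by one; the total becomes N and the system square.\<close>
  define m' where "m' = m(i := m i - 1)"
  have x: "?x \<in> index_set p m" using i by (simp add: index_set_def)
  have I: "index_set p m - {?x} = index_set p m'"
    unfolding m'_def by (rule index_set_update[OF x])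
  have "card (index_set p m') = card (index_set p m) - 1"
    unfolding I[symmetric] by (rule card_Diff_singleton[OF x])
  also have "card (index_set p m) = total + 1" by (simp only: card_index_set m)
  finally have card: "card (index_set p m') = total" by (simp only: diff_add_inverse2)
  then have m': "(\<Sum>i=1..p. m' i) = total" by (simp only: card_index_set)
  have "\<forall>y\<in>index_set p m'. coeff (A (fst y)) (snd y) = 0"
  \<comment> \<open>The square system is injective because its transpose is, and a kernel vector of
    the transpose is a combination of rows with prescribed zeros at the nodes.\<close>
  proof (rule square_system_right_injective)
    show "finite rows" "finite (index_set p m')" by simp_all
    show "card (index_set p m') = card rows" using card card_rows by simp
    show "\<forall>e\<in>rows. b e = 0"
      if "\<forall>y\<in>index_set p m'. (\<Sum>e\<in>rows. b e * row_moment \<xi> (fst e) (fst y) (snd e + snd y)) = 0" for b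
      by (rule left_kernel_trivial[OF inj \<xi> m' that])
    show "\<forall>e\<in>rows. (\<Sum>y\<in>index_set p m'. row_moment \<xi> (fst e) (fst y) (snd e + snd y) * coeff (A (fst y)) (snd y)) = 0"
    proof
      fix e assume e: "e \<in> rows"
      have "(\<Sum>y\<in>index_set p m'. row_moment \<xi> (fst e) (fst y) (snd e + snd y) * coeff (A (fst y)) (snd y)) =
          (\<Sum>y\<in>index_set p m. row_moment \<xi> (fst e) (fst y) (snd e + snd y) * coeff (A (fst y)) (snd y))"
        unfolding I[symmetric] by (rule sum.mono_neutral_left) (use c in auto)
      also have "\<dots> = 0" using A e unfolding system_kernel_def by blast
      finally show "(\<Sum>y\<in>index_set p m'. row_moment \<xi> (fst e) (fst y) (snd e + snd y) * coeff (A (fst y)) (snd y)) = 0" .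
    qed
  qed
  then have "\<forall>(i, l)\<in>index_set p m. coeff (A i) l = 0"
    using c unfolding I[symmetric] by force
  then show "A = 0"
    using A by (intro poly_vectors_eq_0[of A p m]) (auto simp: system_kernel_def)
qed

definition column_poly :: "nat \<Rightarrow> (nat \<Rightarrow> real) \<Rightarrow> (nat \<Rightarrow> nat) \<Rightarrow> real poly" where
  "column_poly p \<xi> m = (\<Prod>i=1..p. [:\<xi> i, -1:] ^ m i)"

abbreviation vector_combination :: "(nat \<Rightarrow> real poly) \<Rightarrow> real poly" where
  "vector_combination B \<equiv> combination (\<lambda>x. coeff (B (fst x)) (snd x))"

lemma vector_combination_eq_0:
  assumes "B \<in> poly_vectors (r + 1) lam" "vector_combination B = 0"
  shows "B = 0"
  using assms combination_eq_0 by (intro poly_vectors_eq_0[of B "r + 1" lam]) fastforce+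

text \<open>A nonzero combination has degree at most N - 1, which is exactly the degree of its
  divisor \<open>column_poly\<close>, so the quotient is constant.\<close>

lemma B_combination:
  assumes inj: "inj_on \<xi> {1..p}" and \<xi>: "\<forall>i\<in>{1..p}. \<xi> i \<in> laplace_domain r \<rho>"
    and m: "total = (\<Sum>i=1..p. m i) + 1"
    and B: "B \<in> system_kernel (r + 1) lam (index_set p m) (\<lambda>e x. row_moment \<xi> (fst x) (fst e) (snd e + snd x))"
  obtains c where "vector_combination B = Polynomial.smult c (column_poly p \<xi> m)"
proof -
  have "\<forall>y\<in>index_set p m. (\<Sum>x\<in>rows. coeff (B (fst x)) (snd x) * row_moment \<xi> (fst x) (fst y) (snd x + snd y)) = 0"
    using B by (simp add: system_kernel_def mult.commute add.commute)
  from combination_dvd[OF inj \<xi> this] obtain Q where Q: "vector_combination B = column_poly p \<xi> m * Q"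
    unfolding column_poly_def by (elim dvdE)
  show ?thesis
  proof (cases "vector_combination B = 0")
    case True
    then show ?thesis by (intro that[of 0]) simp
  next
    case False
    then have nz: "column_poly p \<xi> m \<noteq> 0" "Q \<noteq> 0" using Q by auto
    have "degree (vector_combination B) = (\<Sum>i=1..p. m i) + degree Q"
      unfolding Q degree_mult_eq[OF nz] by (simp only: column_poly_def degree_prod_linear_powers)
    then have "degree Q = 0" using degree_combination[OF False] m by linarith
    then obtain c where "Q = [:c:]" by (rule degree_eq_zeroE)
    then show ?thesis using Q by (intro that[of c]) simp
  qed
qed

text \<open>\<open>vector_combination\<close> maps the kernel injectively into the line spanned by
  \<open>column_poly\<close>. So one nonzero solution spans the kernel, and each of its nonzero
  coefficients detects; which positions these are stays open here, in contrast to the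
  A-problem.\<close>

lemma B_detected:
  assumes inj: "inj_on \<xi> {1..p}" and \<xi>: "\<forall>i\<in>{1..p}. \<xi> i \<in> laplace_domain r \<rho>"
    and m: "total = (\<Sum>i=1..p. m i) + 1"
  shows "\<exists>x\<in>rows. detected_by (system_kernel (r + 1) lam (index_set p m)
    (\<lambda>e x. row_moment \<xi> (fst x) (fst e) (snd e + snd x))) x"
proof -
  let ?K = "system_kernel (r + 1) lam (index_set p m) (\<lambda>e x. row_moment \<xi> (fst x) (fst e) (snd e + snd x))"
  have "card (index_set p m) < card rows" unfolding card_rows by (simp only: card_index_set m)
  then obtain A where A: "A \<in> ?K" "A \<noteq> 0"
    by (rule system_kernel_nonzero[OF finite_index_set])
  then have Av: "A \<in> poly_vectors (r + 1) lam" by (simp add: system_kernel_def)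
  then obtain x where x: "x \<in> rows" "coeff (A (fst x)) (snd x) \<noteq> 0"
    using A(2) poly_vectors_eq_0[of A "r + 1" lam] by fastforce
  obtain c where c: "vector_combination A = Polynomial.smult c (column_poly p \<xi> m)"
    by (rule B_combination[OF inj \<xi> m A(1)])
  have c0: "c \<noteq> 0" using c vector_combination_eq_0[OF Av] A(2) by auto
  have "detected_by ?K x"
    unfolding detected_by_def
  proof (intro ballI impI)
    fix B assume B: "B \<in> ?K" and B0: "coeff (B (fst x)) (snd x) = 0"
    obtain e where e: "vector_combination B = Polynomial.smult e (column_poly p \<xi> m)"
      by (rule B_combination[OF inj \<xi> m B])
    let ?D = "\<lambda>i. B i - Polynomial.smult (e / c) (A i)"
    have D: "?D \<in> ?K" by (rule system_kernel_combination[OF B A(1)])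
    have "vector_combination ?D = 0"
      unfolding coeff_diff coeff_smult combination_scaled_diff c e using c0 by simp
    then have "?D = 0" using D by (intro vector_combination_eq_0) (simp_all add: system_kernel_def)
    then have Bi: "B i = Polynomial.smult (e / c) (A i)" for i by (simp add: fun_eq_iff)
    then have "e = 0" using B0 x c0 by simp
    then show "B = 0" using Bi by (simp add: fun_eq_iff)
  qed
  with x show ?thesis by blast
qed

subsection \<open>The determinant criterion\<close>

lemma coeff_hermite: "coeff (hermite k) k = 1" "n > k \<Longrightarrow> coeff (hermite k) n = 0"
proof -
  have "coeff (hermite k) k = (\<Sum>i\<le>k div 2. if i = 0 then 1 else 0)"
    unfolding hermite_def coeff_sum by (rule sum.cong) (auto simp: coeff_monom)
  then show "coeff (hermite k) k = 1" by (simp add: sum.delta)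
  show "coeff (hermite k) n = 0" if "n > k"
    unfolding hermite_def coeff_sum using that by (intro sum.neutral) (auto simp: coeff_monom)
qed

lemma degree_hermite: "degree (hermite k) = k"
  by (intro antisym degree_le le_degree) (auto simp: coeff_hermite)

text \<open>Since \<open>hermite k\<close> is monic, the change of basis is unitriangular and keeps
  the top coefficient; maximal degree can therefore be read off in the Hermite basis, to which the
  columns of C belong.\<close>

lemma hermite_expansion:
  assumes "\<forall>l\<ge>n. coeff B l = 0"
  shows "\<exists>\<beta>. (n > 0 \<longrightarrow> \<beta> (n - 1) = coeff B (n - 1)) \<and> B = (\<Sum>k<n. Polynomial.smult (\<beta> k) (hermite k))"
  using assms
proof (induction n arbitrary: B)
  case 0
  then show ?case by (auto simp: poly_eq_iff)
next
  case (Suc n)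
  define B' where "B' = B - Polynomial.smult (coeff B n) (hermite n)"
  have "\<forall>l\<ge>n. coeff B' l = 0"
  proof (intro allI impI)
    fix l assume "n \<le> l"
    then show "coeff B' l = 0"
      using Suc.prems by (cases "l = n") (auto simp: B'_def coeff_hermite)
  qed
  from Suc.IH[OF this] obtain \<beta> where \<beta>: "B' = (\<Sum>k<n. Polynomial.smult (\<beta> k) (hermite k))" by auto
  have "B = B' + Polynomial.smult (coeff B n) (hermite n)" by (simp add: B'_def)
  also have "B' = (\<Sum>k<n. Polynomial.smult ((\<beta>(n := coeff B n)) k) (hermite k))"
    unfolding \<beta> by (rule sum.cong) auto
  finally show ?case by (intro exI[of _ "\<beta>(n := coeff B n)"]) simp
qed

text \<open>The polynomial \<open>\<Phi>_{j,k}\<close>. Summing over i < lambda_j instead of i \<le>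
  k adds only zero coefficients when k < lambda_j and gives one range for all k.\<close>

definition phi_poly :: "nat \<Rightarrow> nat \<Rightarrow> real poly" where
  "phi_poly j k = (\<Sum>i<lam j. Polynomial.smult (coeff (hermite k) i) (row_poly j i))"

lemma vector_combination_hermite:
  assumes "\<And>j. j \<in> {1..r+1} \<Longrightarrow> B j = (\<Sum>k<lam j. Polynomial.smult (\<beta> (j, k)) (hermite k))"
  shows "vector_combination B = (\<Sum>x\<in>rows. Polynomial.smult (\<beta> x) (phi_poly (fst x) (snd x)))"
proof -
  have eq: "(\<Sum>k<lam j. Polynomial.smult (coeff (B j) k) (row_poly j k)) = (\<Sum>k<lam j. Polynomial.smult (\<beta> (j, k)) (phi_poly j k))"
    if j: "j \<in> {1..r+1}" for j
  proof (rule poly_eqI)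
    fix n
    have "(\<Sum>i<lam j. coeff (B j) i * coeff (row_poly j i) n) =
        (\<Sum>i<lam j. \<Sum>k<lam j. \<beta> (j, k) * (coeff (hermite k) i * coeff (row_poly j i) n))"
      unfolding assms[OF j] by (simp add: coeff_sum sum_distrib_right mult.assoc)
    also have "\<dots> = (\<Sum>k<lam j. \<beta> (j, k) * (\<Sum>i<lam j. coeff (hermite k) i * coeff (row_poly j i) n))"
      by (subst sum.swap) (simp add: sum_distrib_left)
    finally show "coeff (\<Sum>k<lam j. Polynomial.smult (coeff (B j) k) (row_poly j k)) n =
        coeff (\<Sum>k<lam j. Polynomial.smult (\<beta> (j, k)) (phi_poly j k)) n"
      by (simp add: coeff_sum phi_poly_def)
  qed
  show ?thesis
    unfolding combination_def sum_index_set fst_conv snd_conv by (rule sum.cong[OF refl]) (rule eq)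
qed

lemma Phi_eq_phi_poly:
  assumes j: "j \<in> {1..r+1}" and k: "k < lam j" and z: "z \<in> laplace_domain r \<rho>"
  shows "Phi r \<rho> d a lam (j, k) z = poly (phi_poly j k) z"
proof -
  have "poly_deriv_op (hermite k) (Lam r \<rho> d a j) z = (\<Sum>i<lam j. coeff (hermite k) i * (deriv ^^ i) (Lam r \<rho> d a j) z)"
    unfolding poly_deriv_op_def degree_hermite
    by (rule sum.mono_neutral_left) (use k in \<open>auto simp: coeff_hermite\<close>)
  moreover have "L_F r \<rho> d a z * Phi r \<rho> d a lam (j, k) z =
      poly full_den z * poly_deriv_op (hermite k) (Lam r \<rho> d a j) z"
    using L_F_pos[OF z] unfolding Phi_def prod.case poly_full_den by simp
  ultimately have "L_F r \<rho> d a z * Phi r \<rho> d a lam (j, k) z =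
      (\<Sum>i<lam j. coeff (hermite k) i * (poly full_den z * (deriv ^^ i) (Lam r \<rho> d a j) z))"
    by (simp add: sum_distrib_left mult.left_commute)
  also have "\<dots> = (\<Sum>i<lam j. coeff (hermite k) i * (L_F r \<rho> d a z * poly (row_poly j i) z))"
    by (intro sum.cong refl arg_cong2[where f = "(*)"] higher_deriv_Lam_row_poly j z) auto
  also have "\<dots> = L_F r \<rho> d a z * poly (phi_poly j k) z"
    by (simp add: phi_poly_def poly_sum sum_distrib_left mult_ac)
  finally show ?thesis using L_F_pos[OF z] by simp
qed

lemma taylor_coeff_Phi:
  assumes j: "j \<in> {1..r+1}" and k: "k < lam j"
  shows "taylor_coeff (Phi r \<rho> d a lam (j, k)) \<nu> = coeff (phi_poly j k) \<nu>"
proof -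
  have "0 \<in> laplace_domain r \<rho>" using pos by (auto simp: laplace_domain_def)
  then have "\<forall>\<^sub>F z in nhds 0. z \<in> laplace_domain r \<rho>"
    by (rule eventually_nhds_in_open[OF open_laplace_domain])
  then have "\<forall>\<^sub>F z in nhds 0. poly (phi_poly j k) z = Phi r \<rho> d a lam (j, k) z"
    by eventually_elim (simp add: Phi_eq_phi_poly[OF j k])
  then have "Phi r \<rho> d a lam (j, k) has_fps_expansion fps_of_poly (phi_poly j k)"
    by (simp add: has_fps_expansion_def)
  from has_fps_expansion_nth_deriv[OF this] show ?thesis by (simp add: taylor_coeff_def)
qed

lemma set_col_indices: "set (col_indices (r + 1) lam) = rows"
  unfolding col_indices_def index_set_def set_concat set_map set_upt by fastforce

lemma distinct_col_indices: "distinct (col_indices q l)"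
proof -
  have "distinct (concat (map (\<lambda>j. map (\<lambda>k. (j, k)) [0..<l j]) js))" if "distinct js" for js :: "nat list"
    using that by (induction js) (auto simp: distinct_map inj_on_def)
  then show ?thesis by (simp add: col_indices_def)
qed

lemma length_col_indices: "length (col_indices (r + 1) lam) = total"
  using distinct_card[OF distinct_col_indices[of "r + 1" lam]] by (simp only: set_col_indices card_rows)

text \<open>A linear relation between the column polynomials gives a kernel vector of the matrix of
  their first N coefficients.\<close>

lemma C_replaced_kernel:
  assumes det: "Determinant.det (C_replaced r p \<rho> d a \<xi> lam m x0) \<noteq> 0" and x0: "x0 \<in> rows"
    and 0: "(\<Sum>x\<in>rows. Polynomial.smult (v x) (if x = x0 then column_poly p \<xi> m else phi_poly (fst x) (snd x))) = 0"
  shows "\<forall>x\<in>rows. v x = 0"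
proof -
  let ?cols = "col_indices (r + 1) lam"
  let ?f = "\<lambda>x. if x = x0 then p_col p \<xi> m total else C_col r \<rho> d a lam total x"
  define C where "C = C_replaced r p \<rho> d a \<xi> lam m x0"
  have C: "C = mat_of_cols total (map ?f ?cols)" by (simp only: C_def C_replaced_def Let_def)
  have Cc: "C \<in> carrier_mat total total" unfolding C using length_col_indices by (simp add: mat_of_cols_def)
  define w where "w = Matrix.vec total (\<lambda>l. v (?cols ! l))"
  have f: "vec_index (?f x) \<nu> = coeff (if x = x0 then column_poly p \<xi> m else phi_poly (fst x) (snd x)) \<nu>"
    if "x \<in> rows" "\<nu> < total" for x \<nu>
    using that taylor_coeff_Phi[of "fst x" "snd x" \<nu>]
    by (auto simp: p_col_def C_col_def column_poly_def index_set_def)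
  have "C *\<^sub>v w = 0\<^sub>v total"
  proof (rule eq_vecI)
    fix \<nu> assume "\<nu> < dim_vec (0\<^sub>v total :: real vec)"
    then have \<nu>: "\<nu> < total" by simp
    have "vec_index (C *\<^sub>v w) \<nu> = (\<Sum>l<total. C $$ (\<nu>, l) * vec_index w l)"
      using \<nu> Cc by (auto simp only: index_mult_mat_vec scalar_prod_def carrier_matD w_def dim_vec
          atLeast0LessThan row_def index_vec lessThan_iff intro!: sum.cong)
    also have "\<dots> = (\<Sum>l<total. vec_index (?f (?cols ! l)) \<nu> * v (?cols ! l))"
    proof (intro sum.cong refl arg_cong2[where f = "(*)"])
      fix l assume "l \<in> {..<total}"
      then have l: "l < total" by (rule lessThan_iff[THEN iffD1])
      then have l': "l < length ?cols" by (simp only: length_col_indices)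
      show "vec_index w l = v (?cols ! l)" unfolding w_def by (rule index_vec[OF l])
      show "C $$ (\<nu>, l) = vec_index (?f (?cols ! l)) \<nu>"
        unfolding C using \<nu> l' by (simp only: mat_of_cols_index length_map nth_map)
    qed
    also have "\<dots> = (\<Sum>x\<in>rows. vec_index (?f x) \<nu> * v x)"
    proof (rule sum.reindex_bij_betw)
      show "bij_betw ((!) ?cols) {..<total} rows"
        using bij_betw_nth[OF distinct_col_indices] length_col_indices set_col_indices by metis
    qed
    also have "\<dots> = coeff (\<Sum>x\<in>rows. Polynomial.smult (v x) (if x = x0 then column_poly p \<xi> m else phi_poly (fst x) (snd x))) \<nu>"
      unfolding coeff_sum coeff_smult by (intro sum.cong refl) (simp only: f \<nu> mult.commute)
    finally show "vec_index (C *\<^sub>v w) \<nu> = vec_index (0\<^sub>v total) \<nu>" using 0 \<nu> by simp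
  qed (use Cc in auto)
  moreover have "w \<in> carrier_vec total" by (simp add: w_def)
  ultimately have "w = 0\<^sub>v total"
    using det det_0_iff_vec_prod_zero_field[OF Cc] by (auto simp: C_def)
  then have w0: "v (?cols ! l) = 0" if "l < total" for l
    using that by (metis w_def index_vec index_zero_vec(1))
  show ?thesis
  proof
    fix x assume "x \<in> rows"
    then obtain l where "l < total" "x = ?cols ! l"
      using set_col_indices length_col_indices by (metis in_set_conv_nth)
    then show "v x = 0" using w0 by simp
  qed
qed

text \<open>If the top coefficient of component j vanishes, the expansion of a multiple of
  \<open>column_poly\<close> in the \<open>phi_poly\<close> leaves out the column (j, lambda_j - 1).
  Moving \<open>column_poly\<close> into this vacant place gives a relation between the columns of
  the replaced matrix, so the nonzero determinant kills all coefficients.\<close>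

lemma B_detected_leading:
  assumes inj: "inj_on \<xi> {1..p}" and \<xi>: "\<forall>i\<in>{1..p}. \<xi> i \<in> laplace_domain r \<rho>"
    and m: "total = (\<Sum>i=1..p. m i) + 1" and j: "j \<in> {1..r+1}" "lam j > 0"
    and det: "Determinant.det (C_replaced r p \<rho> d a \<xi> lam m (j, lam j - 1)) \<noteq> 0"
  shows "detected_by (system_kernel (r + 1) lam (index_set p m)
    (\<lambda>e x. row_moment \<xi> (fst x) (fst e) (snd e + snd x))) (j, lam j - 1)"
  unfolding detected_by_def
proof (intro ballI impI)
  let ?K = "system_kernel (r + 1) lam (index_set p m) (\<lambda>e x. row_moment \<xi> (fst x) (fst e) (snd e + snd x))"
  let ?x = "(j, lam j - 1)"
  fix B assume B: "B \<in> ?K" and c: "coeff (B (fst ?x)) (snd ?x) = 0"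
  have x: "?x \<in> rows" using j by (simp add: index_set_def)
  have Bv: "B \<in> poly_vectors (r + 1) lam" using B by (simp add: system_kernel_def)
  have "\<forall>i\<in>{1..r+1}. \<exists>\<beta>. (lam i > 0 \<longrightarrow> \<beta> (lam i - 1) = coeff (B i) (lam i - 1)) \<and>
      B i = (\<Sum>k<lam i. Polynomial.smult (\<beta> k) (hermite k))"
  proof
    fix i
    have "\<forall>l\<ge>lam i. coeff (B i) l = 0" using Bv by (simp add: poly_vectors_iff index_set_def)
    then show "\<exists>\<beta>. (lam i > 0 \<longrightarrow> \<beta> (lam i - 1) = coeff (B i) (lam i - 1)) \<and>
        B i = (\<Sum>k<lam i. Polynomial.smult (\<beta> k) (hermite k))" by (rule hermite_expansion)
  qed
  from bchoice[OF this] obtain \<beta> where \<beta>: "\<And>i. i \<in> {1..r+1} \<Longrightarrow> lam i > 0 \<Longrightarrow> \<beta> i (lam i - 1) = coeff (B i) (lam i - 1)"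
      "\<And>i. i \<in> {1..r+1} \<Longrightarrow> B i = (\<Sum>k<lam i. Polynomial.smult (\<beta> i k) (hermite k))" by blast
  define \<gamma> where "\<gamma> x = \<beta> (fst x) (snd x)" for x
  have \<gamma>x: "\<gamma> ?x = 0" using \<beta>(1)[OF j] c by (simp add: \<gamma>_def)
  have comb: "vector_combination B = (\<Sum>x\<in>rows. Polynomial.smult (\<gamma> x) (phi_poly (fst x) (snd x)))"
    by (rule vector_combination_hermite) (simp add: \<gamma>_def \<beta>(2))
  obtain e where e: "vector_combination B = Polynomial.smult e (column_poly p \<xi> m)"
    by (rule B_combination[OF inj \<xi> m B])
  \<comment> \<open>The vacant column receives the coefficient -e, so that the relation encoded by
    \<open>v\<close> is \<open>vector_combination B\<close> minus e times
    \<open>column_poly\<close>.\<close>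
  define v where "v = \<gamma>(?x := - e)"
  have "(\<Sum>x\<in>rows. Polynomial.smult (v x) (if x = ?x then column_poly p \<xi> m else phi_poly (fst x) (snd x))) =
      Polynomial.smult (- e) (column_poly p \<xi> m) +
      (\<Sum>x\<in>rows - {?x}. Polynomial.smult (\<gamma> x) (phi_poly (fst x) (snd x)))"
    by (subst sum.remove[OF _ x]) (auto simp: v_def intro!: sum.cong)
  also have "(\<Sum>x\<in>rows - {?x}. Polynomial.smult (\<gamma> x) (phi_poly (fst x) (snd x))) = vector_combination B"
    unfolding comb by (rule sum.mono_neutral_left) (use \<gamma>x in auto)
  finally have "(\<Sum>x\<in>rows. Polynomial.smult (v x) (if x = ?x then column_poly p \<xi> m else phi_poly (fst x) (snd x))) = 0"
    by (simp add: e)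
  from C_replaced_kernel[OF det x this] have v0: "\<forall>x\<in>rows. v x = 0" .
  have "\<gamma> y = 0" if "y \<in> rows" for y
    using v0 that \<gamma>x by (cases "y = ?x") (auto simp: v_def)
  then have "vector_combination B = 0" unfolding comb by simp
  then show "B = 0" by (rule vector_combination_eq_0[OF Bv])
qed

end

section \<open>Convergence and normality of the transformed problems\<close>

theorem corollary5p21:
  fixes r p :: nat and d \<rho> \<xi> :: "nat \<Rightarrow> real" and a :: real and lam :: "nat \<Rightarrow> nat"
  assumes "p \<ge> 1"
    and "\<forall>h\<in>{1..r}. d h > 0 \<and> \<rho> h > 0"
    and "inj_on \<xi> {1..p}"
    and "\<forall>i\<in>{1..p}. \<forall>h\<in>{1..r}. \<xi> i + \<rho> h > 0"
    and "\<forall>i\<in>{1..r+1}. \<forall>j\<in>{1..r+1}. lam i \<le> lam j + 1"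
    and "inj_on \<rho> {h \<in> {1..r}. lam h > 0}"
  shows
    "(\<forall>m :: nat \<Rightarrow> nat. (\<Sum>i=1..p. m i) = (\<Sum>j=1..r+1. lam j) + 1 \<longrightarrow>
        (let SH = A_solutions (r+1) p lam m (hermite_row r \<rho> d a) (exp_col \<xi>);
             S = (\<lambda>\<tau>. A_solutions (r+1) p lam m (transformed_row r \<rho> d a \<tau>) (exp_col \<xi>))
         in weakly_normal SH \<and>
            (\<forall>\<^sub>F \<tau> in at_top. weakly_normal (S \<tau>)) \<and>
            normalized_convergence p S SH \<and>
            (\<forall>\<^sub>F \<tau> in at_top. strongly_normal p m (S \<tau>)))) \<and>
     (\<forall>m :: nat \<Rightarrow> nat. (\<Sum>j=1..r+1. lam j) = (\<Sum>i=1..p. m i) + 1 \<longrightarrow>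
        (let SH = B_solutions (r+1) p lam m (hermite_row r \<rho> d a) (exp_col \<xi>);
             S = (\<lambda>\<tau>. B_solutions (r+1) p lam m (transformed_row r \<rho> d a \<tau>) (exp_col \<xi>))
         in weakly_normal SH \<and>
            (\<forall>\<^sub>F \<tau> in at_top. weakly_normal (S \<tau>)) \<and>
            normalized_convergence (r+1) S SH \<and>
            ((\<forall>j\<in>{1..r+1}. lam j > 0 \<longrightarrow>
                Determinant.det (C_replaced r p \<rho> d a \<xi> lam m (j, lam j - 1)) \<noteq> 0) \<longrightarrow>
             (\<forall>\<^sub>F \<tau> in at_top. strongly_normal (r+1) lam (S \<tau>)))))"
proof -
  interpret hermite_rows r d \<rho> a lam
    by (rule hermite_rows.intro[OF assms(2,5,6)])
  let ?U = "hermite_row r \<rho> d a" and ?V = "transformed_row r \<rho> d a"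
  have \<xi>: "\<forall>i\<in>{1..p}. \<xi> i \<in> laplace_domain r \<rho>"
    using assms(4) by (auto simp: laplace_domain_def add.commute)
  have intU: "integrable lborel (\<lambda>t. t ^ n * (exp (\<xi> i * t) * ?U j t))" if "i \<in> {1..p}" "j \<in> {1..r+1}" for i j n
    using hermite_row_integrable[OF assms(2) that(2)] \<xi> that(1) by blast
  have intV: "\<forall>\<^sub>F \<tau> in at_top. \<forall>i\<in>{1..p}. \<forall>j\<in>{1..r+1}. \<forall>n. integrable lborel (\<lambda>t. t ^ n * (exp (\<xi> i * t) * ?V \<tau> j t))"
    using transformed_moment_rate(2)[OF assms(2)] \<xi> by (auto intro!: eventually_ball_finite)
  have rate: "(\<lambda>\<tau>. moment (?V \<tau> j) (\<xi> i) n - moment (?U j) (\<xi> i) n) \<in> O[at_top](\<lambda>\<tau>. \<tau> powr (-1/2))"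
    if "i \<in> {1..p}" "j \<in> {1..r+1}" for i j n
    unfolding moment_def using transformed_moment_rate(1)[OF assms(2) that(2)] \<xi> that(1) by blast
  show ?thesis
    unfolding Let_def
  proof (intro conjI allI impI)
    fix m :: "nat \<Rightarrow> nat" assume m: "(\<Sum>i=1..p. m i) = (\<Sum>j=1..r+1. lam j) + 1"
    let ?M = "\<lambda>\<tau> e x. moment (?V \<tau> (fst e)) (\<xi> (fst x)) (snd e + snd x)"
    let ?S = "\<lambda>\<tau>. A_solutions (r+1) p lam m (?V \<tau>) (exp_col \<xi>)"
    have SH: "A_solutions (r+1) p lam m ?U (exp_col \<xi>) =
        system_kernel p m rows (\<lambda>e x. row_moment \<xi> (fst e) (fst x) (snd e + snd x))"
      by (rule A_solutions_eq_system_kernel) (rule intU)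
    have S: "\<forall>\<^sub>F \<tau> in at_top. ?S \<tau> = system_kernel p m rows (?M \<tau>)"
      using intV by eventually_elim (rule A_solutions_eq_system_kernel, blast)
    have card: "card rows < card (index_set p m)" unfolding card_rows card_index_set m by simp
    have det: "detected_by (system_kernel p m rows (\<lambda>e x. row_moment \<xi> (fst e) (fst x) (snd e + snd x))) (i, m i - 1)"
      if "i \<in> {1..p}" "m i > 0" for i
      by (rule A_detected[OF assms(3) \<xi> m that])
    \<comment> \<open>The balance makes the sum of the \<open>m i\<close> positive, so some
      component has a top coefficient that can serve as detecting position.\<close>
    have "\<exists>i\<in>{1..p}. m i > 0"
    proof (rule ccontr)
      assume "\<not> ?thesis"
      then have "(\<Sum>i=1..p. m i) = 0" by simp
      then show False using m by simp
    qed
    then obtain i where i: "i \<in> {1..p}" "m i > 0" by blast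
    then have x: "(i, m i - 1) \<in> index_set p m" by (simp add: index_set_def)
    have rate': "(\<lambda>\<tau>. ?M \<tau> e y - row_moment \<xi> (fst e) (fst y) (snd e + snd y)) \<in> O[at_top](\<lambda>\<tau>. \<tau> powr (-1/2))"
      if "e \<in> rows" "y \<in> index_set p m" for e y
      by (rule rate) (use that in \<open>auto simp: index_set_def\<close>)
    note c = perturbed_system[OF finite_index_set card x det[OF i] rate' S, folded SH]
    show "weakly_normal (A_solutions (r+1) p lam m ?U (exp_col \<xi>))" by (rule c(1))
    show "\<forall>\<^sub>F \<tau> in at_top. weakly_normal (?S \<tau>)" by (rule c(2))
    show "normalized_convergence p ?S (A_solutions (r+1) p lam m ?U (exp_col \<xi>))" by (rule c(3))
    show "\<forall>\<^sub>F \<tau> in at_top. strongly_normal p m (?S \<tau>)" 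
    proof (rule c(4))
      fix i assume i: "i \<in> {1..p}" "m i > 0"
      show "detected_by (A_solutions (r+1) p lam m ?U (exp_col \<xi>)) (i, m i - 1)"
        unfolding SH by (rule det[OF i])
    qed
  next
    fix m :: "nat \<Rightarrow> nat" assume m: "(\<Sum>j=1..r+1. lam j) = (\<Sum>i=1..p. m i) + 1"
    let ?M = "\<lambda>\<tau> e x. moment (?V \<tau> (fst x)) (\<xi> (fst e)) (snd e + snd x)"
    let ?S = "\<lambda>\<tau>. B_solutions (r+1) p lam m (?V \<tau>) (exp_col \<xi>)"
    have SH: "B_solutions (r+1) p lam m ?U (exp_col \<xi>) =
        system_kernel (r+1) lam (index_set p m) (\<lambda>e x. row_moment \<xi> (fst x) (fst e) (snd e + snd x))"
      by (rule B_solutions_eq_system_kernel) (rule intU)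
    have S: "\<forall>\<^sub>F \<tau> in at_top. ?S \<tau> = system_kernel (r+1) lam (index_set p m) (?M \<tau>)"
      using intV by eventually_elim (rule B_solutions_eq_system_kernel, blast)
    have card: "card (index_set p m) < card rows" unfolding card_rows card_index_set m by simp
    obtain x where x: "x \<in> rows" "detected_by (system_kernel (r+1) lam (index_set p m)
        (\<lambda>e x. row_moment \<xi> (fst x) (fst e) (snd e + snd x))) x"
      using B_detected[OF assms(3) \<xi> m] by blast
    have rate': "(\<lambda>\<tau>. ?M \<tau> e y - row_moment \<xi> (fst y) (fst e) (snd e + snd y)) \<in> O[at_top](\<lambda>\<tau>. \<tau> powr (-1/2))"
      if "e \<in> index_set p m" "y \<in> rows" for e y
      by (rule rate) (use that in \<open>auto simp: index_set_def\<close>)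
    note c = perturbed_system[OF finite_index_set card x rate' S, folded SH]
    show "weakly_normal (B_solutions (r+1) p lam m ?U (exp_col \<xi>))" by (rule c(1))
    show "\<forall>\<^sub>F \<tau> in at_top. weakly_normal (?S \<tau>)" by (rule c(2))
    show "normalized_convergence (r+1) ?S (B_solutions (r+1) p lam m ?U (exp_col \<xi>))" by (rule c(3))
    assume det: "\<forall>j\<in>{1..r+1}. lam j > 0 \<longrightarrow>
        Determinant.det (C_replaced r p \<rho> d a \<xi> lam m (j, lam j - 1)) \<noteq> 0"
    show "\<forall>\<^sub>F \<tau> in at_top. strongly_normal (r+1) lam (?S \<tau>)"
    proof (rule c(4))
      fix j assume j: "j \<in> {1..r+1}" "lam j > 0"
      show "detected_by (B_solutions (r+1) p lam m ?U (exp_col \<xi>)) (j, lam j - 1)"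
        unfolding SH by (rule B_detected_leading[OF assms(3) \<xi> m j]) (use det j in blast)
    qed
  qed
qed

end
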